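(* Let $(G,\boldsymbol{\gamma})$ be a colored graph. (1) If the colors lie in $\mathbb{Z}^2$, then $(G,\boldsymbol{\gamma})$ is a Ross-graph if and only if it can be constructed from a Ross base graph by a finite sequence of \textbf{(H1c)} and \textbf{(H2c)} moves. (2) If the colors lie in $\mathbb{Z}/p\mathbb{Z}$ with $p$ an odd prime, then $(G,\boldsymbol{\gamma})$ is a cone-Laman graph if and only if it can be constructed from a cone-Laman base graph by a finite sequence of \textbf{(H1c)}, \textbf{(H1c$'$)} and \textbf{(H2c)} moves. (3) If the colors lie in $\mathbb{Z}$, then $(G,\boldsymbol{\gamma})$ is a cylinder-Laman graph if and only if it can be constructed from a cylinder-Laman base graph by a finite sequence of \textbf{(H1c)} and \textbf{(H2c)} moves.
   Context: A $\Gamma$-colored graph $(G,\boldsymbol{\gamma})$ is a finite directed multigraph $G=(V,E)$ (self-loops and parallel edges allowed) together with a color $\gamma_e\in\Gamma$ on each edge $e$; here $\Gamma$ is an abelian group. For a cycle $C$ of $G$, $\rho(C)\in\Gamma$ is obtained by traversing $C$ in one direction, adding the colors of edges traversed forwards and subtracting the colors of edges traversed backwards. (Reversing an edge and negating its color changes nothing.) The $\rho$-image of a subgraph $G'$ is the subgroup of $\Gamma$ generated by the $\rho(C)$ for cycles $C$ of $G'$, and the $\rho$-rank of $G'$ is the rank of this subgroup (maximal number of linearly independent elements). For $\Gamma=\mathbb{Z}/p\mathbb{Z}$ it is $0$ if the $\rho$-image is trivial and $1$ otherwise; for $\Gamma=\mathbb{Z}$ it is $0$ or $1$; for $\Gamma=\mathbb{Z}^2$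 it is $0$, $1$ or $2$. For an edge-induced subgraph $G'$, let $n'$ be its number of vertices, $m'$ its number of edges, $r$ its $\rho$-rank, and $c'_i$ the number of its connected components of $\rho$-rank $i$. - $(G,\boldsymbol{\gamma})$ is Ross-sparse if $m'\le 2n'-3c'_0-2(c'_1+c'_2)$ for all such $G'$. - It is cone-Laman-sparse if $m'\le 2n'-3c'_0-c'_1-c'_2$ for all such $G'$. - It is cylinder-Laman-sparse if $m'\le 2n'+r-3c'_0-2(c'_1+c'_2)$ for all such $G'$. It is a Ross-graph (respectively cone-Laman graph, cylinder-Laman graph) if, in addition, the corresponding inequality holds with equality for $G'=G$. Moves (a new vertex is called $n$): - \textbf{(H1c)}: add a new vertex $n$ and two edges $an$, $bn$ oriented into $n$ from existing vertices $a,b$, with arbitrary colors, except that if $a=b$ the two colors must be different. - \textbf{(H1c$'$)} (lollipop): add a new vertex $n$, one edge $an$ from an existing vertex $a$ with arbitrary color, and a self-loop at $n$ with nonzero color. - \textbf{(H2c)}: choose an edge $ab$ with color $\gamma_{ab}$ and a vertex $c$, where $a,b,c$ are not necessarily distinct. Remove $ab$, add a new vertex $n$ and edges $an$, $bn$, $cn$ oriented into $n$, with $\gamma_{an}-\gamma_{bn}=\gamma_{ab}$ and $\gamma_{cn}$ arbitrary. If any of $a,b,c$ coincide, the parallel edges added must have pairwise different colors. Base graphs: - Cone-Laman base: a single vertex with one self-loop of nonzero color in $\mathbb{Z}/p\mathbb{Z}$. - Cylinder-Laman base: a single vertex with one self-loop of nonzero color in $\mathbb{Z}$. - Ross base: two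 vertices $1,2$ joined by two parallel edges with colors $\gamma_{12},\gamma_{(12)'}\in\mathbb{Z}^2$, which are different.
   Formalization: Ross-, cone-Laman and cylinder-Laman graphs are additionally required to be connected with nonzero ρ-rank, since a single edge on two vertices is sparse with equality but not constructible; constructions may also reverse edges while negating their colors. *)

theory Defs
  imports
    "Graph_Theory.Digraph_Component"
    "Berlekamp_Zassenhaus.Finite_Field"
    "HOL-Library.Product_Plus"
    "HOL-Computational_Algebra.Group_Closure"
begin

text \<open>
  A colored graph is a finite digraph \<open>G\<close> (loops and parallel arcs allowed, \<open>fin_digraph G\<close>)
  together with a function \<open>\<gamma>\<close> on arcs; the values of \<open>tail G\<close>, \<open>head G\<close> and \<open>\<gamma>\<close> outside
  \<open>arcs G\<close> are irrelevant. The group $\mathbb{Z}/p\mathbb{Z}$ is the type \<open>'p mod_ring\<close>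
  with \<open>p = CARD('p)\<close>.
\<close>

section \<open>Cycles, \<open>\<rho>\<close>-image and \<open>\<rho>\<close>-rank\<close>

text \<open>
  The arc \<open>(e, True)\<close> is \<open>e\<close> traversed forwards, \<open>(e, False)\<close> is \<open>e\<close> traversed backwards.
\<close>
definition traversals :: "('v, 'e) pre_digraph \<Rightarrow> ('v, 'e \<times> bool) pre_digraph" where
  "traversals G = \<lparr> verts = verts G, arcs = arcs G \<times> UNIV,
     tail = (\<lambda>(e, fwd). if fwd then tail G e else head G e),
     head = (\<lambda>(e, fwd). if fwd then head G e else tail G e) \<rparr>"

text \<open>
  A cycle of the underlying undirected multigraph, with a chosen start and direction.
  Distinctness of the underlying edges excludes traversing one edge back and forth; loops and
  pairs of parallel edges are cycles.
\<close>
definition undirected_cycle :: "('v, 'e) pre_digraph \<Rightarrow> ('e \<times> bool) list \<Rightarrow> bool" where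
  "undirected_cycle G p \<longleftrightarrow> pre_digraph.cycle (traversals G) p \<and> distinct (map fst p)"

definition rho :: "('e \<Rightarrow> 'g::ab_group_add) \<Rightarrow> ('e \<times> bool) list \<Rightarrow> 'g" where
  "rho \<gamma> p = (\<Sum>(e, fwd)\<leftarrow>p. if fwd then \<gamma> e else - \<gamma> e)"

definition rho_image :: "('v, 'e) pre_digraph \<Rightarrow> ('e \<Rightarrow> 'g::ab_group_add) \<Rightarrow> 'g set" where
  "rho_image G \<gamma> = group_closure {rho \<gamma> p | p. undirected_cycle G p}"

text \<open>
  The argument \<open>scale\<close> is the scalar multiplication with respect to which linear independence is
  understood: integer scalars for $\mathbb{Z}$ and $\mathbb{Z}^2$, and scalars in the field
  $\mathbb{Z}/p\mathbb{Z}$ for $\mathbb{Z}/p\mathbb{Z}$ (over the integers every element of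
  $\mathbb{Z}/p\mathbb{Z}$ would be dependent).
\<close>
definition lin_rank :: "('k::comm_ring_1 \<Rightarrow> 'g::ab_group_add \<Rightarrow> 'g) \<Rightarrow> 'g set \<Rightarrow> nat" where
  "lin_rank scale S = Max {card B | B. B \<subseteq> S \<and> finite B \<and> \<not> Modules.module.dependent scale B}"

definition rho_rank ::
  "('k::comm_ring_1 \<Rightarrow> 'g::ab_group_add \<Rightarrow> 'g) \<Rightarrow> ('v, 'e) pre_digraph \<Rightarrow> ('e \<Rightarrow> 'g) \<Rightarrow> nat" where
  "rho_rank scale G \<gamma> = lin_rank scale (rho_image G \<gamma>)"

definition int2_scale :: "int \<Rightarrow> int \<times> int \<Rightarrow> int \<times> int" where
  "int2_scale k x = (k * fst x, k * snd x)"


section \<open>Sparse colored graphs\<close>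

definition edge_induced :: "('v, 'e) pre_digraph \<Rightarrow> 'e set \<Rightarrow> ('v, 'e) pre_digraph" where
  "edge_induced G F = \<lparr> verts = tail G ` F \<union> head G ` F, arcs = F, tail = tail G, head = head G \<rparr>"

definition conn_components :: "('v, 'e) pre_digraph \<Rightarrow> ('v, 'e) pre_digraph set" where
  "conn_components G = (\<lambda>X. G \<restriction> X) ` pre_digraph.sccs_verts (with_proj (mk_symmetric G))"

definition num_comps ::
  "('k::comm_ring_1 \<Rightarrow> 'g::ab_group_add \<Rightarrow> 'g) \<Rightarrow> nat \<Rightarrow> ('v, 'e) pre_digraph \<Rightarrow> ('e \<Rightarrow> 'g) \<Rightarrow> int" where
  "num_comps scale i G \<gamma> = int (card {H \<in> conn_components G. rho_rank scale H \<gamma> = i})"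

definition num_verts :: "('v, 'e) pre_digraph \<Rightarrow> int" where
  "num_verts G = int (card (verts G))"

definition num_edges :: "('v, 'e) pre_digraph \<Rightarrow> int" where
  "num_edges G = int (card (arcs G))"

definition ross_bound :: "('v, 'e) pre_digraph \<Rightarrow> ('e \<Rightarrow> int \<times> int) \<Rightarrow> int" where
  "ross_bound G \<gamma> = 2 * num_verts G - 3 * num_comps int2_scale 0 G \<gamma>
     - 2 * (num_comps int2_scale 1 G \<gamma> + num_comps int2_scale 2 G \<gamma>)"

definition cone_laman_bound :: "('v, 'e) pre_digraph \<Rightarrow> ('e \<Rightarrow> 'p::prime_card mod_ring) \<Rightarrow> int" where
  "cone_laman_bound G \<gamma> = 2 * num_verts G - 3 * num_comps (*) 0 G \<gamma>
     - num_comps (*) 1 G \<gamma> - num_comps (*) 2 G \<gamma>"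

definition cylinder_laman_bound :: "('v, 'e) pre_digraph \<Rightarrow> ('e \<Rightarrow> int) \<Rightarrow> int" where
  "cylinder_laman_bound G \<gamma> = 2 * num_verts G + int (rho_rank (*) G \<gamma>)
     - 3 * num_comps (*) 0 G \<gamma> - 2 * (num_comps (*) 1 G \<gamma> + num_comps (*) 2 G \<gamma>)"

definition ross_sparse :: "('v, 'e) pre_digraph \<Rightarrow> ('e \<Rightarrow> int \<times> int) \<Rightarrow> bool" where
  "ross_sparse G \<gamma> \<longleftrightarrow>
     (\<forall>F \<subseteq> arcs G. num_edges (edge_induced G F) \<le> ross_bound (edge_induced G F) \<gamma>)"

definition cone_laman_sparse :: "('v, 'e) pre_digraph \<Rightarrow> ('e \<Rightarrow> 'p::prime_card mod_ring) \<Rightarrow> bool" where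
  "cone_laman_sparse G \<gamma> \<longleftrightarrow>
     (\<forall>F \<subseteq> arcs G. num_edges (edge_induced G F) \<le> cone_laman_bound (edge_induced G F) \<gamma>)"

definition cylinder_laman_sparse :: "('v, 'e) pre_digraph \<Rightarrow> ('e \<Rightarrow> int) \<Rightarrow> bool" where
  "cylinder_laman_sparse G \<gamma> \<longleftrightarrow>
     (\<forall>F \<subseteq> arcs G. num_edges (edge_induced G F) \<le> cylinder_laman_bound (edge_induced G F) \<gamma>)"

text \<open>
  Equality in the bound alone does not fix the number of edges in terms of the number of vertices:
  it also holds for a single edge joining two vertices (one component of \<open>\<rho>\<close>-rank 0) and for
  disjoint unions of Ross-graphs or of cone-Laman graphs. Ross-graphs, cone-Laman graphs and
  cylinder-Laman graphs are the colored graphs for which, in addition, \<open>G\<close> is connected and has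
  nonzero \<open>\<rho>\<close>-rank, that is, the tight ones with $2n-2$, $2n-1$ and $2n-1$ edges, respectively.
\<close>
definition ross_graph :: "('v, 'e) pre_digraph \<Rightarrow> ('e \<Rightarrow> int \<times> int) \<Rightarrow> bool" where
  "ross_graph G \<gamma> \<longleftrightarrow> ross_sparse G \<gamma> \<and> num_edges G = ross_bound G \<gamma>
     \<and> connected G \<and> rho_rank int2_scale G \<gamma> \<noteq> 0"

definition cone_laman_graph :: "('v, 'e) pre_digraph \<Rightarrow> ('e \<Rightarrow> 'p::prime_card mod_ring) \<Rightarrow> bool" where
  "cone_laman_graph G \<gamma> \<longleftrightarrow> cone_laman_sparse G \<gamma> \<and> num_edges G = cone_laman_bound G \<gamma>
     \<and> connected G \<and> rho_rank (*) G \<gamma> \<noteq> 0"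

definition cylinder_laman_graph :: "('v, 'e) pre_digraph \<Rightarrow> ('e \<Rightarrow> int) \<Rightarrow> bool" where
  "cylinder_laman_graph G \<gamma> \<longleftrightarrow> cylinder_laman_sparse G \<gamma> \<and> num_edges G = cylinder_laman_bound G \<gamma>
     \<and> connected G \<and> rho_rank (*) G \<gamma> \<noteq> 0"


section \<open>Henneberg moves\<close>

text \<open>
  \<open>extends_by H \<delta> F n N G \<gamma>\<close>: \<open>(G, \<gamma>)\<close> arises from \<open>(H, \<delta>)\<close> by keeping only the edges in
  \<open>F\<close>, adding the new vertex \<open>n\<close> and the set \<open>N\<close> of new edges. An edge of \<open>H\<close> that has been
  removed may have its name reused in \<open>N\<close>.
\<close>
definition extends_by ::
  "('v, 'e) pre_digraph \<Rightarrow> ('e \<Rightarrow> 'g) \<Rightarrow> 'e set \<Rightarrow> 'v \<Rightarrow> 'e set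
     \<Rightarrow> ('v, 'e) pre_digraph \<Rightarrow> ('e \<Rightarrow> 'g) \<Rightarrow> bool" where
  "extends_by H \<delta> F n N G \<gamma> \<longleftrightarrow>
     n \<notin> verts H \<and> verts G = insert n (verts H) \<and>
     F \<subseteq> arcs H \<and> F \<inter> N = {} \<and> arcs G = F \<union> N \<and>
     (\<forall>e \<in> F. tail G e = tail H e \<and> head G e = head H e \<and> \<gamma> e = \<delta> e)"

definition H1c ::
  "('v, 'e) pre_digraph \<Rightarrow> ('e \<Rightarrow> 'g) \<Rightarrow> ('v, 'e) pre_digraph \<Rightarrow> ('e \<Rightarrow> 'g) \<Rightarrow> bool" where
  "H1c H \<delta> G \<gamma> \<longleftrightarrow> (\<exists>n a b an bn.
     a \<in> verts H \<and> b \<in> verts H \<and> an \<noteq> bn \<and>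
     extends_by H \<delta> (arcs H) n {an, bn} G \<gamma> \<and>
     tail G an = a \<and> head G an = n \<and> tail G bn = b \<and> head G bn = n \<and>
     (a = b \<longrightarrow> \<gamma> an \<noteq> \<gamma> bn))"

definition H1c_lollipop ::
  "('v, 'e) pre_digraph \<Rightarrow> ('e \<Rightarrow> 'g::zero) \<Rightarrow> ('v, 'e) pre_digraph \<Rightarrow> ('e \<Rightarrow> 'g) \<Rightarrow> bool" where
  "H1c_lollipop H \<delta> G \<gamma> \<longleftrightarrow> (\<exists>n a an l.
     a \<in> verts H \<and> an \<noteq> l \<and>
     extends_by H \<delta> (arcs H) n {an, l} G \<gamma> \<and>
     tail G an = a \<and> head G an = n \<and> tail G l = n \<and> head G l = n \<and> \<gamma> l \<noteq> 0)"

definition H2c ::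
  "('v, 'e) pre_digraph \<Rightarrow> ('e \<Rightarrow> 'g::minus) \<Rightarrow> ('v, 'e) pre_digraph \<Rightarrow> ('e \<Rightarrow> 'g) \<Rightarrow> bool" where
  "H2c H \<delta> G \<gamma> \<longleftrightarrow> (\<exists>n a b c ab an bn cn.
     ab \<in> arcs H \<and> tail H ab = a \<and> head H ab = b \<and> c \<in> verts H \<and>
     an \<noteq> bn \<and> an \<noteq> cn \<and> bn \<noteq> cn \<and>
     extends_by H \<delta> (arcs H - {ab}) n {an, bn, cn} G \<gamma> \<and>
     tail G an = a \<and> head G an = n \<and> tail G bn = b \<and> head G bn = n \<and> tail G cn = c \<and> head G cn = n \<and>
     \<gamma> an - \<gamma> bn = \<delta> ab \<and>
     (a = b \<longrightarrow> \<gamma> an \<noteq> \<gamma> bn) \<and> (a = c \<longrightarrow> \<gamma> an \<noteq> \<gamma> cn) \<and> (b = c \<longrightarrow> \<gamma> bn \<noteq> \<gamma> cn))"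

text \<open>
  Reversing edges and negating their colors does not change a colored graph; \<open>reorients\<close>
  is the resulting equivalence of colored graphs.
\<close>
definition reorients ::
  "('v, 'e) pre_digraph \<Rightarrow> ('e \<Rightarrow> 'g::uminus) \<Rightarrow> ('v, 'e) pre_digraph \<Rightarrow> ('e \<Rightarrow> 'g) \<Rightarrow> bool" where
  "reorients H \<delta> G \<gamma> \<longleftrightarrow> verts G = verts H \<and> arcs G = arcs H \<and>
     (\<forall>e \<in> arcs H.
        tail G e = tail H e \<and> head G e = head H e \<and> \<gamma> e = \<delta> e \<or>
        tail G e = head H e \<and> head G e = tail H e \<and> \<gamma> e = - \<delta> e)"

definition loop_base :: "('v, 'e) pre_digraph \<Rightarrow> ('e \<Rightarrow> 'g::zero) \<Rightarrow> bool" where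
  "loop_base G \<gamma> \<longleftrightarrow> (\<exists>v l. verts G = {v} \<and> arcs G = {l} \<and> tail G l = v \<and> head G l = v \<and> \<gamma> l \<noteq> 0)"

definition ross_base :: "('v, 'e) pre_digraph \<Rightarrow> ('e \<Rightarrow> int \<times> int) \<Rightarrow> bool" where
  "ross_base G \<gamma> \<longleftrightarrow> (\<exists>u v e f. u \<noteq> v \<and> e \<noteq> f \<and> verts G = {u, v} \<and> arcs G = {e, f} \<and>
     tail G e = u \<and> head G e = v \<and> tail G f = u \<and> head G f = v \<and> \<gamma> e \<noteq> \<gamma> f)"

inductive ross_constructible :: "('v, 'e) pre_digraph \<Rightarrow> ('e \<Rightarrow> int \<times> int) \<Rightarrow> bool" where
  base: "ross_base G \<gamma> \<Longrightarrow> ross_constructible G \<gamma>"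
| H1c: "ross_constructible H \<delta> \<Longrightarrow> H1c H \<delta> G \<gamma> \<Longrightarrow> ross_constructible G \<gamma>"
| H2c: "ross_constructible H \<delta> \<Longrightarrow> H2c H \<delta> G \<gamma> \<Longrightarrow> ross_constructible G \<gamma>"
| reorients: "ross_constructible H \<delta> \<Longrightarrow> reorients H \<delta> G \<gamma> \<Longrightarrow> ross_constructible G \<gamma>"

inductive cone_laman_constructible ::
  "('v, 'e) pre_digraph \<Rightarrow> ('e \<Rightarrow> 'p::prime_card mod_ring) \<Rightarrow> bool" where
  base: "loop_base G \<gamma> \<Longrightarrow> cone_laman_constructible G \<gamma>"
| H1c: "cone_laman_constructible H \<delta> \<Longrightarrow> H1c H \<delta> G \<gamma> \<Longrightarrow> cone_laman_constructible G \<gamma>"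
| H1c_lollipop:
    "cone_laman_constructible H \<delta> \<Longrightarrow> H1c_lollipop H \<delta> G \<gamma> \<Longrightarrow> cone_laman_constructible G \<gamma>"
| H2c: "cone_laman_constructible H \<delta> \<Longrightarrow> H2c H \<delta> G \<gamma> \<Longrightarrow> cone_laman_constructible G \<gamma>"
| reorients: "cone_laman_constructible H \<delta> \<Longrightarrow> reorients H \<delta> G \<gamma> \<Longrightarrow> cone_laman_constructible G \<gamma>"

inductive cylinder_laman_constructible :: "('v, 'e) pre_digraph \<Rightarrow> ('e \<Rightarrow> int) \<Rightarrow> bool" where
  base: "loop_base G \<gamma> \<Longrightarrow> cylinder_laman_constructible G \<gamma>"
| H1c: "cylinder_laman_constructible H \<delta> \<Longrightarrow> H1c H \<delta> G \<gamma> \<Longrightarrow> cylinder_laman_constructible G \<gamma>"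
| H2c: "cylinder_laman_constructible H \<delta> \<Longrightarrow> H2c H \<delta> G \<gamma> \<Longrightarrow> cylinder_laman_constructible G \<gamma>"
| reorients:
    "cylinder_laman_constructible H \<delta> \<Longrightarrow> reorients H \<delta> G \<gamma> \<Longrightarrow> cylinder_laman_constructible G \<gamma>"

end

theory Submission
  imports Defs
begin

text \<open>
  A set of edges has \<open>\<rho>\<close>-rank 0 iff its colors are differences of a vertex potential. Hence all three
  families are described by two counts that do not mention components: every nonempty edge
  set \<open>F\<close> satisfies \<open>|F| \<le> \<Phi>(F)\<close>, where \<open>\<Phi>\<close> is \<open>2n - 2\<close> (Ross), \<open>2n - 1\<close> (cone) or \<open>2r + 1\<close>
  with \<open>r\<close> the graphic rank (cylinder), and \<open>|F| \<le> 2n - 3\<close> if \<open>F\<close> has a potential. As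
  \<open>\<Phi>\<close> is submodular on intersecting sets, minimal violating sets satisfy circuit elimination, so sparse
  sets form a matroid.

  A tight graph has a vertex \<open>n\<close> of degree at most 3. Degree 2 and a loop at \<open>n\<close> are easy. If \<open>n\<close> has
  three neighbours \<open>a, b, c\<close> (not necessarily distinct) and none of the edges \<open>ab\<close>, \<open>bc\<close>, \<open>ac\<close> with the
  induced colors could be added to \<open>G - n\<close>, then all three lie in the closure of \<open>G - n\<close>. But together
  with any two of the edges at \<open>n\<close> they span the third one, contradicting sparsity of \<open>G\<close>.
\<close>


section \<open>Exchange from circuit elimination\<close>

text \<open>The \<open>\<rho>\<close>-rank matters only as zero or nonzero: components of rank 1 and
  of rank 2 carry the same weight in each bound, so the existence of a potential is all that has to
  be known, and one argument serves all three groups. The exception is the rank summand of the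
  cylinder bound, which is granted once for the whole set and not once per component. With c
  components this allows 2n + 1 - 2c edges, which is where the graphic rank n - c comes from; a
  function of n alone would not do. Undoing (H2c) directly would mean taking a blocking set for each
  of the three candidate edges and uniting them, where each blocker is balanced or not and the
  intersections may be disconnected. Circuit elimination carries out this uncrossing once, for two
  circuits. What is left of the three candidates is a count on the vertices a, b, c, n, where
  coinciding neighbours, and the loops and parallel edges that they cause, are settled by
  cases.\<close>

definition circuit :: "('a set \<Rightarrow> bool) \<Rightarrow> 'a set \<Rightarrow> bool" where
  "circuit indep C \<longleftrightarrow> \<not> indep C \<and> (\<forall>D. D \<subset> C \<longrightarrow> indep D)"

lemma exists_circuit:
  assumes "finite S" "\<not> indep S"
  shows "\<exists>C \<subseteq> S. circuit indep C"
  using assms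
proof (induction S rule: finite_psubset_induct)
  case (psubset S)
  show ?case
  proof (cases "\<forall>D. D \<subset> S \<longrightarrow> indep D")
    case True
    then show ?thesis using psubset.prems by (auto simp: circuit_def)
  next
    case False
    then obtain D where "D \<subset> S" "\<not> indep D" by auto
    then obtain C where "C \<subseteq> D" "circuit indep C" using psubset.IH[of D] by auto
    then show ?thesis using \<open>D \<subset> S\<close> by (intro exI[of _ C]) auto
  qed
qed

locale circuit_elimination =
  fixes indep :: "'a set \<Rightarrow> bool"
  assumes indep_subset: "indep B \<Longrightarrow> A \<subseteq> B \<Longrightarrow> indep A"
    and elimination: "finite C \<Longrightarrow> finite D \<Longrightarrow> circuit indep C \<Longrightarrow> circuit indep D \<Longrightarrow> C \<noteq> D
      \<Longrightarrow> e \<in> C \<Longrightarrow> e \<in> D \<Longrightarrow> \<not> indep (C \<union> D - {e})"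
begin

text \<open>Induction on \<open>card (I - J)\<close> for a supposedly larger \<open>J\<close>.
  Exchanging an \<open>f\<close> of \<open>J - I\<close> for an \<open>e\<close> of
  \<open>I - J\<close> keeps the size of \<open>J\<close> and brings it closer to \<open>I\<close>,
  so it must create a circuit. Two such circuits for different \<open>f\<close> both pass through
  \<open>e\<close>, and eliminating \<open>e\<close> leaves a dependent subset of
  \<open>J\<close>.\<close>

lemma card_le_card_maximal:
  assumes S: "finite S" and I: "I \<subseteq> S" "indep I" and max: "\<And>x. x \<in> S - I \<Longrightarrow> \<not> indep (insert x I)"
    and J: "J \<subseteq> S" "indep J"
  shows "card J \<le> card I"
  using J
proof (induction "card (I - J)" arbitrary: J rule: less_induct)
  case less
  have fin: "finite I" "finite J" using I less.prems S finite_subset by auto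
  show ?case
  proof (rule ccontr)
    assume "\<not> ?case"
    then have lt: "card I < card J" by simp
    show False
    proof (cases "I \<subseteq> J")
      case True
      moreover have "I \<noteq> J" using lt by auto
      ultimately obtain x where "x \<in> J" "x \<notin> I" by blast
      then show False
        using max[of x] less.prems True indep_subset[of J "insert x I"] by auto
    next
      case False
      then obtain e where e: "e \<in> I" "e \<notin> J" by blast
      have T: "\<exists>C \<subseteq> insert e J - {f}. circuit indep C" if f: "f \<in> J" "f \<notin> I" for f
      proof (rule exists_circuit)
        show "finite (insert e J - {f})" using fin by simp
        show "\<not> indep (insert e J - {f})"
        proof
          assume ind: "indep (insert e J - {f})"
          have "insert e J - {f} = insert e (J - {f})" using f e by auto
          then have c: "card (insert e J - {f}) = card J"
            using f e fin by (metis card.insert card.remove Diff_iff finite_Diff)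
          have "I - (insert e J - {f}) = I - J - {e}" using f by auto
          then have "card (I - (insert e J - {f})) < card (I - J)"
            using e fin by (metis Diff_iff card_Diff1_less finite_Diff)
          then have "card (insert e J - {f}) \<le> card I"
            using less.hyps[of "insert e J - {f}"] ind I e less.prems by auto
          then show False using c lt by simp
        qed
      qed
      have "\<not> J \<subseteq> I" using lt fin card_mono[of I J] by auto
      then obtain g where g: "g \<in> J" "g \<notin> I" by auto
      obtain C where C: "C \<subseteq> insert e J - {g}" "circuit indep C" using T[OF g] by auto
      \<comment> \<open>The second exchanged element \<open>h\<close> is taken from \<open>C\<close>
        itself; as \<open>D\<close> avoids \<open>h\<close>, the two circuits differ.\<close>
      have "\<not> C \<subseteq> I" using C I indep_subset by (auto simp: circuit_def)
      then obtain h where h: "h \<in> C" "h \<notin> I" by auto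
      then have "h \<in> J" using C e by auto
      obtain D where D: "D \<subseteq> insert e J - {h}" "circuit indep D" using T[OF \<open>h \<in> J\<close> h(2)] by auto
      have "\<not> X \<subseteq> J" if "circuit indep X" for X
        using that less.prems indep_subset[of J X] by (auto simp: circuit_def)
      then have eC: "e \<in> C" and eD: "e \<in> D" using C D by auto
      have "C \<noteq> D" using h D by auto
      have "finite C" "finite D" using C D fin by (meson finite_Diff finite_insert finite_subset)+
      then have "\<not> indep (C \<union> D - {e})" using elimination[OF _ _ C(2) D(2) \<open>C \<noteq> D\<close> eC eD] by simp
      moreover have "C \<union> D - {e} \<subseteq> J" using C D by auto
      ultimately show False using indep_subset[OF less.prems(2)] by simp
    qed
  qed
qed

lemma exists_maximal:
  assumes "finite S" "A \<subseteq> S" "indep A"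
  obtains B where "A \<subseteq> B" "B \<subseteq> S" "indep B" "\<And>x. x \<in> S - B \<Longrightarrow> \<not> indep (insert x B)"
proof -
  have "\<exists>B. A \<subseteq> B \<and> B \<subseteq> S \<and> indep B \<and> (\<forall>x \<in> S - B. \<not> indep (insert x B))"
    using assms(2,3)
  proof (induction "card (S - A)" arbitrary: A rule: less_induct)
    case less
    show ?case
    proof (cases "\<forall>x \<in> S - A. \<not> indep (insert x A)")
      case False
      then obtain x where x: "x \<in> S - A" "indep (insert x A)" by blast
      then have "card (S - insert x A) < card (S - A)"
        using assms(1) by (intro psubset_card_mono) auto
      then obtain B where "insert x A \<subseteq> B" "B \<subseteq> S" "indep B" "\<forall>x \<in> S - B. \<not> indep (insert x B)"
        using less.hyps[of "insert x A"] x less.prems by auto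
      then show ?thesis by (intro exI[of _ B]) auto
    qed (use less in auto)
  qed
  then show ?thesis using that by auto
qed

text \<open>A rank argument: \<open>K\<close> lies in the closure of \<open>I\<close>. Extend a
  basis \<open>B\<close> of \<open>K\<close> to a basis \<open>M\<close> of everything. Its part in
  \<open>I \<union> K\<close> has at most \<open>card I\<close> elements and it cannot contain all
  of \<open>N\<close>, so \<open>M\<close> is smaller than \<open>I \<union> N\<close>, which
  therefore cannot be independent.\<close>

lemma dependent_extension:
  assumes fin: "finite I" "finite K" "finite N" and disj: "N \<inter> (I \<union> K) = {}"
    and K: "\<And>x. x \<in> K - I \<Longrightarrow> \<not> indep (insert x I)"
    and N: "\<And>B. B \<subseteq> K \<Longrightarrow> indep B \<Longrightarrow> (\<And>x. x \<in> K - B \<Longrightarrow> \<not> indep (insert x B)) \<Longrightarrow> \<not> indep (B \<union> N)"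
  shows "\<not> indep (I \<union> N)"
proof
  assume ind: "indep (I \<union> N)"
  have "indep {}" "indep I" using indep_subset[OF ind] by auto
  obtain B where B: "B \<subseteq> K" "indep B" "\<And>x. x \<in> K - B \<Longrightarrow> \<not> indep (insert x B)"
    using exists_maximal[OF fin(2) _ \<open>indep {}\<close>] by auto
  let ?T = "I \<union> K \<union> N"
  obtain M where M: "B \<subseteq> M" "M \<subseteq> ?T" "indep M" "\<And>x. x \<in> ?T - M \<Longrightarrow> \<not> indep (insert x M)"
    using exists_maximal[of ?T B] B(1,2) fin by (metis finite_UnI le_supI1 le_supI2)
  have finM: "finite M" using M(2) fin by (meson finite_UnI finite_subset)
  have 1: "card (M \<inter> (I \<union> K)) \<le> card I"
    by (rule card_le_card_maximal[of "I \<union> K"]) (use fin \<open>indep I\<close> K indep_subset[OF M(3)] in auto)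
  have "\<not> N \<subseteq> M" using N[OF B] M(1,3) indep_subset[of M "B \<union> N"] by auto
  then have 2: "card (M \<inter> N) < card N" using fin by (intro psubset_card_mono) auto
  have "M = (M \<inter> (I \<union> K)) \<union> (M \<inter> N)" using M(2) by auto
  then have "card M = card (M \<inter> (I \<union> K)) + card (M \<inter> N)"
    using disj finM card_Un_disjoint[of "M \<inter> (I \<union> K)" "M \<inter> N"] by auto
  moreover have "card (I \<union> N) \<le> card M"
    by (rule card_le_card_maximal[of ?T]) (use fin M ind in auto)
  moreover have "card (I \<union> N) = card I + card N" using disj fin by (intro card_Un_disjoint) auto
  ultimately show False using 1 2 by linarith
qed

end


section \<open>Sparse sets of colored edges\<close>

text \<open>Edges carry their own ends and color, so a colored multigraph is a plain set; the label
  keeps apart parallel edges that agree in everything else.\<close>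

datatype ('l, 'v, 'g) edge = Edge (lab: 'l) (src: 'v) (dst: 'v) (col: 'g)

definition ends :: "('l, 'v, 'g) edge \<Rightarrow> 'v \<times> 'v" where
  "ends e = (src e, dst e)"

lemma Field_insert_ends [simp]: "Field (insert (ends x) R) = insert (src x) (insert (dst x) (Field R))"
  by (auto simp: Field_def ends_def)

abbreviation touched :: "('l, 'v, 'g) edge set \<Rightarrow> 'v set" where
  "touched F \<equiv> Field (ends ` F)"

lemma touched_conv: "touched F = src ` F \<union> dst ` F"
  by (force simp: Field_def ends_def)

lemma touched_mono: "A \<subseteq> B \<Longrightarrow> touched A \<subseteq> touched B"
  by (auto simp: touched_conv)

lemma finite_touched [simp]: "finite F \<Longrightarrow> finite (touched F)"
  by (auto simp: touched_conv)

definition balanced :: "('l, 'v, 'g::ab_group_add) edge set \<Rightarrow> bool" where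
  "balanced F \<longleftrightarrow> (\<exists>p. \<forall>e \<in> F. col e = p (dst e) - p (src e))"

lemma balanced_subset: "balanced B \<Longrightarrow> A \<subseteq> B \<Longrightarrow> balanced A"
  unfolding balanced_def by blast

text \<open>\<open>\<Phi>\<close> is applied to the set of end pairs, so it sees neither
  multiplicities nor colors and can be any suitable function of graphs; colors enter only through
  \<open>balanced\<close>.\<close>

definition sparse :: "('v rel \<Rightarrow> int) \<Rightarrow> ('l, 'v, 'g::ab_group_add) edge set \<Rightarrow> bool" where
  "sparse \<Phi> I \<longleftrightarrow> finite I \<and> (\<forall>F \<subseteq> I. F \<noteq> {} \<longrightarrow> int (card F) \<le> \<Phi> (ends ` F) \<and>
     (balanced F \<longrightarrow> int (card F) \<le> 2 * int (card (touched F)) - 3))"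

lemma sparse_subset: "sparse \<Phi> B \<Longrightarrow> A \<subseteq> B \<Longrightarrow> sparse \<Phi> A"
  unfolding sparse_def by (meson finite_subset subset_trans)

lemma sparse_empty [simp]: "sparse \<Phi> {}"
  by (simp add: sparse_def)

lemma sparse_finite: "sparse \<Phi> I \<Longrightarrow> finite I"
  by (simp add: sparse_def)

lemma sparse_bound: "sparse \<Phi> I \<Longrightarrow> I \<noteq> {} \<Longrightarrow> int (card I) \<le> \<Phi> (ends ` I)"
  by (simp add: sparse_def)

lemma sparse_balanced_bound:
  "sparse \<Phi> I \<Longrightarrow> I \<noteq> {} \<Longrightarrow> balanced I \<Longrightarrow> int (card I) \<le> 2 * int (card (touched I)) - 3"
  by (simp add: sparse_def)

text \<open>
  If the common part of two balanced sets, including isolated common vertices, is connected, then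
  their potentials differ by a constant on it and the union is balanced. Otherwise it splits,
  and then the count on the common part improves.
\<close>
lemma balanced_Un_or_split:
  fixes A B :: "('l, 'v, 'g::ab_group_add) edge set"
  assumes A: "balanced A" and B: "balanced B" and s: "s \<in> touched A \<inter> touched B"
  shows "balanced (A \<union> B) \<or>
    (\<exists>S. S \<inter> touched A \<inter> touched B \<noteq> {} \<and> touched A \<inter> touched B - S \<noteq> {} \<and>
      (\<forall>e \<in> A \<inter> B. src e \<in> S \<longleftrightarrow> dst e \<in> S))"
proof -
  obtain p where p: "\<forall>e \<in> A. col e = p (dst e) - p (src e)" using A by (auto simp: balanced_def)
  obtain q where q: "\<forall>e \<in> B. col e = q (dst e) - q (src e)" using B by (auto simp: balanced_def)
  define S where "S = {v. p v - q v = p s - q s}"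
  have inv: "src e \<in> S \<longleftrightarrow> dst e \<in> S" if "e \<in> A \<inter> B" for e
  proof -
    have "p (dst e) - p (src e) = q (dst e) - q (src e)" using p q that by (metis IntE)
    then have "p (dst e) - q (dst e) = p (src e) - q (src e)" by (simp add: algebra_simps)
    then show ?thesis by (simp add: S_def)
  qed
  show ?thesis
  proof (cases "touched A \<inter> touched B \<subseteq> S")
    case True
    \<comment> \<open>The potential of \<open>A\<close> is shifted by the constant difference at
      \<open>s\<close>, so that it agrees with \<open>q\<close> on the common vertices.\<close>
    define r where "r v = (if v \<in> touched A then p v - (p s - q s) else q v)" for v
    have rB: "r v = q v" if "v \<in> touched B" for v
    proof (cases "v \<in> touched A")
      case T: True
      then have "p v - q v = p s - q s" using True that by (auto simp: S_def)
      then show ?thesis using T by (simp add: r_def algebra_simps)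
    qed (simp add: r_def)
    have "col e = r (dst e) - r (src e)" if "e \<in> A \<union> B" for e
    proof (cases "e \<in> A")
      case True
      then have "src e \<in> touched A" "dst e \<in> touched A" by (auto simp: touched_conv)
      then show ?thesis using p True by (simp add: r_def)
    next
      case False
      then have "e \<in> B" using that by auto
      then have "src e \<in> touched B" "dst e \<in> touched B" by (auto simp: touched_conv)
      then show ?thesis using q \<open>e \<in> B\<close> rB by simp
    qed
    then show ?thesis unfolding balanced_def by blast
  next
    case False
    moreover have "s \<in> S" by (simp add: S_def)
    ultimately show ?thesis using inv s by blast
  qed
qed

text \<open>
  A count \<open>\<Phi>\<close> that equals \<open>2n - k\<close> on connected graphs. In \<open>components\<close> it may be smaller on
  disconnected graphs, which is only needed for the cylinder.
\<close>
locale count =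
  fixes \<Phi> :: "'v rel \<Rightarrow> int" and k :: int
  assumes k: "k = 1 \<or> k = 2"
    and mono: "finite S \<Longrightarrow> R \<subseteq> S \<Longrightarrow> R \<noteq> {} \<Longrightarrow> \<Phi> R \<le> \<Phi> S"
    and submodular: "finite R \<Longrightarrow> finite S \<Longrightarrow> R \<inter> S \<noteq> {} \<Longrightarrow> \<Phi> (R \<union> S) + \<Phi> (R \<inter> S) \<le> \<Phi> R + \<Phi> S"
    and upper: "finite R \<Longrightarrow> R \<noteq> {} \<Longrightarrow> \<Phi> R \<le> 2 * int (card (Field R)) - k"
    and single: "\<Phi> {(a, b)} = 2 * int (card {a, b}) - k"
    and new_vertex: "finite R \<Longrightarrow> R \<noteq> {} \<Longrightarrow> n \<notin> Field R \<Longrightarrow> a \<noteq> n \<Longrightarrow> \<Phi> R + 2 \<le> \<Phi> (insert (a, n) R)"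
    and split_edge: "finite R \<Longrightarrow> n \<notin> Field R \<Longrightarrow> a \<noteq> n \<Longrightarrow> b \<noteq> n
      \<Longrightarrow> \<Phi> (insert (a, b) R) + 2 \<le> \<Phi> (insert (a, n) (insert (b, n) R))"
    and symmetric: "R \<union> R\<inverse> = S \<union> S\<inverse> \<Longrightarrow> \<Phi> R = \<Phi> S"
    and components: "finite R \<Longrightarrow> R \<noteq> {} \<Longrightarrow> \<Phi> R = 2 * int (card (Field R)) - k \<or>
      (\<exists>R1 R2. R1 \<noteq> {} \<and> R2 \<noteq> {} \<and> R = R1 \<union> R2 \<and> Field R1 \<inter> Field R2 = {} \<and>
        \<Phi> R1 + \<Phi> R2 - (3 - k) \<le> \<Phi> R)"
begin

text \<open>On a connected set \<Phi> is 2n - k, and 2n - 3 is smaller by 3 - k. If the set falls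
  apart, each part gains 3 - k by induction, and recombining \<Phi> costs 3 - k only once, so one
  gain survives.\<close>

lemma balanced_count:
  assumes "sparse \<Phi> I" "I \<noteq> {}" "balanced I"
  shows "int (card I) \<le> \<Phi> (ends ` I) - (3 - k)"
  using assms
proof (induction "card I" arbitrary: I rule: less_induct)
  case less
  have fin: "finite I" using less.prems sparse_finite by blast
  consider "\<Phi> (ends ` I) = 2 * int (card (touched I)) - k"
    | R1 R2 where "R1 \<noteq> {}" "R2 \<noteq> {}" "ends ` I = R1 \<union> R2" "Field R1 \<inter> Field R2 = {}"
        "\<Phi> R1 + \<Phi> R2 - (3 - k) \<le> \<Phi> (ends ` I)"
    using components[of "ends ` I"] fin less.prems(2) by (metis finite_imageI image_is_empty)
  then show ?case
  proof cases
    case 1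
    then show ?thesis using sparse_balanced_bound[OF less.prems] by linarith
  next
    case 2
    define A where "A = {e \<in> I. ends e \<in> R1}"
    define B where "B = {e \<in> I. ends e \<in> R2}"
    have "R1 \<inter> R2 = {}" using 2(4) by (force simp: Field_def)
    then have AB: "I = A \<union> B" "A \<inter> B = {}"
      using 2(3) by (auto simp: A_def B_def)
    have "R1 \<subseteq> ends ` I" "R2 \<subseteq> ends ` I" using 2(3) by auto
    then have "ends ` A = R1" "ends ` B = R2" unfolding A_def B_def by blast+
    note AB = AB this
    then have ne: "A \<noteq> {}" "B \<noteq> {}" using 2 by auto
    have finAB: "finite A" "finite B" using fin AB by auto
    have c: "card I = card A + card B" using AB finAB card_Un_disjoint by auto
    then have lt: "card A < card I" "card B < card I" using ne finAB by (auto simp: card_gt_0_iff)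
    have "int (card A) \<le> \<Phi> R1 - (3 - k)" "int (card B) \<le> \<Phi> R2 - (3 - k)"
      using less.hyps[OF lt(1)] less.hyps[OF lt(2)] ne AB less.prems
        sparse_subset[of \<Phi> I] balanced_subset[of I] by auto
    then show ?thesis using 2(5) c k by linarith
  qed
qed

text \<open>Some nonempty subset violates a bound, and that subset is dependent for the same reason;
  minimality makes it the whole circuit.\<close>

lemma circuit_cases:
  assumes "circuit (sparse \<Phi>) C" "finite C"
  shows "C \<noteq> {}" "\<Phi> (ends ` C) < int (card C) \<or> (balanced C \<and> 2 * int (card (touched C)) - 3 < int (card C))"
proof -
  obtain F where F: "F \<subseteq> C" "F \<noteq> {}"
    "\<Phi> (ends ` F) < int (card F) \<or> (balanced F \<and> 2 * int (card (touched F)) - 3 < int (card F))"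
    using assms unfolding circuit_def sparse_def by (metis not_le)
  then have "\<not> sparse \<Phi> F" unfolding sparse_def by (metis not_le order_refl)
  then have "F = C" using assms F by (auto simp: circuit_def)
  then show "C \<noteq> {}" "\<Phi> (ends ` C) < int (card C) \<or> (balanced C \<and> 2 * int (card (touched C)) - 3 < int (card C))"
    using F by auto
qed

text \<open>Both circuits have at least 2n - 2 edges on their n vertices. If the union is balanced,
  the bound 2n - 3 on the common part leaves at least 2n - 1 edges in the union, so 2n - 2 without
  \<open>e\<close>, one too many for a balanced set. If not, the common part splits and has at most
  2n - 5 edges; then 2n edges remain without \<open>e\<close>, more than 2n - k.\<close>

lemma elimination_balanced_balanced:
  assumes fin: "finite C" "finite D" and D: "balanced D" "2 * int (card (touched D)) - 3 < int (card D)"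
    and C: "balanced C" "2 * int (card (touched C)) - 3 < int (card C)"
    and e: "e \<in> C" "e \<in> D" and sp: "sparse \<Phi> (C \<inter> D)" and ne: "C \<union> D - {e} \<noteq> {}"
  shows "\<not> sparse \<Phi> (C \<union> D - {e})"
proof
  assume U: "sparse \<Phi> (C \<union> D - {e})"
  let ?V = "touched C \<inter> touched D"
  have bal: "balanced (C \<inter> D)" using C balanced_subset by blast
  have tU: "touched (C \<union> D) = touched C \<union> touched D" by (auto simp: touched_conv)
  have cV: "int (card (touched C)) + int (card (touched D)) = int (card (touched (C \<union> D))) + int (card ?V)"
    using card_Un_Int[of "touched C" "touched D"] fin tU by simp
  have cE: "int (card C) + int (card D) = int (card (C \<union> D)) + int (card (C \<inter> D))"
    using card_Un_Int[of C D] fin by simp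
  have cU: "int (card (C \<union> D - {e})) = int (card (C \<union> D)) - 1"
    using e fin card_Suc_Diff1[of "C \<union> D" e] by simp
  have tle: "int (card (touched (C \<union> D - {e}))) \<le> int (card (touched (C \<union> D)))"
    using fin by (simp add: card_mono touched_mono)
  have e12: "src e \<in> ?V" using e by (auto simp: touched_conv)
  consider "balanced (C \<union> D)" | S where "S \<inter> ?V \<noteq> {}" "?V - S \<noteq> {}" "\<forall>e \<in> C \<inter> D. src e \<in> S \<longleftrightarrow> dst e \<in> S"
    using balanced_Un_or_split[OF C(1) D(1) e12] by (metis Int_assoc)
  then show False
  proof cases
    case 1
    have "int (card (C \<inter> D)) \<le> 2 * int (card (touched (C \<inter> D))) - 3"
      using sparse_balanced_bound[OF sp _ bal] e by auto
    moreover have "card (touched (C \<inter> D)) \<le> card ?V"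
      using fin by (intro card_mono) (auto simp: touched_conv)
    ultimately have "int (card (C \<inter> D)) \<le> 2 * int (card ?V) - 3" by linarith
    moreover have "int (card (C \<union> D - {e})) \<le> 2 * int (card (touched (C \<union> D - {e}))) - 3"
      using sparse_balanced_bound[OF U ne balanced_subset[OF 1]] by auto
    ultimately show False using C D cV cE cU tle by linarith
  next
    case 2
    define A where "A = {e \<in> C \<inter> D. src e \<in> S}"
    define B where "B = {e \<in> C \<inter> D. src e \<notin> S}"
    have AB: "C \<inter> D = A \<union> B" "A \<inter> B = {}" by (auto simp: A_def B_def)
    have tA: "touched A \<subseteq> ?V \<inter> S" and tB: "touched B \<subseteq> ?V - S"
      using 2(3) by (auto simp: A_def B_def touched_conv)
    \<comment> \<open>A side without edges still owns a vertex, which yields the 2 in place of 3.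
      One side does contain an edge, namely \<open>e\<close>, so the two sides together lose at
      least 5.\<close>
    have bnd: "int (card X) \<le> 2 * int (card W) - (if X = {} then 2 else 3)"
      if "X \<subseteq> C \<inter> D" "touched X \<subseteq> W" "finite W" "W \<noteq> {}" for X W
    proof (cases "X = {}")
      case True
      then show ?thesis using that by (simp add: Suc_le_eq card_gt_0_iff)
    next
      case False
      have "int (card X) \<le> 2 * int (card (touched X)) - 3"
        using sparse_balanced_bound[of \<Phi> X] False sparse_subset[OF sp that(1)] balanced_subset[OF bal that(1)]
        by auto
      moreover have "card (touched X) \<le> card W" using that card_mono by blast
      ultimately show ?thesis using False by simp
    qed
    have finV: "finite ?V" using fin by simp
    have "int (card A) \<le> 2 * int (card (?V \<inter> S)) - (if A = {} then 2 else 3)"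
      by (rule bnd) (use AB tA 2 finV in auto)
    moreover have "int (card B) \<le> 2 * int (card (?V - S)) - (if B = {} then 2 else 3)"
      by (rule bnd) (use AB tB 2 finV in auto)
    moreover have "A \<noteq> {} \<or> B \<noteq> {}" using AB e by auto
    moreover have "card (C \<inter> D) = card A + card B"
      using AB fin by (metis card_Un_disjoint finite_Int finite_Un)
    moreover have "card ?V = card (?V \<inter> S) + card (?V - S)"
      using finV by (metis card_Int_Diff)
    ultimately have "int (card (C \<inter> D)) \<le> 2 * int (card ?V) - 5" by (auto split: if_splits)
    moreover have "int (card (C \<union> D - {e})) \<le> \<Phi> (ends ` (C \<union> D - {e}))"
      using sparse_bound[OF U ne] .
    moreover have "\<Phi> (ends ` (C \<union> D - {e})) \<le> 2 * int (card (touched (C \<union> D - {e}))) - k"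
      using upper[of "ends ` (C \<union> D - {e})"] fin ne by blast
    ultimately show False using C D cV cE cU tle k by linarith
  qed
qed

text \<open>If both circuits exceed the count, this is the usual submodular uncrossing. A balanced
  \<open>C\<close> is only known to have at least 2n - 2 edges, which may be 3 - k short of
  exceeding the count; exactly this amount is regained by \<open>balanced_count\<close> on the
  balanced set \<open>C \<inter> D\<close>.\<close>

lemma elimination_with_count:
  assumes fin: "finite C" "finite D" and D: "\<Phi> (ends ` D) < int (card D)"
    and C: "\<Phi> (ends ` C) < int (card C) \<or> (balanced C \<and> 2 * int (card (touched C)) - 3 < int (card C))"
    and e: "e \<in> C" "e \<in> D" and sp: "sparse \<Phi> (C \<inter> D)" and ne: "C \<union> D - {e} \<noteq> {}"
  shows "\<not> sparse \<Phi> (C \<union> D - {e})"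
proof
  assume U: "sparse \<Phi> (C \<union> D - {e})"
  have cE: "int (card C) + int (card D) = int (card (C \<union> D)) + int (card (C \<inter> D))"
    using card_Un_Int[of C D] fin by simp
  have cU: "int (card (C \<union> D - {e})) = int (card (C \<union> D)) - 1"
    using e fin card_Suc_Diff1[of "C \<union> D" e] by simp
  have "\<Phi> (ends ` C \<union> ends ` D) + \<Phi> (ends ` C \<inter> ends ` D) \<le> \<Phi> (ends ` C) + \<Phi> (ends ` D)"
    using submodular[of "ends ` C" "ends ` D"] fin e by blast
  moreover have "\<Phi> (ends ` (C \<inter> D)) \<le> \<Phi> (ends ` C \<inter> ends ` D)"
    by (rule mono) (use fin e in auto)
  moreover have "\<Phi> (ends ` (C \<union> D - {e})) \<le> \<Phi> (ends ` C \<union> ends ` D)"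
    by (rule mono) (use fin ne in auto)
  moreover have "int (card (C \<union> D - {e})) \<le> \<Phi> (ends ` (C \<union> D - {e}))"
    using sparse_bound[OF U ne] .
  moreover have "int (card (C \<inter> D)) \<le> \<Phi> (ends ` (C \<inter> D))"
    using sparse_bound[OF sp] e by auto
  moreover have "int (card (C \<inter> D)) \<le> \<Phi> (ends ` (C \<inter> D)) - (3 - k)" if "balanced C"
    using balanced_count[OF sp] e balanced_subset[OF that] by auto
  moreover have "\<Phi> (ends ` C) \<le> 2 * int (card (touched C)) - k"
    using upper[of "ends ` C"] fin e by auto
  ultimately show False using C D cE cU by linarith
qed

sublocale circuit_elimination "sparse \<Phi> :: ('l, 'v, 'g::ab_group_add) edge set \<Rightarrow> bool"
proof
  fix A B :: "('l, 'v, 'g) edge set"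
  show "sparse \<Phi> B \<Longrightarrow> A \<subseteq> B \<Longrightarrow> sparse \<Phi> A" by (rule sparse_subset)
next
  fix C D :: "('l, 'v, 'g) edge set" and e
  assume *: "finite C" "finite D" "circuit (sparse \<Phi>) C" "circuit (sparse \<Phi>) D" "C \<noteq> D" "e \<in> C" "e \<in> D"
  have ne: "C \<union> D - {e} \<noteq> {}" using * by auto
  have "\<not> C \<subset> D" "\<not> D \<subset> C" using *(3,4) by (auto simp: circuit_def)
  then have "C \<inter> D \<subset> C" using *(5) by auto
  then have sp: "sparse \<Phi> (C \<inter> D)" using *(3) by (auto simp: circuit_def)
  have C: "\<Phi> (ends ` C) < int (card C) \<or> (balanced C \<and> 2 * int (card (touched C)) - 3 < int (card C))"
    and D: "\<Phi> (ends ` D) < int (card D) \<or> (balanced D \<and> 2 * int (card (touched D)) - 3 < int (card D))"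
    using circuit_cases * by auto
  show "\<not> sparse \<Phi> (C \<union> D - {e})"
  proof (cases "\<Phi> (ends ` D) < int (card D)")
    case True
    then show ?thesis using elimination_with_count[OF *(1,2) _ C *(6,7) sp ne] by simp
  next
    case False
    then show ?thesis
      using elimination_with_count[OF *(2,1) _ D *(7,6)] elimination_balanced_balanced[OF *(1,2) _ _ _ _ *(6,7) sp ne]
        C D sp ne by (metis Int_commute Un_commute)
  qed
qed

end


section \<open>Graphic rank\<close>

definition conn_rel :: "'v rel \<Rightarrow> 'v rel" where
  "conn_rel R = (R \<union> R\<inverse>)\<^sup>*"

lemma conn_rel_refl [simp]: "(x, x) \<in> conn_rel R"
  by (simp add: conn_rel_def)

lemma conn_rel_sym: "(x, y) \<in> conn_rel R \<Longrightarrow> (y, x) \<in> conn_rel R"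
  using sym_rtrancl[OF sym_Un_converse, of R] unfolding conn_rel_def by (meson symE)

lemma conn_rel_trans: "(x, y) \<in> conn_rel R \<Longrightarrow> (y, z) \<in> conn_rel R \<Longrightarrow> (x, z) \<in> conn_rel R"
  unfolding conn_rel_def by (rule rtrancl_trans)

lemma conn_rel_base: "(x, y) \<in> R \<Longrightarrow> (x, y) \<in> conn_rel R"
  unfolding conn_rel_def by auto

lemma conn_rel_mono: "R \<subseteq> S \<Longrightarrow> conn_rel R \<subseteq> conn_rel S"
  unfolding conn_rel_def by (intro rtrancl_mono) auto

lemma conn_rel_least:
  assumes "R \<subseteq> conn_rel S"
  shows "conn_rel R \<subseteq> conn_rel S"
proof -
  have "R \<union> R\<inverse> \<subseteq> conn_rel S" using assms by (auto intro: conn_rel_sym)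
  then show ?thesis unfolding conn_rel_def by (rule rtrancl_subset_rtrancl)
qed

lemma conn_rel_closed:
  assumes "\<And>u v. (u, v) \<in> R \<Longrightarrow> u \<in> S \<longleftrightarrow> v \<in> S" "(x, y) \<in> conn_rel R"
  shows "x \<in> S \<longleftrightarrow> y \<in> S"
  using assms(2) unfolding conn_rel_def by (induction rule: rtrancl_induct) (use assms(1) in auto)

lemma conn_rel_class_eq_iff: "conn_rel R `` {x} = conn_rel R `` {y} \<longleftrightarrow> (x, y) \<in> conn_rel R"
proof
  assume "conn_rel R `` {x} = conn_rel R `` {y}"
  then have "y \<in> conn_rel R `` {x}" by simp
  then show "(x, y) \<in> conn_rel R" by simp
next
  assume "(x, y) \<in> conn_rel R"
  then show "conn_rel R `` {x} = conn_rel R `` {y}"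
    using conn_rel_sym[of x y R] conn_rel_trans[of x y R] conn_rel_trans[of y x R] by auto
qed

lemma conn_rel_outside: "x \<notin> Field R \<Longrightarrow> conn_rel R `` {x} = {x}"
  using conn_rel_closed[of R "{x}" x] by (auto simp: Field_def)

text \<open>The rank in the graphic matroid of the underlying undirected graph, that is, the size of
  a spanning forest.\<close>

definition crank :: "'v rel \<Rightarrow> int" where
  "crank R = int (card (Field R)) - int (card (Field R // conn_rel R))"

text \<open>Each vertex outside \<open>Field R\<close> is a class of its own and cancels. Thus ranks
  of different relations can be compared over one common vertex set.\<close>

lemma crank_eq:
  assumes "finite V" "Field R \<subseteq> V"
  shows "int (card V) - int (card (V // conn_rel R)) = crank R"
proof -
  let ?E = "conn_rel R" and ?W = "V - Field R"
  have "V = Field R \<union> ?W" using assms by auto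
  then have "V // ?E = Field R // ?E \<union> ?W // ?E" unfolding quotient_def by auto
  moreover have W: "?W // ?E = (\<lambda>x. {x}) ` ?W"
    unfolding quotient_def using conn_rel_outside[of _ R] by auto
  moreover have "Field R // ?E \<inter> (\<lambda>x. {x}) ` ?W = {}"
    unfolding quotient_def by auto (metis conn_rel_refl Image_singleton_iff singletonD)
  moreover have "finite (Field R // ?E)" unfolding quotient_def using assms finite_subset by auto
  ultimately have "card (V // ?E) = card (Field R // ?E) + card ?W"
    using assms(1) by (simp add: card_Un_disjoint card_image)
  moreover have "card V = card (Field R) + card ?W"
    using assms by (metis card_Diff_subset card_mono finite_subset le_add_diff_inverse)
  ultimately show ?thesis unfolding crank_def by simp
qed

text \<open>Over a common vertex set, the new pair either stays inside one class or merges two. The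
  later comparisons of ranks follow from this by adding pairs one at a time.\<close>

lemma crank_insert:
  assumes fin: "finite R"
  shows "crank (insert (a, b) R) = crank R + (if (a, b) \<in> conn_rel R then 0 else 1)"
proof -
  let ?R' = "insert (a, b) R"
  let ?E = "conn_rel R" and ?E' = "conn_rel ?R'"
  define V where "V = Field ?R'"
  have V: "finite V" "Field R \<subseteq> V" "Field ?R' \<subseteq> V" "a \<in> V" "b \<in> V"
    using fin by (auto simp: V_def finite_Field)
  have eq: "crank R = int (card V) - int (card (V // ?E))" "crank ?R' = int (card V) - int (card (V // ?E'))"
    using crank_eq V by metis+
  have sub: "?E \<subseteq> ?E'" by (rule conn_rel_mono) auto
  show ?thesis
  proof (cases "(a, b) \<in> ?E")
    case True
    then have "?E' \<subseteq> ?E" using conn_rel_base by (intro conn_rel_least) auto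
    then show ?thesis using sub eq True by auto
  next
    case False
    let ?A = "?E `` {a}" and ?B = "?E `` {b}"
    have ab: "(a, b) \<in> ?E'" by (rule conn_rel_base) auto
    \<comment> \<open>Beyond the old relation, \<open>?E'\<close> relates exactly the points of the
      two merged classes.\<close>
    have E': "(x, y) \<in> ?E' \<longleftrightarrow> (x, y) \<in> ?E \<or> x \<in> ?A \<union> ?B \<and> y \<in> ?A \<union> ?B" for x y
    proof
      assume "(x, y) \<in> ?E'"
      then show "(x, y) \<in> ?E \<or> x \<in> ?A \<union> ?B \<and> y \<in> ?A \<union> ?B"
        unfolding conn_rel_def[of ?R']
      proof (induction rule: rtrancl_induct)
        case base
        then show ?case by simp
      next
        case (step y z)
        then consider "(y, z) \<in> ?E" | "y = a" "z = b" | "y = b" "z = a"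
          using conn_rel_base conn_rel_sym by (metis Un_iff converseD insert_iff prod.inject)
        then show ?case
        proof cases
          case 1
          then show ?thesis
            using step.IH conn_rel_trans[of x y R z] conn_rel_trans[of a y R z] conn_rel_trans[of b y R z] by auto
        next
          case 2
          then show ?thesis using step.IH conn_rel_sym[of x a R] by auto
        next
          case 3
          then show ?thesis using step.IH conn_rel_sym[of x b R] by auto
        qed
      qed
    next
      have "(x, a) \<in> ?E'" if "x \<in> ?A \<union> ?B" for x
      proof -
        from that have "(a, x) \<in> ?E' \<or> (b, x) \<in> ?E'" using sub by auto
        then have "(a, x) \<in> ?E'" using ab conn_rel_trans[of a b ?R' x] by auto
        then show ?thesis by (rule conn_rel_sym)
      qed
      then show "(x, y) \<in> ?E \<or> x \<in> ?A \<union> ?B \<and> y \<in> ?A \<union> ?B \<Longrightarrow> (x, y) \<in> ?E'"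
        using sub conn_rel_sym[of y a ?R'] conn_rel_trans[of x a ?R' y] by auto
    qed
    have in1: "?E' `` {x} = ?A \<union> ?B" if "x \<in> ?A \<union> ?B" for x
    proof -
      have "y \<in> ?A \<union> ?B" if "(x, y) \<in> ?E" for y
        using that \<open>x \<in> ?A \<union> ?B\<close> conn_rel_trans[of a x R y] conn_rel_trans[of b x R y] by auto
      then show ?thesis using that E' by auto
    qed
    have out: "?E' `` {x} = ?E `` {x}" if "x \<notin> ?A \<union> ?B" for x
      using that E' by auto
    have cl: "?E `` {x} = ?A \<or> ?E `` {x} = ?B" if "x \<in> ?A \<union> ?B" for x
      using that conn_rel_sym[of a x R] conn_rel_sym[of b x R] by (auto simp: conn_rel_class_eq_iff)
    have nc: "?E `` {x} \<noteq> ?A" "?E `` {x} \<noteq> ?B" if "x \<notin> ?A \<union> ?B" for x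
      using that conn_rel_sym[of x a R] conn_rel_sym[of x b R] by (simp_all add: conn_rel_class_eq_iff) blast+
    have q: "V // ?E' = insert (?A \<union> ?B) (V // ?E - {?A, ?B})"
    proof (rule subset_antisym; rule subsetI)
      fix X assume "X \<in> V // ?E'"
      then obtain x where "x \<in> V" "X = ?E' `` {x}" unfolding quotient_def by blast
      then show "X \<in> insert (?A \<union> ?B) (V // ?E - {?A, ?B})"
        using in1[of x] out[of x] nc[of x] unfolding quotient_def by (cases "x \<in> ?A \<union> ?B") auto
    next
      fix X assume X: "X \<in> insert (?A \<union> ?B) (V // ?E - {?A, ?B})"
      show "X \<in> V // ?E'"
      proof (cases "X = ?A \<union> ?B")
        case True
        have "a \<in> ?A \<union> ?B" by simp
        then have "X = ?E' `` {a}" using in1 True by blast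
        then show ?thesis using V unfolding quotient_def by blast
      next
        case False
        then obtain x where x: "x \<in> V" "X = ?E `` {x}" "X \<noteq> ?A" "X \<noteq> ?B"
          using X unfolding quotient_def by blast
        then have "x \<notin> ?A \<union> ?B" using cl by blast
        then have "X = ?E' `` {x}" using out x by blast
        then show ?thesis using x unfolding quotient_def by blast
      qed
    qed
    \<comment> \<open>The merged class is not an old one, so removing two classes and inserting one
      lowers their number by exactly one.\<close>
    have "?A \<union> ?B \<notin> V // ?E"
    proof
      assume "?A \<union> ?B \<in> V // ?E"
      then obtain x where "?A \<union> ?B = ?E `` {x}" unfolding quotient_def by blast
      then have x: "?E `` {x} = ?A \<union> ?B" by simp
      have "a \<in> ?E `` {x}" "b \<in> ?E `` {x}" unfolding x by simp_all
      then have "(x, a) \<in> ?E" "(x, b) \<in> ?E" by simp_all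
      then show False using False conn_rel_sym[of x a R] conn_rel_trans[of a x R b] by simp
    qed
    moreover have "?A \<noteq> ?B" using False conn_rel_class_eq_iff by metis
    moreover have "?A \<in> V // ?E" "?B \<in> V // ?E" using V unfolding quotient_def by auto
    moreover have "finite (V // ?E)" using V unfolding quotient_def by auto
    moreover have "card (V // ?E) = card (V // ?E - {?A, ?B}) + card {?A, ?B}"
      using card_Int_Diff[of "V // ?E" "{?A, ?B}"] calculation(3,4,5) by (simp add: Int_absorb1)
    ultimately have "Suc (card (V // ?E')) = card (V // ?E)"
      unfolding q by simp
    then show ?thesis using eq False by simp
  qed
qed

lemma crank_empty [simp]: "crank {} = 0"
  by (simp add: crank_def quotient_def)

text \<open>A pair that joins two components of the larger graph \<open>B \<union> T\<close> also
  joins two components of \<open>A \<union> T\<close>.\<close>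

lemma crank_diminishing:
  assumes "finite T" "finite B" "A \<subseteq> B"
  shows "crank (B \<union> T) - crank B \<le> crank (A \<union> T) - crank A"
  using assms(1)
proof (induction T)
  case empty
  then show ?case by simp
next
  case (insert t T)
  obtain a b where t: "t = (a, b)" by force
  have "conn_rel (A \<union> T) \<subseteq> conn_rel (B \<union> T)" using assms by (intro conn_rel_mono) auto
  moreover have "finite (A \<union> T)" "finite (B \<union> T)" using assms insert finite_subset by auto
  ultimately show ?case using insert.IH by (auto simp: t crank_insert)
qed

lemma crank_submodular:
  assumes "finite R" "finite S"
  shows "crank (R \<union> S) + crank (R \<inter> S) \<le> crank R + crank S"
proof -
  have "crank (S \<union> (R - S)) - crank S \<le> crank (R \<inter> S \<union> (R - S)) - crank (R \<inter> S)"
    using assms by (intro crank_diminishing) auto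
  moreover have "S \<union> (R - S) = R \<union> S" "R \<inter> S \<union> (R - S) = R" by auto
  ultimately show ?thesis by simp
qed

lemma crank_mono_Un:
  assumes "finite T" "finite R"
  shows "crank R \<le> crank (R \<union> T)"
  using assms(1)
proof (induction T)
  case (insert t T)
  obtain a b where t: "t = (a, b)" by force
  then show ?case using insert assms by (auto simp: crank_insert)
qed simp

lemma crank_mono:
  assumes "finite S" "R \<subseteq> S"
  shows "crank R \<le> crank S"
  using crank_mono_Un[of S R] assms finite_subset by (metis sup.absorb2)

lemma crank_upper:
  assumes "finite R" "R \<noteq> {}"
  shows "crank R \<le> int (card (Field R)) - 1"
proof -
  have "Field R \<noteq> {}" using assms by (force simp: Field_def)
  then have "Field R // conn_rel R \<noteq> {}" unfolding quotient_def by auto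
  moreover have "finite (Field R // conn_rel R)"
    using assms by (simp add: quotient_def finite_Field)
  ultimately have "card (Field R // conn_rel R) \<ge> 1" by (simp add: Suc_le_eq card_gt_0_iff)
  then show ?thesis unfolding crank_def by linarith
qed

text \<open>When \<open>S\<close> is added pair by pair, the pairs of \<open>R\<close> never connect
  the ends of a pair of \<open>S\<close>: the \<open>S\<close>-class of \<open>a\<close> lies in
  \<open>insert a (Field S)\<close> and is closed under \<open>R\<close> as well.\<close>

lemma crank_disjoint:
  assumes "finite S" "finite R" "Field R \<inter> Field S = {}"
  shows "crank (R \<union> S) = crank R + crank S"
  using assms(1,3)
proof (induction S)
  case (insert t S)
  obtain a b where t: "t = (a, b)" by force
  have disj: "Field R \<inter> Field S = {}" and a: "a \<notin> Field R" using insert.prems by (auto simp: t Field_def)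
  have "(a, b) \<in> conn_rel S" if ab: "(a, b) \<in> conn_rel (R \<union> S)"
  proof -
    have closed: "u \<in> conn_rel S `` {a} \<longleftrightarrow> v \<in> conn_rel S `` {a}" if uv: "(u, v) \<in> R \<union> S" for u v
    proof (cases "(u, v) \<in> S")
      case True
      then show ?thesis using conn_rel_base conn_rel_sym conn_rel_trans by (metis Image_singleton_iff)
    next
      case False
      then have "u \<in> Field R" "v \<in> Field R" using uv by (auto simp: Field_def)
      moreover have "conn_rel S `` {a} \<subseteq> insert a (Field S)"
        using conn_rel_closed[of S "insert a (Field S)" a] by (auto simp: Field_def)
      ultimately show ?thesis using disj a by blast
    qed
    show ?thesis using conn_rel_closed[OF closed ab] by simp
  qed
  moreover have "conn_rel S \<subseteq> conn_rel (R \<union> S)" by (rule conn_rel_mono) auto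
  ultimately show ?case using insert.IH disj insert.hyps assms(2) by (auto simp: t crank_insert)
qed simp

lemma conn_rel_new_vertex: "n \<notin> Field R \<Longrightarrow> a \<noteq> n \<Longrightarrow> (a, n) \<notin> conn_rel R"
  using conn_rel_outside conn_rel_sym by fastforce

text \<open>In the subdivided graph the path through \<open>n\<close> makes \<open>(a, b)\<close>
  redundant, so its rank is at least that of \<open>insert (a, b) R\<close> with a pendant vertex
  \<open>n\<close> attached.\<close>

lemma crank_split_edge:
  assumes fin: "finite R" and n: "n \<notin> Field R" "a \<noteq> n" "b \<noteq> n"
  shows "crank (insert (a, b) R) + 1 \<le> crank (insert (a, n) (insert (b, n) R))"
proof -
  let ?S = "insert (a, n) (insert (b, n) R)"
  have "(a, n) \<in> conn_rel ?S" "(b, n) \<in> conn_rel ?S" by (rule conn_rel_base; simp)+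
  then have "(a, b) \<in> conn_rel ?S" using conn_rel_sym conn_rel_trans by metis
  then have "crank (insert (a, b) ?S) = crank ?S" using fin by (simp add: crank_insert)
  moreover have "crank (insert (a, n) (insert (a, b) R)) \<le> crank (insert (a, b) ?S)"
    using fin by (intro crank_mono) auto
  moreover have "n \<notin> Field (insert (a, b) R)" using n by (auto simp: Field_def)
  then have "crank (insert (a, n) (insert (a, b) R)) = crank (insert (a, b) R) + 1"
    using crank_insert[of "insert (a, b) R" a n] conn_rel_new_vertex[of n "insert (a, b) R" a] n fin by simp
  ultimately show ?thesis by simp
qed

lemma Field_symmetric: "R \<union> R\<inverse> = S \<union> S\<inverse> \<Longrightarrow> Field R = Field S"
  by (metis Field_Un Field_converse sup.idem)

lemma crank_components:
  assumes fin: "finite R" "R \<noteq> {}"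
  shows "crank R = int (card (Field R)) - 1 \<or>
      (\<exists>R1 R2. R1 \<noteq> {} \<and> R2 \<noteq> {} \<and> R = R1 \<union> R2 \<and> Field R1 \<inter> Field R2 = {})"
proof -
  obtain a b where ab: "(a, b) \<in> R" using fin by auto
  let ?X = "conn_rel R `` {a}"
  have closed: "u \<in> ?X \<longleftrightarrow> v \<in> ?X" if "(u, v) \<in> R" for u v
    using that conn_rel_base conn_rel_sym conn_rel_trans by (metis Image_singleton_iff)
  show ?thesis
  proof (cases "Field R \<subseteq> ?X")
    case True
    then have "conn_rel R `` {x} = ?X" if "x \<in> Field R" for x
      using that conn_rel_class_eq_iff[of R a x] by auto
    then have "Field R // conn_rel R = {?X}"
      unfolding quotient_def using ab by (force simp: Field_def)
    then show ?thesis by (simp add: crank_def)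
  next
    case False
    define R1 where "R1 = {t \<in> R. fst t \<in> ?X}"
    define R2 where "R2 = {t \<in> R. fst t \<notin> ?X}"
    have "Field R1 \<subseteq> ?X" "Field R2 \<subseteq> - ?X" unfolding R1_def R2_def using closed by (auto simp: Field_def)
    then have "Field R1 \<inter> Field R2 = {}" by auto
    moreover have "(a, b) \<in> R1" using ab by (simp add: R1_def)
    moreover have "R = R1 \<union> R2" by (auto simp: R1_def R2_def)
    moreover have "R2 \<noteq> {}" using False closed by (auto simp: R2_def Field_def)
    ultimately show ?thesis by blast
  qed
qed


section \<open>The three counts\<close>

lemma Field_insert_pair: "Field (insert (a, b) R) = insert a (insert b (Field R))"
  by (auto simp: Field_def)

lemma count_vertices:
  assumes k: "k = 1 \<or> k = 2"
  shows "count (\<lambda>R :: 'v rel. 2 * int (card (Field R)) - k) k"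
proof
  fix R S :: "'v rel"
  assume "finite R" "finite S" "R \<inter> S \<noteq> {}"
  moreover have "Field (R \<inter> S) \<subseteq> Field R \<inter> Field S" by (auto simp: Field_def)
  ultimately have "card (Field (R \<inter> S)) \<le> card (Field R \<inter> Field S)"
    by (intro card_mono) (auto simp: finite_Field)
  moreover have "card (Field R) + card (Field S) = card (Field (R \<union> S)) + card (Field R \<inter> Field S)"
    using card_Un_Int[of "Field R" "Field S"] \<open>finite R\<close> \<open>finite S\<close> by (simp add: finite_Field)
  ultimately show "2 * int (card (Field (R \<union> S))) - k + (2 * int (card (Field (R \<inter> S))) - k)
      \<le> 2 * int (card (Field R)) - k + (2 * int (card (Field S)) - k)" by linarith
next
  fix R :: "'v rel" and n a
  assume *: "finite R" "n \<notin> Field R" "a \<noteq> n"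
  then have "card (insert n (Field R)) \<le> card (Field (insert (a, n) R))"
    by (intro card_mono) (auto simp: finite_Field Field_insert_pair)
  then show "2 * int (card (Field R)) - k + 2 \<le> 2 * int (card (Field (insert (a, n) R))) - k"
    using * by (simp add: finite_Field)
next
  fix R :: "'v rel" and n a b
  assume *: "finite R" "n \<notin> Field R" "a \<noteq> n" "b \<noteq> n"
  have "Field (insert (a, n) (insert (b, n) R)) = insert n (Field (insert (a, b) R))"
    by (auto simp: Field_insert_pair)
  moreover have "n \<notin> Field (insert (a, b) R)" using * by (auto simp: Field_insert_pair)
  ultimately show "2 * int (card (Field (insert (a, b) R))) - k + 2
      \<le> 2 * int (card (Field (insert (a, n) (insert (b, n) R)))) - k"
    using * by (simp add: finite_Field)
next
  fix R S :: "'v rel"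
  assume "finite S" "R \<subseteq> S"
  then have "card (Field R) \<le> card (Field S)"
    using mono_Field by (intro card_mono) (auto simp: finite_Field monoD)
  then show "2 * int (card (Field R)) - k \<le> 2 * int (card (Field S)) - k" by simp
next
  fix R S :: "'v rel"
  assume "R \<union> R\<inverse> = S \<union> S\<inverse>"
  then show "2 * int (card (Field R)) - k = 2 * int (card (Field S)) - k"
    using Field_symmetric by metis
next
  fix a b :: 'v
  show "2 * int (card (Field {(a, b)})) - k = 2 * int (card {a, b}) - k"
    by (simp add: Field_insert_pair)
qed (use k in auto)

text \<open>Here the second alternative of \<open>components\<close> occurs: \<open>crank\<close> is
  additive on disjoint parts, so the two constants 1 exceed the single one by 1, within the slack 3
  - k = 2.\<close>

lemma count_crank: "count (\<lambda>R :: 'v rel. 2 * crank R + 1) 1"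
proof
  fix R S :: "'v rel"
  assume *: "finite R" "finite S"
  show "2 * crank (R \<union> S) + 1 + (2 * crank (R \<inter> S) + 1) \<le> 2 * crank R + 1 + (2 * crank S + 1)"
    using crank_submodular[OF *] by simp
next
  fix R :: "'v rel"
  assume "finite R" "R \<noteq> {}"
  then show "2 * crank R + 1 \<le> 2 * int (card (Field R)) - 1" using crank_upper[of R] by simp
next
  fix a b :: 'v
  have "(a, b) \<in> conn_rel {} \<longleftrightarrow> a = b" by (auto simp: conn_rel_def)
  then show "2 * crank {(a, b)} + 1 = 2 * int (card {a, b}) - 1"
    using crank_insert[of "{}" a b] by simp
next
  fix R :: "'v rel" and n a
  assume "finite R" "n \<notin> Field R" "a \<noteq> n"
  then show "2 * crank R + 1 + 2 \<le> 2 * crank (insert (a, n) R) + 1"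
    using crank_insert[of R a n] conn_rel_new_vertex[of n R a] by simp
next
  fix R :: "'v rel" and n a b
  assume *: "finite R" "n \<notin> Field R" "a \<noteq> n" "b \<noteq> n"
  then show "2 * crank (insert (a, b) R) + 1 + 2 \<le> 2 * crank (insert (a, n) (insert (b, n) R)) + 1"
    using crank_split_edge[OF *] by simp
next
  fix R S :: "'v rel"
  assume *: "R \<union> R\<inverse> = S \<union> S\<inverse>"
  then show "2 * crank R + 1 = 2 * crank S + 1"
    using Field_symmetric[OF *] by (simp add: crank_def conn_rel_def)
next
  fix R :: "'v rel"
  assume R: "finite R" "R \<noteq> {}"
  then consider "crank R = int (card (Field R)) - 1"
    | R1 R2 where "R1 \<noteq> {}" "R2 \<noteq> {}" "R = R1 \<union> R2" "Field R1 \<inter> Field R2 = {}"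
    using crank_components[OF R] by blast
  then show "2 * crank R + 1 = 2 * int (card (Field R)) - 1 \<or>
      (\<exists>R1 R2. R1 \<noteq> {} \<and> R2 \<noteq> {} \<and> R = R1 \<union> R2 \<and> Field R1 \<inter> Field R2 = {} \<and>
        2 * crank R1 + 1 + (2 * crank R2 + 1) - (3 - 1) \<le> 2 * crank R + 1)"
  proof cases
    case 2
    then have "crank R = crank R1 + crank R2" using crank_disjoint[of R2 R1] R by simp
    then have "2 * crank R1 + 1 + (2 * crank R2 + 1) - (3 - 1) \<le> 2 * crank R + 1" by simp
    then show ?thesis using 2 by blast
  qed simp
qed (simp_all add: crank_mono)


section \<open>Moves on sparse sets\<close>

context count
begin

text \<open>The map may change labels as well as orientations; renaming is used later, when an
  auxiliary edge receives the name of an arc.\<close>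

lemma sparse_reorient:
  fixes f :: "('l, 'v, 'g::ab_group_add) edge \<Rightarrow> ('m, 'v, 'g) edge"
  assumes I: "sparse \<Phi> I" and inj: "inj_on f I"
    and f: "\<And>e. e \<in> I \<Longrightarrow> src (f e) = src e \<and> dst (f e) = dst e \<and> col (f e) = col e \<or>
      src (f e) = dst e \<and> dst (f e) = src e \<and> col (f e) = - col e"
  shows "sparse \<Phi> (f ` I)"
  unfolding sparse_def
proof (intro conjI allI impI)
  show "finite (f ` I)" using sparse_finite[OF I] by simp
next
  fix F' assume "F' \<subseteq> f ` I" "F' \<noteq> {}"
  then obtain F where F: "F \<subseteq> I" "F' = f ` F" "F \<noteq> {}" by (metis image_is_empty subset_imageE)
  have c: "card F' = card F" using F inj by (metis card_image inj_on_subset)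
  have fF: "src (f e) = src e \<and> dst (f e) = dst e \<and> col (f e) = col e \<or>
      src (f e) = dst e \<and> dst (f e) = src e \<and> col (f e) = - col e" if "e \<in> F" for e
    by (rule f) (use that F(1) in blast)
  have e: "ends (f e) = (src e, dst e) \<or> ends (f e) = (dst e, src e)" if "e \<in> F" for e
    using fF[OF that] by (auto simp: ends_def)
  have "ends ` F' \<subseteq> ends ` F \<union> (ends ` F)\<inverse>"
  proof
    fix t assume "t \<in> ends ` F'"
    then obtain u where u: "u \<in> F" "t = ends (f u)" unfolding F(2) by blast
    then have "(src u, dst u) \<in> ends ` F" by (metis ends_def imageI)
    then show "t \<in> ends ` F \<union> (ends ` F)\<inverse>" using e[OF u(1)] u(2) by (metis UnCI converseI)
  qed
  moreover have "ends ` F \<subseteq> ends ` F' \<union> (ends ` F')\<inverse>"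
  proof
    fix t assume "t \<in> ends ` F"
    then obtain u where u: "u \<in> F" "t = (src u, dst u)" by (metis ends_def imageE)
    then have "ends (f u) \<in> ends ` F'" by (simp add: F(2))
    then show "t \<in> ends ` F' \<union> (ends ` F')\<inverse>" using e[OF u(1)] u(2) by (metis UnCI converseI)
  qed
  ultimately have sym: "ends ` F' \<union> (ends ` F')\<inverse> = ends ` F \<union> (ends ` F)\<inverse>" by blast
  have 1: "int (card F) \<le> \<Phi> (ends ` F)" "balanced F \<longrightarrow> int (card F) \<le> 2 * int (card (touched F)) - 3"
    using I F unfolding sparse_def by auto
  show "int (card F') \<le> \<Phi> (ends ` F')" using symmetric[OF sym] 1(1) c by simp
  assume "balanced F'"
  then obtain p where p: "\<And>e. e \<in> F \<Longrightarrow> col (f e) = p (dst (f e)) - p (src (f e))"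
    unfolding balanced_def F(2) by auto
  have "col e = p (dst e) - p (src e)" if "e \<in> F" for e
    using p[OF that] fF[OF that] by (auto simp: algebra_simps)
  then have "balanced F" unfolding balanced_def by blast
  then show "int (card F') \<le> 2 * int (card (touched F')) - 3"
    using 1(2) c Field_symmetric[OF sym] by simp
qed

text \<open>With equal colors the two edges would be balanced on 2 vertices, where the bound is 1.
  This provides the color conditions of (H1c) and (H2c) when these moves are undone.\<close>

lemma parallel_edges:
  assumes I: "sparse \<Phi> I" and xy: "x \<in> I" "y \<in> I" "x \<noteq> y"
    and e: "src x = src y" "dst x = dst y" "src x \<noteq> dst x"
  shows "col x \<noteq> col y"
proof
  assume c: "col x = col y"
  let ?p = "\<lambda>v. if v = dst x then col x else 0"
  have "balanced {x, y}" unfolding balanced_def by (rule exI[of _ ?p]) (use c e in auto)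
  moreover have "touched {x, y} = {src x, dst x}" using e by (auto simp: touched_conv)
  ultimately show False
    using sparse_balanced_bound[of \<Phi> "{x, y}"] sparse_subset[OF I, of "{x, y}"] xy e by simp
qed

text \<open>A loop has a single vertex: with color zero it is balanced against the bound -1, and the
  count 2 - k admits it only for \<open>k\<close> = 1.\<close>

lemma no_balanced_loop:
  assumes I: "sparse \<Phi> I" and x: "x \<in> I" "src x = dst x"
  shows "col x \<noteq> 0" "k = 1"
proof -
  have s: "sparse \<Phi> {x}" using sparse_subset[OF I] x by simp
  have t: "touched {x} = {dst x}" using x by (auto simp: touched_conv)
  show "col x \<noteq> 0"
  proof
    assume "col x = 0"
    then have "balanced {x}" using x by (simp add: balanced_def)
    then show False using sparse_balanced_bound[OF s] t by simp
  qed
  have "ends ` {x} = {(dst x, dst x)}" using x by (simp add: ends_def)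
  then show "k = 1" using sparse_bound[OF s] single[of "dst x" "dst x"] k by simp
qed

text \<open>If old edges are present, the vertex \<open>n\<close> raises both bounds by 2 and pays
  for the new edges. Among new edges alone, the critical case is two balanced ones: a common source
  would force equal colors, so there is a third vertex and the bound is 3.\<close>

lemma sparse_add_vertex:
  fixes I N :: "('l, 'v, 'g::ab_group_add) edge set"
  assumes I: "sparse \<Phi> I" and n: "n \<notin> touched I" and N: "finite N" "card N \<le> 2"
    and into: "\<And>e. e \<in> N \<Longrightarrow> dst e = n \<and> src e \<noteq> n"
    and par: "\<And>e f. e \<in> N \<Longrightarrow> f \<in> N \<Longrightarrow> e \<noteq> f \<Longrightarrow> src e = src f \<Longrightarrow> col e \<noteq> col f"
  shows "sparse \<Phi> (I \<union> N)"
  unfolding sparse_def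
proof (intro conjI allI impI)
  show fin: "finite (I \<union> N)" using sparse_finite[OF I] N by simp
  fix F assume F: "F \<subseteq> I \<union> N" "F \<noteq> {}"
  define A where "A = F \<inter> I"
  define M where "M = F \<inter> N"
  have "N \<inter> I = {}" using into n by (auto simp: touched_conv)
  then have AM: "F = A \<union> M" "A \<inter> M = {}" "A \<subseteq> I" "M \<subseteq> N" using F unfolding A_def M_def by blast+
  have finAM: "finite A" "finite M" using fin unfolding A_def M_def by simp_all
  have c: "card F = card A + card M" using card_Un_disjoint[OF finAM AM(2)] AM(1) by simp
  have cM: "card M \<le> 2" using card_mono[OF N(1) AM(4)] N(2) by simp
  have sA: "sparse \<Phi> A" using sparse_subset[OF I AM(3)] .
  have nA: "n \<notin> touched A" using n touched_mono[OF AM(3)] by auto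
  show "int (card F) \<le> \<Phi> (ends ` F)"
  proof (cases "M = {}")
    case True
    then show ?thesis using sparse_bound[OF sA] AM F by simp
  next
    case False
    then obtain x where x: "x \<in> M" by auto
    have ex: "ends x = (src x, n)" "src x \<noteq> n" using into x AM(4) by (auto simp: ends_def)
    have exF: "(src x, n) \<in> ends ` F" using x AM(1) ex(1) by (metis UnI2 imageI)
    show ?thesis
    proof (cases "A = {}")
      case True
      have "\<Phi> {(src x, n)} \<le> \<Phi> (ends ` F)"
        using exF AM(1) finAM by (intro mono) auto
      then show ?thesis using single[of "src x" n] ex(2) c cM True k by auto
    next
      case A: False
      have "\<Phi> (insert (src x, n) (ends ` A)) \<le> \<Phi> (ends ` F)"
        using exF AM(1) finAM by (intro mono) auto
      moreover have "\<Phi> (ends ` A) + 2 \<le> \<Phi> (insert (src x, n) (ends ` A))"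
        using new_vertex[of "ends ` A" n "src x"] ex finAM A nA by simp
      ultimately show ?thesis using sparse_bound[OF sA A] c cM by linarith
    qed
  qed
  assume bal: "balanced F"
  then have balA: "balanced A" using balanced_subset[of F A] AM by simp
  obtain p where p: "\<And>e. e \<in> F \<Longrightarrow> col e = p (dst e) - p (src e)" using bal by (auto simp: balanced_def)
  have finT: "finite (touched F)" using AM finAM by simp
  show "int (card F) \<le> 2 * int (card (touched F)) - 3"
  proof (cases "M = {}")
    case True
    then show ?thesis using sparse_balanced_bound[OF sA _ balA] AM F by simp
  next
    case False
    then obtain x where x: "x \<in> M" by auto
    have ex: "dst x = n" "src x \<noteq> n" using into x AM(4) by auto
    have xF: "src x \<in> touched F" "n \<in> touched F" using x AM ex by (auto simp: touched_conv)
    show ?thesis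
    proof (cases "A = {}")
      case False
      have "insert n (touched A) \<subseteq> touched F" using xF touched_mono[of A F] AM by auto
      then have "card (insert n (touched A)) \<le> card (touched F)" using finT by (intro card_mono)
      then have "card (touched A) + 1 \<le> card (touched F)" using nA finAM by simp
      then show ?thesis using sparse_balanced_bound[OF sA False balA] c cM by linarith
    next
      case A: True
      show ?thesis
      proof (cases "M = {x}")
        case True
        have "card {src x, n} \<le> card (touched F)" using xF finT by (intro card_mono) auto
        then show ?thesis using c A True ex by simp
      next
        case False
        then obtain y where y: "y \<in> M" "y \<noteq> x" using x by auto
        have ey: "dst y = n" "src y \<noteq> n" using into y AM(4) by auto
        have "src y \<noteq> src x"
        proof
          assume s: "src y = src x"
          have "col y = col x" using p[of x] p[of y] x y AM ex ey s by simp
          then show False using par[of y x] x y AM(4) s by auto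
        qed
        moreover have "src y \<in> touched F" using y AM by (auto simp: touched_conv)
        ultimately have "card {src y, src x, n} \<le> card (touched F)" using xF finT by (intro card_mono) auto
        then show ?thesis using c cM A ex ey \<open>src y \<noteq> src x\<close> by simp
      qed
    qed
  qed
qed

text \<open>A set that misses one of the three edges is covered by \<open>sparse_add_vertex\<close>.
  Otherwise exchanging the three edges for \<open>x\<close> removes 2 edges and one vertex, and the
  color condition on \<open>an\<close> and \<open>bn\<close> makes \<open>x\<close> fit every
  potential of the set.\<close>

lemma sparse_split_edge:
  fixes I :: "('l, 'v, 'g::ab_group_add) edge set"
  assumes I: "sparse \<Phi> (insert x I)" and x: "x \<notin> I" and n: "n \<notin> touched (insert x I)"
    and N: "N = {an, bn, cn}" "card N = 3"
    and into: "\<And>e. e \<in> N \<Longrightarrow> dst e = n \<and> src e \<noteq> n"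
    and par: "\<And>e f. e \<in> N \<Longrightarrow> f \<in> N \<Longrightarrow> e \<noteq> f \<Longrightarrow> src e = src f \<Longrightarrow> col e \<noteq> col f"
    and ab: "src an = src x" "src bn = dst x" "col an - col bn = col x"
  shows "sparse \<Phi> (I \<union> N)"
  unfolding sparse_def
proof (intro conjI allI impI)
  have sI: "sparse \<Phi> I" using sparse_subset[OF I] by auto
  have finN: "finite N" using N by simp
  have nI: "n \<notin> touched I" using n touched_mono[of I "insert x I"] by auto
  show fin: "finite (I \<union> N)" using sparse_finite[OF sI] finN by simp
  have NI: "N \<inter> I = {}" using into nI by (auto simp: touched_conv)
  fix F assume F: "F \<subseteq> I \<union> N" "F \<noteq> {}"
  have "int (card F) \<le> \<Phi> (ends ` F) \<and> (balanced F \<longrightarrow> int (card F) \<le> 2 * int (card (touched F)) - 3)"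
  proof (cases "N \<subseteq> F")
    case False
    have "sparse \<Phi> (I \<union> (F \<inter> N))"
    proof (rule sparse_add_vertex[OF sI nI])
      have "card (F \<inter> N) < card N" using False finN by (intro psubset_card_mono) auto
      then show "card (F \<inter> N) \<le> 2" using N by simp
    qed (use finN into par in auto)
    moreover have "F \<subseteq> I \<union> (F \<inter> N)" using F by auto
    ultimately have "sparse \<Phi> F" by (rule sparse_subset)
    then show ?thesis using F unfolding sparse_def by auto
  next
    case True
    define A where "A = F \<inter> I"
    have AI: "A \<subseteq> I" by (simp add: A_def)
    have FA: "F = A \<union> N" using F True by (auto simp: A_def)
    have finA: "finite A" using finite_subset[OF AI sparse_finite[OF sI]] .
    have xA: "x \<notin> A" using x AI by auto
    have "card F = card A + 3" using FA NI AI N(2) finA finN card_Un_disjoint[of A N] by auto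
    then have c: "int (card F) = int (card (insert x A)) + 2" using xA finA by simp
    have sA: "sparse \<Phi> (insert x A)" using sparse_subset[OF I, of "insert x A"] AI by auto
    have nA: "n \<notin> touched A" "n \<notin> touched (insert x A)"
      using n touched_mono[of A "insert x I"] touched_mono[of "insert x A" "insert x I"] AI by auto
    have a: "ends an = (src x, n)" "ends bn = (dst x, n)" "src x \<noteq> n" "dst x \<noteq> n"
      using into[of an] into[of bn] N ab by (auto simp: ends_def)
    have "\<Phi> (insert (src x, dst x) (ends ` A)) + 2 \<le> \<Phi> (insert (src x, n) (insert (dst x, n) (ends ` A)))"
      using split_edge[of "ends ` A" n "src x" "dst x"] finA nA a by simp
    also have "\<dots> \<le> \<Phi> (ends ` F)"
      using a FA N(1) finA by (intro mono) (auto simp flip: a(1,2))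
    finally have 1: "int (card F) \<le> \<Phi> (ends ` F)"
      using sparse_bound[OF sA] c by (simp add: ends_def)
    have "int (card F) \<le> 2 * int (card (touched F)) - 3" if bal: "balanced F"
    proof -
      obtain p where p: "\<And>e. e \<in> F \<Longrightarrow> col e = p (dst e) - p (src e)" using bal by (auto simp: balanced_def)
      have "col x = (p n - p (src x)) - (p n - p (dst x))"
        using p[of an] p[of bn] FA N(1) a ab into[of an] into[of bn] by auto
      then have "balanced (insert x A)" unfolding balanced_def using p FA by (intro exI[of _ p]) auto
      then have b: "int (card (insert x A)) \<le> 2 * int (card (touched (insert x A))) - 3"
        using sparse_balanced_bound[OF sA] by auto
      have "insert n (touched (insert x A)) \<subseteq> touched F"
        using FA N(1) ab into[of an] by (auto simp: touched_conv)
      then have "card (insert n (touched (insert x A))) \<le> card (touched F)"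
        using FA finA finN by (intro card_mono) auto
      then have "card (touched (insert x A)) + 1 \<le> card (touched F)" using nA finA by simp
      then show ?thesis using b c by linarith
    qed
    then show ?thesis using 1 by blast
  qed
  then show "int (card F) \<le> \<Phi> (ends ` F)" "balanced F \<Longrightarrow> int (card F) \<le> 2 * int (card (touched F)) - 3"
    by auto
qed

text \<open>The count must be by vertices: the loop has to raise it even in sets where no edge joins
  \<open>n\<close> to the rest, and the graphic rank ignores loops.\<close>

lemma sparse_add_lollipop:
  assumes \<Phi>: "\<And>R. \<Phi> R = 2 * int (card (Field R)) - 1"
    and I: "sparse \<Phi> I" and n: "n \<notin> touched I"
    and x: "dst x = n" "src x \<noteq> n" and l: "src l = n" "dst l = n" "col l \<noteq> 0"
  shows "sparse \<Phi> (I \<union> {x, l})"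
  unfolding sparse_def
proof (intro conjI allI impI)
  have finI: "finite I" using sparse_finite[OF I] .
  show fin: "finite (I \<union> {x, l})" using finI by simp
  fix F assume F: "F \<subseteq> I \<union> {x, l}" "F \<noteq> {}"
  have finF: "finite F" using finite_subset[OF F(1) fin] .
  define A where "A = F \<inter> I"
  have sA: "sparse \<Phi> A" using sparse_subset[OF I] by (simp add: A_def)
  have nA: "n \<notin> touched A" using n touched_mono[of A I] by (auto simp: A_def)
  have finA: "finite A" using finI by (simp add: A_def)
  have sub: "F \<subseteq> A \<union> {x, l}" using F by (auto simp: A_def)
  then have "card F \<le> card (A \<union> {x, l})" using finA by (intro card_mono) auto
  also have "\<dots> \<le> card A + card {x, l}" by (rule card_Un_le)
  finally have c: "card F \<le> card A + 2" by (simp add: card_insert_if split: if_splits)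
  have up: "card (touched A) + 1 \<le> card (touched F)" if "\<not> F \<subseteq> I"
  proof -
    have "n \<in> touched F" using that F x l by (force simp: touched_conv)
    then have "insert n (touched A) \<subseteq> touched F" using touched_mono[of A F] by (auto simp: A_def)
    then have "card (insert n (touched A)) \<le> card (touched F)" using finF by (intro card_mono) auto
    then show ?thesis using nA finA by simp
  qed
  have sub_case: "sparse \<Phi> F" if "F \<subseteq> I" using sparse_subset[OF I that] .
  have xn: "card (touched F) \<ge> 2" if "x \<in> F"
  proof -
    have "{src x, n} \<subseteq> touched F" using that x by (auto simp: touched_conv)
    then have "card {src x, n} \<le> card (touched F)" using finF by (intro card_mono) auto
    then show ?thesis using x by simp
  qed
  show "int (card F) \<le> \<Phi> (ends ` F)"
  proof (cases "F \<subseteq> I")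
    case True
    then show ?thesis using sparse_bound[OF sub_case] F by simp
  next
    case False
    show ?thesis
    proof (cases "A = {}")
      case True
      then have "card F \<le> 1" if "x \<notin> F" using sub that card_mono[of "{l}" F] by auto
      then show ?thesis using up[OF False] xn c True unfolding \<Phi> by (cases "x \<in> F") auto
    next
      case A: False
      then show ?thesis using sparse_bound[OF sA A] up[OF False] c unfolding \<Phi> by linarith
    qed
  qed
  assume bal: "balanced F"
  \<comment> \<open>A loop of nonzero color admits no potential, so a balanced set can gain only the
    edge \<open>x\<close>.\<close>
  have "l \<notin> F"
  proof
    assume "l \<in> F"
    then have "col l = 0" using bal l unfolding balanced_def by force
    then show False using l by simp
  qed
  then have sub': "F \<subseteq> A \<union> {x}" using sub by auto
  then have "card F \<le> card (A \<union> {x})" using finA by (intro card_mono) auto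
  also have "\<dots> \<le> card A + 1" using card_Un_le[of A "{x}"] by simp
  finally have c': "card F \<le> card A + 1" .
  show "int (card F) \<le> 2 * int (card (touched F)) - 3"
  proof (cases "F \<subseteq> I")
    case True
    then show ?thesis using sparse_balanced_bound[OF sub_case] F bal by simp
  next
    case False
    then have "x \<in> F" using sub' by (auto simp: A_def)
    show ?thesis
    proof (cases "A = {}")
      case True
      then show ?thesis using xn[OF \<open>x \<in> F\<close>] c' by simp
    next
      case A: False
      have "balanced A" using balanced_subset[OF bal, of A] by (simp add: A_def)
      then show ?thesis using sparse_balanced_bound[OF sA A] up[OF False] c' by linarith
    qed
  qed
qed

text \<open>Allowing a larger vertex set \<open>W\<close> covers isolated vertices and an empty
  \<open>I\<close>; in the latter case \<open>W \<noteq> {}\<close> gives 2 - k \<ge> 0.\<close>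

lemma sparse_card_le:
  assumes I: "sparse \<Phi> I" and W: "touched I \<subseteq> W" "finite W" "W \<noteq> {}"
  shows "int (card I) \<le> 2 * int (card W) - k"
proof (cases "I = {}")
  case True
  have "card W \<ge> 1" using W by (simp add: Suc_le_eq card_gt_0_iff)
  then show ?thesis using k True by auto
next
  case False
  have "int (card I) \<le> \<Phi> (ends ` I)" using sparse_bound[OF I False] .
  moreover have "\<Phi> (ends ` I) \<le> 2 * int (card (touched I)) - k"
    using upper[of "ends ` I"] False sparse_finite[OF I] by simp
  moreover have "card (touched I) \<le> card W" using W by (intro card_mono)
  ultimately show ?thesis by linarith
qed

text \<open>Each side of a separation has its own deficit \<open>k\<close>, so there are at most 2n
  - 2k edges.\<close>

lemma sparse_connected:
  assumes I: "sparse \<Phi> I" and V: "finite V" "touched I \<subseteq> V" and S: "V \<inter> S \<noteq> {}" "V - S \<noteq> {}"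
    and closed: "\<And>e. e \<in> I \<Longrightarrow> src e \<in> S \<longleftrightarrow> dst e \<in> S"
  shows "int (card I) < 2 * int (card V) - k"
proof -
  define A where "A = {e \<in> I. src e \<in> S}"
  define B where "B = {e \<in> I. src e \<notin> S}"
  have "int (card A) \<le> 2 * int (card (V \<inter> S)) - k"
    by (rule sparse_card_le[OF sparse_subset[OF I]]) (use V S closed in \<open>auto simp: A_def touched_conv\<close>)
  moreover have "int (card B) \<le> 2 * int (card (V - S)) - k"
    by (rule sparse_card_le[OF sparse_subset[OF I]]) (use V S closed in \<open>auto simp: B_def touched_conv\<close>)
  moreover have "card I = card A + card B"
  proof -
    have "I = A \<union> B" "A \<inter> B = {}" by (auto simp: A_def B_def)
    then show ?thesis using card_Un_disjoint sparse_finite[OF I] by (metis finite_Un)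
  qed
  moreover have "card V = card (V \<inter> S) + card (V - S)" using card_Int_Diff[OF V(1)] .
  ultimately show ?thesis using k by linarith
qed

text \<open>
  Otherwise all three candidate edges depend on \<open>I\<close>. Then \<open>I \<union> {x, y, z}\<close> is dependent as well,
  since a basis of the candidates together with \<open>x\<close>, \<open>y\<close>, \<open>z\<close> has too many edges.
\<close>
lemma unsplit_edge_ordered:
  fixes I :: "('e + nat, 'v, 'g::ab_group_add) edge set"
  assumes s: "sparse \<Phi> (I \<union> {x, y, z})" and d: "x \<noteq> y" "x \<noteq> z" "y \<noteq> z"
    and n: "n \<notin> touched I" and label: "\<And>e. e \<in> I \<union> {x, y, z} \<Longrightarrow> lab e \<in> range Inl"
    and into: "\<And>e. e \<in> {x, y, z} \<Longrightarrow> dst e = n \<and> src e \<noteq> n"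
    and ord: "src x = src y \<or> src x \<noteq> src z \<and> src y \<noteq> src z"
  shows "\<exists>u v i. u \<in> {x, y, z} \<and> v \<in> {x, y, z} \<and> u \<noteq> v \<and> sparse \<Phi> (insert (Edge (Inr i) (src u) (src v) (col u - col v)) I)"
proof (rule ccontr)
  assume no: "\<not> ?thesis"
  let ?N = "{x, y, z}"
  define a b c where "a = src x" and "b = src y" and "c = src z"
  \<comment> \<open>The colors are those that (H2c) demands of an edge that is split into two of
    \<open>x\<close>, \<open>y\<close>, \<open>z\<close>. The labels \<open>Inr\<close> keep the
    candidates distinct from each other and from all given edges, even when ends coincide.\<close>
  define ab bc ac :: "('e + nat, 'v, 'g) edge" where "ab = Edge (Inr 0) a b (col x - col y)"
    and "bc = Edge (Inr 1) b c (col y - col z)" and "ac = Edge (Inr 2) a c (col x - col z)"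
  let ?K = "{ab, bc, ac}"
  note defs = ab_def bc_def ac_def ends_def
  have dist: "ab \<noteq> bc" "ab \<noteq> ac" "bc \<noteq> ac" by (auto simp: defs)
  have finI: "finite I" using sparse_finite[OF s] by simp
  have NI: "?N \<inter> I = {}" using into n by (auto simp: touched_conv)
  have "lab e \<notin> range Inl" if "e \<in> ?K" for e using that by (auto simp: defs)
  then have NK: "?N \<inter> ?K = {}" using label by blast
  have cN: "card ?N = 3" using d by simp
  have sN: "sparse \<Phi> ?N" using sparse_subset[OF s] by auto
  have abcn: "a \<noteq> n" "b \<noteq> n" "c \<noteq> n" using into by (auto simp: a_def b_def c_def)
  have par: "col e \<noteq> col f" if "e \<in> ?N" "f \<in> ?N" "e \<noteq> f" "src e = src f" for e f
    using parallel_edges[OF sN that(1-3)] that into by metis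
  have tN: "touched ?N = {a, b, c, n}" using into by (auto simp: touched_conv a_def b_def c_def)
  have tK: "touched ?K \<subseteq> {a, b, c}" by (auto simp: touched_conv defs)
  \<comment> \<open>A basis of the candidates together with \<open>?N\<close> lives on the vertices
    \<open>a\<close>, \<open>b\<close>, \<open>c\<close>, \<open>n\<close>, where counting edges is
    enough.\<close>
  have main: "\<not> sparse \<Phi> (B \<union> ?N)"
    if B: "B \<subseteq> ?K" "sparse \<Phi> B" and max: "\<And>x. x \<in> ?K - B \<Longrightarrow> \<not> sparse \<Phi> (insert x B)" for B
  proof
    assume U: "sparse \<Phi> (B \<union> ?N)"
    have finB: "finite B" using sparse_finite[OF B(2)] .
    have "B \<inter> ?N = {}" using NK B(1) by blast
    then have cU: "card (B \<union> ?N) = card B + 3" using cN finB card_Un_disjoint[of B ?N] by simp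
    have "touched B \<subseteq> {a, b, c}" using touched_mono[OF B(1)] tK by (rule order_trans)
    moreover have "touched (B \<union> ?N) = touched B \<union> touched ?N" by (simp only: image_Un Field_Un)
    ultimately have tU: "touched (B \<union> ?N) = {a, b, c, n}" unfolding tN by auto
    have maxB: "B = K'" if K': "B \<subseteq> K'" "K' \<subseteq> ?K" "sparse \<Phi> K'" for K'
    proof (rule ccontr)
      assume "B \<noteq> K'"
      then obtain t where t: "t \<in> K'" "t \<notin> B" using K'(1) by blast
      have "sparse \<Phi> (insert t B)" by (rule sparse_subset[OF K'(3)]) (use t K' in simp)
      moreover have "t \<in> ?K - B" using t K'(2) by blast
      ultimately show False using max by blast
    qed
    have up: "int (card (B \<union> ?N)) \<le> 2 * int (card {a, b, c, n}) - k"
    proof -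
      have "int (card (B \<union> ?N)) \<le> \<Phi> (ends ` (B \<union> ?N))" by (rule sparse_bound[OF U]) simp
      also have "\<dots> \<le> 2 * int (card (touched (B \<union> ?N))) - k" by (rule upper) (use finB in auto)
      finally show ?thesis unfolding tU .
    qed
    \<comment> \<open>By \<open>ord\<close>, if exactly two of the neighbours coincide, they are
      \<open>a\<close> and \<open>b\<close>.\<close>
    consider (dis) "a \<noteq> b" "a \<noteq> c" "b \<noteq> c" | (two) "a = b" "a \<noteq> c" | (all) "a = b" "a = c"
      using ord unfolding a_def b_def c_def by metis
    then show False
    proof cases
      case dis
      \<comment> \<open>The triangle on \<open>a\<close>, \<open>b\<close>, \<open>c\<close> is
        sparse, so it is the basis. With \<open>?N\<close> it becomes a balanced complete graph on 4
        vertices: 6 edges against the bound 5.\<close>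
      have "sparse \<Phi> ({} \<union> {ab})" by (rule sparse_add_vertex[of _ b]) (use dis in \<open>auto simp: defs\<close>)
      then have "sparse \<Phi> ({} \<union> {ab} \<union> {bc, ac})"
        by (rule sparse_add_vertex[of _ c]) (use dis dist in \<open>auto simp: defs touched_conv\<close>)
      moreover have "{} \<union> {ab} \<union> {bc, ac} = ?K" by blast
      ultimately have "B = ?K" using maxB[of ?K] B by simp
      then have "card B = 3" using dist by simp
      moreover have "balanced (B \<union> ?N)" unfolding balanced_def
      proof (intro exI ballI)
        fix e assume e: "e \<in> B \<union> ?N"
        \<comment> \<open>Value 0 at \<open>n\<close> and the edges of \<open>?N\<close> determine
          the other values; the candidate edges then fit because their colors are
          differences.\<close>
        let ?p = "\<lambda>v. if v = a then - col x else if v = b then - col y else if v = c then - col z else 0"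
        show "col e = ?p (dst e) - ?p (src e)"
        proof -
          have ends: "src x = a" "src y = b" "src z = c" "dst x = n" "dst y = n" "dst z = n"
            using into by (simp_all add: a_def b_def c_def)
          have "e = ab \<or> e = bc \<or> e = ac \<or> e = x \<or> e = y \<or> e = z" using e B(1) by blast
          then show ?thesis
            by (elim disjE) (simp_all add: defs(1-3) ends dis abcn dis[symmetric] abcn[symmetric])
        qed
      qed
      ultimately show False using sparse_balanced_bound[OF U] cU dis abcn unfolding tU by simp
    next
      case two
      \<comment> \<open>\<open>x\<close> and \<open>y\<close> are parallel, so their colors differ.
        Hence the loop \<open>ab\<close> is nonzero, and the parallel edges \<open>bc\<close> and
        \<open>ac\<close> differ in color too. On three vertices the bound is 6 - k: with the loop
        there are 6 edges; without it \<open>k\<close> = 2, and there are 5 edges against 4.\<close>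
      have ne: "col x \<noteq> col y" using par[of x y] two d by (simp add: a_def b_def)
      have two_edges: "sparse \<Phi> (J \<union> {bc, ac})" if "sparse \<Phi> J" "touched J \<subseteq> {a}" for J
        by (rule sparse_add_vertex[of _ c]) (use that two dist ne in \<open>auto simp: defs touched_conv\<close>)
      show False
      proof (cases "sparse \<Phi> {ab}")
        case True
        moreover have "touched {ab} \<subseteq> {a}" using two by (auto simp: touched_conv defs)
        ultimately have "sparse \<Phi> ({ab} \<union> {bc, ac})" by (rule two_edges)
        moreover have "{ab} \<union> {bc, ac} = ?K" by blast
        ultimately have "B = ?K" using maxB[of ?K] B by simp
        then have "card B = 3" using dist by simp
        then show False using up cU two abcn k by simp
      next
        case False
        then have "k = 2"
        proof -
          have "sparse \<Phi> {ab}" if "k = 1"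
          proof -
            have "\<not> balanced {ab}" using ne two by (auto simp: balanced_def defs)
            then show ?thesis using single[of a a] that two
              unfolding sparse_def by (auto simp: defs subset_singleton_iff)
          qed
          then show ?thesis using False k by auto
        qed
        have "ab \<notin> B" using False sparse_subset[OF B(2), of "{ab}"] by auto
        then have "B = {bc, ac}" using maxB[of "{bc, ac}"] B two_edges[of "{}"] by auto
        then have "card B = 2" using dist by simp
        then show False using up cU two abcn \<open>k = 2\<close> by simp
      qed
    next
      case all
      \<comment> \<open>On two vertices the bound is 4 - k. The edges of \<open>?N\<close> exceed it
        if \<open>k\<close> = 2; if \<open>k\<close> = 1, the nonzero loop \<open>ab\<close> is
        sparse, so the basis contributes a fourth edge.\<close>
      have "B \<noteq> {}" if "k = 1"
      proof
        assume "B = {}"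
        have "col x \<noteq> col y" using par[of x y] all d by (simp add: a_def b_def)
        then have "\<not> balanced {ab}" using all by (auto simp: balanced_def defs)
        then have "sparse \<Phi> {ab}" using single[of a a] that all
          unfolding sparse_def by (auto simp: defs subset_singleton_iff)
        then show False using max[of ab] \<open>B = {}\<close> by simp
      qed
      then have "card B \<ge> 1" if "k = 1" using that finB by (simp add: Suc_le_eq card_gt_0_iff)
      then show False using up cU all abcn k by auto
    qed
  qed
  have "\<not> sparse \<Phi> (insert t I)" if t: "t \<in> ?K" for t
  proof
    assume st: "sparse \<Phi> (insert t I)"
    consider "t = ab" | "t = bc" | "t = ac" using t by auto
    then show False
    proof cases
      case 1
      then show False using st no d unfolding defs a_def b_def by blast
    next
      case 2
      then show False using st no d unfolding defs b_def c_def by blast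
    next
      case 3
      then show False using st no d unfolding defs a_def c_def by blast
    qed
  qed
  then have "\<not> sparse \<Phi> (I \<union> ?N)"
    using dependent_extension[of I ?K ?N] finI NI NK main by blast
  then show False using s by simp
qed

text \<open>Renaming the three edges brings a coinciding pair of sources to the front, as
  \<open>unsplit_edge_ordered\<close> expects.\<close>

lemma unsplit_edge:
  fixes I :: "('e + nat, 'v, 'g::ab_group_add) edge set"
  assumes s: "sparse \<Phi> (I \<union> N)" and N: "card N = 3"
    and n: "n \<notin> touched I" and label: "\<And>e. e \<in> I \<union> N \<Longrightarrow> lab e \<in> range Inl"
    and into: "\<And>e. e \<in> N \<Longrightarrow> dst e = n \<and> src e \<noteq> n"
  shows "\<exists>x y z i. N = {x, y, z} \<and> x \<noteq> y \<and> x \<noteq> z \<and> y \<noteq> z \<and>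
    sparse \<Phi> (insert (Edge (Inr i) (src x) (src y) (col x - col y)) I)"
proof -
  obtain x y z where xyz: "N = {x, y, z}" "x \<noteq> y" "x \<noteq> z" "y \<noteq> z"
    using N by (metis card_3_iff)
  have "\<exists>x y z. N = {x, y, z} \<and> x \<noteq> y \<and> x \<noteq> z \<and> y \<noteq> z \<and> (src x = src y \<or> src x \<noteq> src z \<and> src y \<noteq> src z)"
  proof (cases "src x = src z")
    case True
    then show ?thesis using xyz by (intro exI[of _ x] exI[of _ z] exI[of _ y]) (simp add: insert_commute)
  next
    case 1: False
    show ?thesis
    proof (cases "src y = src z")
      case True
      then show ?thesis using xyz by (intro exI[of _ y] exI[of _ z] exI[of _ x]) (simp add: insert_commute)
    next
      case False
      then show ?thesis using xyz 1 by (intro exI[of _ x] exI[of _ y] exI[of _ z]) simp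
    qed
  qed
  then obtain x y z where N': "N = {x, y, z}" "x \<noteq> y" "x \<noteq> z" "y \<noteq> z"
    and ord: "src x = src y \<or> src x \<noteq> src z \<and> src y \<noteq> src z" by blast
  obtain u v i where uv: "u \<in> {x, y, z}" "v \<in> {x, y, z}" "u \<noteq> v"
    "sparse \<Phi> (insert (Edge (Inr i) (src u) (src v) (col u - col v)) I)"
    using unsplit_edge_ordered[of I x y z n] s label into N' n ord by auto
  have "\<exists>w. N = {u, v, w} \<and> u \<noteq> w \<and> v \<noteq> w"
    using uv(1-3) N' by (elim insertE emptyE) (auto simp: insert_commute)
  then show ?thesis using uv by blast
qed

end


section \<open>Moves on colored graphs\<close>

text \<open>
  The labels \<open>Inr i\<close> are kept free for auxiliary edges, since the type \<open>'e\<close> may be finite.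
\<close>
definition cedge :: "('v, 'e) pre_digraph \<Rightarrow> ('e \<Rightarrow> 'g) \<Rightarrow> 'e \<Rightarrow> ('e + nat, 'v, 'g) edge" where
  "cedge G \<gamma> e = Edge (Inl e) (tail G e) (head G e) (\<gamma> e)"

lemma cedge_sel [simp]:
  "lab (cedge G \<gamma> e) = Inl e" "src (cedge G \<gamma> e) = tail G e" "dst (cedge G \<gamma> e) = head G e"
  "col (cedge G \<gamma> e) = \<gamma> e"
  by (simp_all add: cedge_def)

lemma inj_cedge: "inj_on (cedge G \<gamma>) F"
  by (auto simp: inj_on_def cedge_def)

lemma card_cedge [simp]: "card (cedge G \<gamma> ` F) = card F"
  by (simp add: card_image inj_cedge)

lemma touched_cedge: "touched (cedge G \<gamma> ` F) = tail G ` F \<union> head G ` F"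
  unfolding touched_conv by (simp add: image_image)

lemma fin_digraph_iff:
  "fin_digraph G \<longleftrightarrow> finite (verts G) \<and> finite (arcs G) \<and> (\<forall>e \<in> arcs G. tail G e \<in> verts G \<and> head G e \<in> verts G)"
  by (auto simp: fin_digraph_def fin_digraph_axioms_def wf_digraph_def)

lemma extends_cedge: "extends_by H \<delta> F n N G \<gamma> \<Longrightarrow> cedge G \<gamma> ` F = cedge H \<delta> ` F"
  by (intro image_cong) (auto simp: extends_by_def cedge_def)

lemma reorients_sym:
  fixes \<delta> :: "'e \<Rightarrow> 'g::group_add"
  shows "reorients H \<delta> G \<gamma> \<Longrightarrow> reorients G \<gamma> H \<delta>"
  unfolding reorients_def by (metis minus_minus)

lemma reorients_fin_digraph: "reorients H \<delta> G \<gamma> \<Longrightarrow> fin_digraph H \<Longrightarrow> fin_digraph G"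
  unfolding reorients_def fin_digraph_iff by metis

text \<open>The moves orient their new edges into \<open>n\<close>; after this reorientation only
  loops have tail \<open>n\<close>.\<close>

lemma exists_reorientation_into:
  fixes \<gamma> :: "'e \<Rightarrow> 'g::group_add"
  shows "\<exists>G' \<gamma>'. reorients G \<gamma> G' \<gamma>' \<and> (\<forall>e \<in> arcs G'. tail G' e = n \<longrightarrow> head G' e = n)"
proof (intro exI conjI)
  let ?G = "\<lparr> verts = verts G, arcs = arcs G, tail = (\<lambda>e. if tail G e = n then head G e else tail G e),
    head = (\<lambda>e. if tail G e = n then n else head G e) \<rparr>"
  let ?\<gamma> = "\<lambda>e. if tail G e = n then - \<gamma> e else \<gamma> e"
  show "reorients G \<gamma> ?G ?\<gamma>" by (auto simp: reorients_def)
  show "\<forall>e \<in> arcs ?G. tail ?G e = n \<longrightarrow> head ?G e = n" by auto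
qed

text \<open>Common form of the three constructibility predicates: \<open>B\<close> selects the base
  graphs and \<open>L\<close> tells whether lollipop moves are allowed.\<close>

inductive constructible ::
  "(('v, 'e) pre_digraph \<Rightarrow> ('e \<Rightarrow> 'g::ab_group_add) \<Rightarrow> bool) \<Rightarrow> bool
     \<Rightarrow> ('v, 'e) pre_digraph \<Rightarrow> ('e \<Rightarrow> 'g) \<Rightarrow> bool"
  for B :: "('v, 'e) pre_digraph \<Rightarrow> ('e \<Rightarrow> 'g) \<Rightarrow> bool" and L :: bool where
  base: "B G \<gamma> \<Longrightarrow> constructible B L G \<gamma>"
| H1c: "constructible B L H \<delta> \<Longrightarrow> H1c H \<delta> G \<gamma> \<Longrightarrow> constructible B L G \<gamma>"
| H1c_lollipop: "constructible B L H \<delta> \<Longrightarrow> L \<Longrightarrow> H1c_lollipop H \<delta> G \<gamma> \<Longrightarrow> constructible B L G \<gamma>"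
| H2c: "constructible B L H \<delta> \<Longrightarrow> H2c H \<delta> G \<gamma> \<Longrightarrow> constructible B L G \<gamma>"
| reorients: "constructible B L H \<delta> \<Longrightarrow> reorients H \<delta> G \<gamma> \<Longrightarrow> constructible B L G \<gamma>"

lemma ross_constructible_iff: "ross_constructible G \<gamma> \<longleftrightarrow> constructible ross_base False G \<gamma>"
proof
  show "ross_constructible G \<gamma> \<Longrightarrow> constructible ross_base False G \<gamma>"
    by (induction rule: ross_constructible.induct) (auto intro: constructible.intros)
  show "constructible ross_base False G \<gamma> \<Longrightarrow> ross_constructible G \<gamma>"
    by (induction rule: constructible.induct) (auto intro: ross_constructible.intros)
qed

lemma cone_laman_constructible_iff: "cone_laman_constructible G \<gamma> \<longleftrightarrow> constructible loop_base True G \<gamma>"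
proof
  show "cone_laman_constructible G \<gamma> \<Longrightarrow> constructible loop_base True G \<gamma>"
    by (induction rule: cone_laman_constructible.induct) (auto intro: constructible.intros)
  show "constructible loop_base True G \<gamma> \<Longrightarrow> cone_laman_constructible G \<gamma>"
    by (induction rule: constructible.induct) (auto intro: cone_laman_constructible.intros)
qed

lemma cylinder_laman_constructible_iff:
  "cylinder_laman_constructible G \<gamma> \<longleftrightarrow> constructible loop_base False G \<gamma>"
proof
  show "cylinder_laman_constructible G \<gamma> \<Longrightarrow> constructible loop_base False G \<gamma>"
    by (induction rule: cylinder_laman_constructible.induct) (auto intro: constructible.intros)
  show "constructible loop_base False G \<gamma> \<Longrightarrow> cylinder_laman_constructible G \<gamma>"
    by (induction rule: constructible.induct) (auto intro: cylinder_laman_constructible.intros)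
qed

section \<open>Tight graphs, the moves and their inverses\<close>

context count
begin

text \<open>For \<open>k\<close> = 2 the condition \<open>arcs G \<noteq> {}\<close> excludes the
  single vertex without edges, where 0 = 2n - 2.\<close>

definition tight_graph :: "('v, 'e) pre_digraph \<Rightarrow> ('e \<Rightarrow> 'g::ab_group_add) \<Rightarrow> bool" where
  "tight_graph G \<gamma> \<longleftrightarrow> arcs G \<noteq> {} \<and> int (card (arcs G)) = 2 * int (card (verts G)) - k \<and>
     sparse \<Phi> (cedge G \<gamma> ` arcs G)"

lemma reorients_tight_graph:
  assumes r: "reorients H \<delta> G \<gamma>" and H: "tight_graph H \<delta>"
  shows "tight_graph G \<gamma>"
proof -
  let ?f = "\<lambda>x. cedge G \<gamma> (projl (lab x))"
  have "sparse \<Phi> (?f ` (cedge H \<delta> ` arcs H))"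
  proof (rule sparse_reorient)
    show "sparse \<Phi> (cedge H \<delta> ` arcs H)" using H by (simp add: tight_graph_def)
    show "inj_on ?f (cedge H \<delta> ` arcs H)" by (auto simp: inj_on_def cedge_def)
    fix x assume "x \<in> cedge H \<delta> ` arcs H"
    then show "src (?f x) = src x \<and> dst (?f x) = dst x \<and> col (?f x) = col x \<or>
      src (?f x) = dst x \<and> dst (?f x) = src x \<and> col (?f x) = - col x"
      using r unfolding reorients_def by fastforce
  qed
  moreover have "?f ` (cedge H \<delta> ` arcs H) = cedge G \<gamma> ` arcs G"
    using r by (simp add: image_image reorients_def)
  ultimately show ?thesis using H r by (simp add: tight_graph_def reorients_def)
qed

lemma new_vertex_untouched:
  assumes "fin_digraph H" "n \<notin> verts H" "F \<subseteq> arcs H"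
  shows "n \<notin> touched (cedge H \<delta> ` F)"
  using assms by (auto simp: touched_cedge fin_digraph_iff)

lemma H1c_tight_graph:
  assumes H: "fin_digraph H" "tight_graph H \<delta>" and m: "H1c H \<delta> G \<gamma>"
  shows "fin_digraph G \<and> tight_graph G \<gamma>"
proof -
  obtain n a b an bn where *: "a \<in> verts H" "b \<in> verts H" "an \<noteq> bn"
    and ext: "extends_by H \<delta> (arcs H) n {an, bn} G \<gamma>"
    and e: "tail G an = a" "head G an = n" "tail G bn = b" "head G bn = n"
    and par: "a = b \<longrightarrow> \<gamma> an \<noteq> \<gamma> bn"
    using m unfolding H1c_def by blast
  have G: "n \<notin> verts H" "verts G = insert n (verts H)" "arcs H \<inter> {an, bn} = {}" "arcs G = arcs H \<union> {an, bn}"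
    and kept: "\<And>e. e \<in> arcs H \<Longrightarrow> tail G e = tail H e \<and> head G e = head H e"
    using ext by (simp_all add: extends_by_def)
  have fin: "finite (arcs H)" "finite (verts H)" using H by (auto simp: fin_digraph_iff)
  have "fin_digraph G" unfolding fin_digraph_iff G(2,4) using H(1) kept e * by (auto simp: fin_digraph_iff)
  moreover have "sparse \<Phi> (cedge H \<delta> ` arcs H \<union> cedge G \<gamma> ` {an, bn})"
  proof (rule sparse_add_vertex)
    show "sparse \<Phi> (cedge H \<delta> ` arcs H)" using H by (simp add: tight_graph_def)
    show "n \<notin> touched (cedge H \<delta> ` arcs H)" using new_vertex_untouched[OF H(1) G(1)] by blast
    show "card (cedge G \<gamma> ` {an, bn}) \<le> 2" using * by (simp only: card_cedge) simp
  qed (use e par * G(1) in \<open>auto simp: cedge_def\<close>)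
  then have "sparse \<Phi> (cedge G \<gamma> ` arcs G)" using extends_cedge[OF ext] by (simp only: G(4) image_Un)
  moreover have "card (arcs G) = card (arcs H) + 2"
    unfolding G(4) using G(3) * fin by (subst card_Un_disjoint) auto
  ultimately show ?thesis using H fin G(1,2) by (auto simp: tight_graph_def G(4))
qed

lemma H1c_lollipop_tight_graph:
  assumes \<Phi>: "\<And>R. \<Phi> R = 2 * int (card (Field R)) - 1"
    and H: "fin_digraph H" "tight_graph H \<delta>" and m: "H1c_lollipop H \<delta> G \<gamma>"
  shows "fin_digraph G \<and> tight_graph G \<gamma>"
proof -
  obtain n a an l where *: "a \<in> verts H" "an \<noteq> l"
    and ext: "extends_by H \<delta> (arcs H) n {an, l} G \<gamma>"
    and e: "tail G an = a" "head G an = n" "tail G l = n" "head G l = n" "\<gamma> l \<noteq> 0"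
    using m unfolding H1c_lollipop_def by blast
  have G: "n \<notin> verts H" "verts G = insert n (verts H)" "arcs H \<inter> {an, l} = {}" "arcs G = arcs H \<union> {an, l}"
    and kept: "\<And>e. e \<in> arcs H \<Longrightarrow> tail G e = tail H e \<and> head G e = head H e"
    using ext by (simp_all add: extends_by_def)
  have fin: "finite (arcs H)" "finite (verts H)" using H by (auto simp: fin_digraph_iff)
  have "fin_digraph G" unfolding fin_digraph_iff G(2,4) using H(1) kept e * by (auto simp: fin_digraph_iff)
  moreover have "sparse \<Phi> (cedge H \<delta> ` arcs H \<union> {cedge G \<gamma> an, cedge G \<gamma> l})"
  proof (rule sparse_add_lollipop[OF \<Phi>])
    show "sparse \<Phi> (cedge H \<delta> ` arcs H)" using H by (simp add: tight_graph_def)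
    show "n \<notin> touched (cedge H \<delta> ` arcs H)" using new_vertex_untouched[OF H(1) G(1)] by blast
  qed (use e * G(1) in auto)
  then have "sparse \<Phi> (cedge G \<gamma> ` arcs G)"
    using extends_cedge[OF ext] by (simp only: G(4) image_Un image_insert image_empty)
  moreover have "card (arcs G) = card (arcs H) + 2"
    unfolding G(4) using G(3) * fin by (subst card_Un_disjoint) auto
  ultimately show ?thesis using H fin G(1,2) by (auto simp: tight_graph_def G(4))
qed

lemma H2c_tight_graph:
  assumes H: "fin_digraph H" "tight_graph H \<delta>" and m: "H2c H \<delta> G \<gamma>"
  shows "fin_digraph G \<and> tight_graph G \<gamma>"
proof -
  obtain n a b c ab an bn cn where ab: "ab \<in> arcs H" "tail H ab = a" "head H ab = b" "c \<in> verts H"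
    and d: "an \<noteq> bn" "an \<noteq> cn" "bn \<noteq> cn"
    and ext: "extends_by H \<delta> (arcs H - {ab}) n {an, bn, cn} G \<gamma>"
    and e: "tail G an = a" "head G an = n" "tail G bn = b" "head G bn = n" "tail G cn = c" "head G cn = n"
    and col: "\<gamma> an - \<gamma> bn = \<delta> ab"
    and par: "a = b \<longrightarrow> \<gamma> an \<noteq> \<gamma> bn" "a = c \<longrightarrow> \<gamma> an \<noteq> \<gamma> cn" "b = c \<longrightarrow> \<gamma> bn \<noteq> \<gamma> cn"
    using m unfolding H2c_def by blast
  let ?F = "arcs H - {ab}" and ?N = "{an, bn, cn}"
  have G: "n \<notin> verts H" "verts G = insert n (verts H)" "?F \<inter> ?N = {}" "arcs G = ?F \<union> ?N"
    and kept: "\<And>e. e \<in> ?F \<Longrightarrow> tail G e = tail H e \<and> head G e = head H e"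
    using ext by (simp_all add: extends_by_def)
  have fin: "finite (arcs H)" "finite (verts H)" using H by (auto simp: fin_digraph_iff)
  have abH: "a \<in> verts H" "b \<in> verts H" using H(1) ab by (auto simp: fin_digraph_iff)
  have "fin_digraph G" unfolding fin_digraph_iff G(2,4)
    using H(1) kept e ab(4) abH by (auto simp: fin_digraph_iff)
  moreover have "sparse \<Phi> (cedge H \<delta> ` ?F \<union> cedge G \<gamma> ` ?N)"
  proof (rule sparse_split_edge[where x = "cedge H \<delta> ab" and n = n and an = "cedge G \<gamma> an" and bn = "cedge G \<gamma> bn"
        and cn = "cedge G \<gamma> cn"])
    have eq: "insert (cedge H \<delta> ab) (cedge H \<delta> ` ?F) = cedge H \<delta> ` arcs H" using ab by auto
    show "sparse \<Phi> (insert (cedge H \<delta> ab) (cedge H \<delta> ` ?F))" using H unfolding eq by (simp add: tight_graph_def)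
    show "n \<notin> touched (insert (cedge H \<delta> ab) (cedge H \<delta> ` ?F))"
      unfolding eq using new_vertex_untouched[OF H(1) G(1)] by blast
    show "cedge H \<delta> ab \<notin> cedge H \<delta> ` ?F" by (auto simp: cedge_def)
    show "card (cedge G \<gamma> ` ?N) = 3" using d by (simp only: card_cedge) simp
    show "\<And>u v. u \<in> cedge G \<gamma> ` ?N \<Longrightarrow> v \<in> cedge G \<gamma> ` ?N \<Longrightarrow> u \<noteq> v \<Longrightarrow> src u = src v \<Longrightarrow> col u \<noteq> col v"
      using e par by auto
    show "\<And>u. u \<in> cedge G \<gamma> ` ?N \<Longrightarrow> dst u = n \<and> src u \<noteq> n" using e abH ab(4) G(1) by auto
  qed (use e ab col in auto)
  then have "sparse \<Phi> (cedge G \<gamma> ` arcs G)" using extends_cedge[OF ext] by (simp only: G(4) image_Un)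
  moreover have "card (arcs G) = card (arcs H) + 2"
  proof -
    have "card (arcs G) = card ?F + card ?N" unfolding G(4) using G(3) fin by (intro card_Un_disjoint) auto
    moreover have "card ?N = 3" using d by simp
    moreover have "Suc (card ?F) = card (arcs H)" using card_Suc_Diff1[OF fin(1) ab(1)] .
    ultimately show ?thesis by simp
  qed
  ultimately show ?thesis using H fin G(1,2) by (auto simp: tight_graph_def G(4))
qed

text \<open>With loops counted twice, the degrees sum to 2m = 4n - 2k < 4n.\<close>

lemma exists_low_degree:
  assumes "fin_digraph G" "tight_graph G \<gamma>"
  shows "\<exists>n \<in> verts G. card {e \<in> arcs G. tail G e = n} + card {e \<in> arcs G. head G e = n} \<le> 3"
proof (rule ccontr)
  assume "\<not> ?thesis"
  then have deg: "4 \<le> card {e \<in> arcs G. tail G e = n} + card {e \<in> arcs G. head G e = n}" if "n \<in> verts G" for n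
    using that by force
  have fin: "finite (verts G)" "finite (arcs G)" "tail G ` arcs G \<subseteq> verts G" "head G ` arcs G \<subseteq> verts G"
    using assms(1) by (auto simp: fin_digraph_iff)
  have fiber: "(\<Sum>n\<in>verts G. card {e \<in> arcs G. f e = n}) = card (arcs G)" if "f ` arcs G \<subseteq> verts G" for f
    using sum.group[OF fin(2,1) that, of "\<lambda>_. 1::nat"] by simp
  have "4 * card (verts G) = (\<Sum>n\<in>verts G. 4)" by simp
  also have "\<dots> \<le> (\<Sum>n\<in>verts G. card {e \<in> arcs G. tail G e = n} + card {e \<in> arcs G. head G e = n})"
    by (rule sum_mono) (rule deg)
  also have "\<dots> = 2 * card (arcs G)" using fiber[OF fin(3)] fiber[OF fin(4)] by (simp add: sum.distrib)
  finally show False using assms(2) k unfolding tight_graph_def by linarith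
qed

lemma tight_graph_parallel:
  assumes G: "tight_graph G \<gamma>" and "e \<in> arcs G" "f \<in> arcs G" "e \<noteq> f"
    "tail G e = tail G f" "head G e = head G f" "tail G e \<noteq> head G e"
  shows "\<gamma> e \<noteq> \<gamma> f"
proof -
  have "cedge G \<gamma> e \<noteq> cedge G \<gamma> f" using assms by (simp add: cedge_def)
  then show ?thesis
    using parallel_edges[of "cedge G \<gamma> ` arcs G" "cedge G \<gamma> e" "cedge G \<gamma> f"] assms
    by (simp add: tight_graph_def)
qed

text \<open>What is left after deleting \<open>n\<close> is sparse on one vertex fewer, so at least
  2 edges enter \<open>n\<close>. With degree at most 3 this leaves the local pictures created by
  (H1c), (H1c') and (H2c); \<open>no_lollipop\<close> rules out the second one when it is not among
  the allowed moves.\<close>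

lemma remove_low_degree_vertex:
  fixes G :: "('v, 'e) pre_digraph" and \<gamma> :: "'e \<Rightarrow> 'g::ab_group_add"
  assumes G: "fin_digraph G" "tight_graph G \<gamma>" and n: "n \<in> verts G" and big: "k < int (card (verts G))"
    and into: "\<And>e. e \<in> arcs G \<Longrightarrow> tail G e = n \<Longrightarrow> head G e = n"
    and deg: "card {e \<in> arcs G. tail G e = n} + card {e \<in> arcs G. head G e = n} \<le> 3"
    and no_lollipop: "\<And>R m. \<not> L \<Longrightarrow> k = 1 \<Longrightarrow> finite R \<Longrightarrow> R \<noteq> {} \<Longrightarrow> m \<notin> Field R
      \<Longrightarrow> \<Phi> (insert (m, m) R) \<le> 2 * int (card (Field R)) - 1"
  shows "\<exists>H \<delta>. fin_digraph H \<and> tight_graph H \<delta> \<and> card (verts H) < card (verts G) \<and>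
    (H1c H \<delta> G \<gamma> \<or> L \<and> H1c_lollipop H \<delta> G \<gamma> \<or> H2c H \<delta> G \<gamma>)"
proof -
  define A where "A = {e \<in> arcs G. head G e = n}"
  \<comment> \<open>By \<open>into\<close> these are exactly the loops at \<open>n\<close>, so
    \<open>card P + card A\<close> is the degree with loops counted twice.\<close>
  define P where "P = {e \<in> arcs G. tail G e = n}"
  have fin: "finite (verts G)" "finite (arcs G)" using G by (auto simp: fin_digraph_iff)
  have wf: "\<And>e. e \<in> arcs G \<Longrightarrow> tail G e \<in> verts G \<and> head G e \<in> verts G" using G by (auto simp: fin_digraph_iff)
  have finA: "finite A" and finP: "finite P" using fin by (simp_all add: A_def P_def)
  have PA: "P \<subseteq> A" using into by (auto simp: A_def P_def)
  have AG: "A \<subseteq> arcs G" by (auto simp: A_def)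
  have deg': "card P + card A \<le> 3" using deg by (simp add: A_def P_def)
  let ?W = "verts G - {n}" and ?R = "arcs G - A"
  have cW: "int (card ?W) = int (card (verts G)) - 1"
    using card_Suc_Diff1[OF fin(1) n] by simp
  have cR: "int (card ?R) = int (card (arcs G)) - int (card A)"
    using card_Diff_subset[OF finA AG] card_mono[OF fin(2) AG] by simp
  have R: "tail G e \<in> ?W" "head G e \<in> ?W" if "e \<in> ?R" for e
    using that wf into by (auto simp: A_def)
  have sG: "sparse \<Phi> (cedge G \<gamma> ` arcs G)" and cG: "int (card (arcs G)) = 2 * int (card (verts G)) - k"
    using G by (auto simp: tight_graph_def)
  have sR: "sparse \<Phi> (cedge G \<gamma> ` ?R)" using sparse_subset[OF sG] by (metis Diff_subset image_mono)
  have tR: "touched (cedge G \<gamma> ` ?R) \<subseteq> ?W" unfolding touched_cedge using R by blast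
  have "card ?W \<noteq> 0" using cW big k by linarith
  then have W: "?W \<noteq> {}" "finite ?W" using fin by (metis card.empty, simp)
  have "int (card ?R) \<le> 2 * int (card ?W) - k" using sparse_card_le[OF sR tR W(2,1)] by simp
  then have A2: "card A \<ge> 2" using cR cW cG by linarith
  have ltW: "card ?W < card (verts G)" using card_Diff1_less[OF fin(1) n] .
  define H where "H = \<lparr> verts = ?W, arcs = ?R, tail = tail G, head = head G \<rparr>"
  have cH: "cedge H \<gamma> ` F = cedge G \<gamma> ` F" for F by (simp add: cedge_def H_def)
  have finH: "fin_digraph H" unfolding fin_digraph_iff using fin R by (auto simp: H_def)
  have tightH: "tight_graph H \<gamma>" if "card A = 2"
  proof -
    have "int (card ?R) = 2 * int (card ?W) - k" using that cR cW cG by linarith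
    \<comment> \<open>By \<open>big\<close> at least \<open>k\<close> vertices remain, hence at
      least 2k - k = k edges.\<close>
    moreover from this have "card ?R \<noteq> 0" using cW big k by linarith
    then have "?R \<noteq> {}" by (metis card.empty)
    ultimately show ?thesis using sR cH[of ?R] by (simp add: tight_graph_def H_def)
  qed
  have ext: "extends_by H \<gamma> (arcs H) n A G \<gamma>"
    using n AG by (auto simp: extends_by_def H_def)
  have finish: "?thesis" if "card A = 2" "H1c H \<gamma> G \<gamma> \<or> L \<and> H1c_lollipop H \<gamma> G \<gamma>"
    using finH tightH[OF that(1)] that(2) ltW by (intro exI[of _ H] exI[of _ \<gamma>]) (auto simp: H_def)
  have "card P \<le> card A" using PA finA by (rule card_mono[rotated])
  consider (H1) "card A = 2" "P = {}" | (lollipop) "card A = 2" "card P = 1" | (H2) "card A = 3" "P = {}"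
  proof -
    have "card P = 0 \<longleftrightarrow> P = {}" using finP by simp
    moreover have "card A = 2 \<and> card P = 0 \<or> card A = 2 \<and> card P = 1 \<or> card A = 3 \<and> card P = 0"
      using A2 deg' by linarith
    ultimately show thesis using that by metis
  qed
  then show ?thesis
  proof cases
    case H1
    then obtain e f where ef: "A = {e, f}" "e \<noteq> f" by (meson card_2_iff)
    then have eG: "e \<in> arcs G" "f \<in> arcs G" "head G e = n" "head G f = n" by (auto simp: A_def)
    then have t: "tail G e \<noteq> n" "tail G f \<noteq> n" using H1 by (auto simp: P_def)
    have "H1c H \<gamma> G \<gamma>" unfolding H1c_def
    proof (intro exI conjI)
      show "extends_by H \<gamma> (arcs H) n {e, f} G \<gamma>" using ext ef by simp
      show "tail G e = tail G f \<longrightarrow> \<gamma> e \<noteq> \<gamma> f"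
        using tight_graph_parallel[OF G(2) eG(1,2) ef(2)] eG t by simp
    qed (use eG ef t wf in \<open>auto simp: H_def\<close>)
    then show ?thesis using finish[OF H1(1)] by blast
  next
    case lollipop
    then obtain l where l: "P = {l}" by (meson card_1_singletonE)
    then have "l \<in> A" using PA by simp
    then obtain e where e: "A = {e, l}" "e \<noteq> l"
      using lollipop(1) by (metis card_2_iff insert_iff insert_commute singletonD)
    then have eG: "e \<in> arcs G" "l \<in> arcs G" "head G e = n" "head G l = n" by (auto simp: A_def)
    have t: "tail G e \<noteq> n" "tail G l = n" using l e eG by (auto simp: P_def)
    have loop: "\<gamma> l \<noteq> 0" "k = 1"
      using no_balanced_loop[OF sG, of "cedge G \<gamma> l"] eG t by auto
    \<comment> \<open>The remaining graph already has 2 \<open>card ?W\<close> - 1 edges. If the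
      count ignores a loop at \<open>n\<close>, there is no room for \<open>l\<close>.\<close>
    have L
    proof (rule ccontr)
      assume "\<not> L"
      let ?I = "cedge G \<gamma> ` ?R"
      have ne: "?R \<noteq> {}" using tightH[OF lollipop(1)] by (simp add: tight_graph_def H_def)
      have lR: "l \<notin> ?R" using e by simp
      have nR: "n \<notin> touched ?I" using tR by auto
      have "sparse \<Phi> (cedge G \<gamma> ` insert l ?R)"
        by (rule sparse_subset[OF sG]) (use eG in auto)
      then have "int (card (insert l ?R)) \<le> \<Phi> (ends ` cedge G \<gamma> ` insert l ?R)"
        using sparse_bound[of \<Phi> "cedge G \<gamma> ` insert l ?R"] by (simp only: card_cedge image_is_empty) simp
      moreover have "ends ` cedge G \<gamma> ` insert l ?R = insert (n, n) (ends ` ?I)"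
        using eG t by (simp add: ends_def)
      moreover have "\<Phi> (insert (n, n) (ends ` ?I)) \<le> 2 * int (card (touched ?I)) - 1"
        by (rule no_lollipop[OF \<open>\<not> L\<close> loop(2)]) (use fin ne nR in auto)
      moreover have "card (touched ?I) \<le> card ?W" using tR W(2) by (intro card_mono)
      moreover have "card (insert l ?R) = card ?R + 1" using lR fin by simp
      ultimately have "int (card ?R) + 1 \<le> 2 * int (card ?W) - 1" by simp
      then show False using cR cW cG lollipop(1) loop(2) by linarith
    qed
    have "H1c_lollipop H \<gamma> G \<gamma>" unfolding H1c_lollipop_def
    proof (intro exI conjI)
      show "extends_by H \<gamma> (arcs H) n {e, l} G \<gamma>" using ext e by simp
    qed (use eG e t wf loop in \<open>auto simp: H_def\<close>)
    then show ?thesis using finish[OF lollipop(1)] \<open>L\<close> by blast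
  next
    case H2
    let ?I = "cedge G \<gamma> ` ?R" and ?N = "cedge G \<gamma> ` A"
    have A: "head G e = n" "tail G e \<noteq> n" "e \<in> arcs G" "tail G e \<in> ?W" if "e \<in> A" for e
      using that H2 wf by (auto simp: A_def P_def)
    have IN: "?I \<union> ?N = cedge G \<gamma> ` arcs G" using AG by auto
    have "\<exists>x y z i. ?N = {x, y, z} \<and> x \<noteq> y \<and> x \<noteq> z \<and> y \<noteq> z \<and>
      sparse \<Phi> (insert (Edge (Inr i) (src x) (src y) (col x - col y)) ?I)"
    proof (rule unsplit_edge)
      show "sparse \<Phi> (?I \<union> ?N)" using sG IN by simp
      show "card ?N = 3" using H2 by simp
      show "n \<notin> touched ?I" using tR by auto
      show "\<And>e. e \<in> ?N \<Longrightarrow> dst e = n \<and> src e \<noteq> n" using A(1,2) by (metis cedge_sel(2,3) imageE)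
    qed auto
    then obtain x y z i where xyz: "?N = {x, y, z}" "x \<noteq> y" "x \<noteq> z" "y \<noteq> z"
      and sp: "sparse \<Phi> (insert (Edge (Inr i) (src x) (src y) (col x - col y)) ?I)" by blast
    have "x \<in> ?N" "y \<in> ?N" "z \<in> ?N" using xyz by auto
    then obtain a b c where abc: "x = cedge G \<gamma> a" "y = cedge G \<gamma> b" "z = cedge G \<gamma> c" "a \<in> A" "b \<in> A" "c \<in> A"
      by blast
    have d: "a \<noteq> b" "a \<noteq> c" "b \<noteq> c" using xyz abc by auto
    have A_eq: "A = {a, b, c}"
      using abc d H2(1) finA by (intro card_seteq[symmetric]) auto
    define K where "K = \<lparr> verts = ?W, arcs = insert a ?R, tail = (tail G)(a := tail G a), head = (head G)(a := tail G b) \<rparr>"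
    define \<delta> where "\<delta> = \<gamma>(a := \<gamma> a - \<gamma> b)"
    have aR: "a \<notin> ?R" using abc by simp
    have finK: "fin_digraph K" unfolding fin_digraph_iff using fin R A abc by (auto simp: K_def)
    \<comment> \<open>\<open>?x\<close> is the edge found by \<open>unsplit_edge\<close>, with an
      auxiliary label; \<open>?y\<close> is the same edge under its final name, and
      \<open>?f\<close> renames the former to the latter.\<close>
    let ?x = "Edge (Inr i) (src x) (src y) (col x - col y)" and ?y = "Edge (Inl a) (tail G a) (tail G b) (\<gamma> a - \<gamma> b)"
    let ?f = "\<lambda>t. if t = ?x then ?y else t"
    have xI: "?x \<notin> ?I" by (auto simp: cedge_def)
    have yI: "?y \<notin> ?I" using aR by (auto simp: cedge_def)
    have f_id: "?f t = t" if "t \<in> ?I" for t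
    proof -
      have "t \<noteq> ?x" using that xI by blast
      then show ?thesis by (rule if_not_P)
    qed
    have "?f ` ?I = (\<lambda>t. t) ` ?I" by (rule image_cong[OF refl]) (rule f_id)
    then have fI: "?f ` ?I = ?I" by (simp only: image_ident)
    have "sparse \<Phi> (?f ` insert ?x ?I)"
    proof (rule sparse_reorient[OF sp])
      have "inj_on ?f ?I \<longleftrightarrow> inj_on (\<lambda>t. t) ?I" by (rule inj_on_cong) (rule f_id)
      moreover have "?I - {?x} = ?I" using xI by blast
      ultimately show "inj_on ?f (insert ?x ?I)" unfolding inj_on_insert using yI fI by simp
    qed (auto simp: abc)
    moreover have "?f ` insert ?x ?I = insert ?y ?I" unfolding image_insert fI by simp
    moreover have "cedge K \<delta> ` arcs K = insert ?y ?I"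
    proof -
      have "cedge K \<delta> e = cedge G \<gamma> e" if "e \<in> ?R" for e
        using that aR by (auto simp: cedge_def K_def \<delta>_def)
      then have "cedge K \<delta> ` ?R = ?I" by (rule image_cong[OF refl])
      then show ?thesis by (simp add: K_def) (simp add: cedge_def \<delta>_def)
    qed
    ultimately have "sparse \<Phi> (cedge K \<delta> ` arcs K)" by simp
    moreover have "int (card (arcs K)) = int (card ?R) + 1" using aR fin by (simp add: K_def)
    then have "int (card (arcs K)) = 2 * int (card (verts K)) - k"
      using cR cW cG H2(1) by (simp add: K_def)
    moreover have "arcs K \<noteq> {}" by (simp add: K_def)
    ultimately have tightK: "tight_graph K \<delta>" by (simp add: tight_graph_def)
    have "H2c K \<delta> G \<gamma>" unfolding H2c_def
    proof (rule exI[of _ n], rule exI[of _ "tail G a"], rule exI[of _ "tail G b"], rule exI[of _ "tail G c"],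
        rule exI[of _ a], rule exI[of _ a], rule exI[of _ b], rule exI[of _ c], intro conjI)
      show "a \<in> arcs K" "tail G c \<in> verts K" using A abc by (auto simp: K_def)
      show "extends_by K \<delta> (arcs K - {a}) n {a, b, c} G \<gamma>"
        using n AG aR A_eq by (auto simp: extends_by_def K_def \<delta>_def)
      show "tail K a = tail G a" "head K a = tail G b" "\<gamma> a - \<gamma> b = \<delta> a" by (simp_all add: K_def \<delta>_def)
      show "tail G a = tail G b \<longrightarrow> \<gamma> a \<noteq> \<gamma> b" "tail G a = tail G c \<longrightarrow> \<gamma> a \<noteq> \<gamma> c"
        "tail G b = tail G c \<longrightarrow> \<gamma> b \<noteq> \<gamma> c"
        using tight_graph_parallel[OF G(2)] A abc d by metis+
    qed (use A abc d in auto)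
    then show ?thesis using finK tightK ltW by (intro exI[of _ K] exI[of _ \<delta>]) (auto simp: K_def)
  qed
qed

text \<open>The threshold \<open>k\<close> is the size of the base graphs: one vertex for
  \<open>k\<close> = 1 and two for \<open>k\<close> = 2. The flag \<open>L\<close> has to match the
  count: lollipops require the vertex count; without them, either \<open>k\<close> = 2 excludes
  loops altogether or the count must give no credit for an isolated loop.\<close>

theorem tight_graph_iff_constructible:
  fixes G :: "('v, 'e) pre_digraph" and \<gamma> :: "'e \<Rightarrow> 'g::ab_group_add"
  assumes G: "fin_digraph G"
    and base_tight: "\<And>(G :: ('v, 'e) pre_digraph) \<gamma>. B G \<gamma> \<Longrightarrow> fin_digraph G \<and> tight_graph G \<gamma>"
    and tight_base: "\<And>(G :: ('v, 'e) pre_digraph) \<gamma>. fin_digraph G \<Longrightarrow> tight_graph G \<gamma> \<Longrightarrow> int (card (verts G)) \<le> k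
      \<Longrightarrow> constructible B L G \<gamma>"
    and lollipop: "\<And>R. L \<Longrightarrow> \<Phi> R = 2 * int (card (Field R)) - 1"
    and no_lollipop: "\<And>R m. \<not> L \<Longrightarrow> k = 1 \<Longrightarrow> finite R \<Longrightarrow> R \<noteq> {} \<Longrightarrow> m \<notin> Field R
      \<Longrightarrow> \<Phi> (insert (m, m) R) \<le> 2 * int (card (Field R)) - 1"
  shows "tight_graph G \<gamma> \<longleftrightarrow> constructible B L G \<gamma>"
proof
  assume "constructible B L G \<gamma>"
  then have "fin_digraph G \<and> tight_graph G \<gamma>"
  proof (induction rule: constructible.induct)
    case (base G \<gamma>)
    then show ?case by (rule base_tight)
  next
    case (H1c H \<delta> G \<gamma>)
    then show ?case using H1c_tight_graph by blast
  next
    case (H1c_lollipop H \<delta> G \<gamma>)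
    then show ?case using H1c_lollipop_tight_graph[OF lollipop] by blast
  next
    case (H2c H \<delta> G \<gamma>)
    then show ?case using H2c_tight_graph by blast
  next
    case (reorients H \<delta> G \<gamma>)
    then show ?case using reorients_tight_graph reorients_fin_digraph by blast
  qed
  then show "tight_graph G \<gamma>" by simp
next
  assume "tight_graph G \<gamma>"
  then show "constructible B L G \<gamma>" using G
  proof (induction "card (verts G)" arbitrary: G \<gamma> rule: less_induct)
    case less
    show ?case
    proof (cases "int (card (verts G)) \<le> k")
      case True
      then show ?thesis using tight_base less.prems by blast
    next
      case False
      obtain n where n: "n \<in> verts G" "card {e \<in> arcs G. tail G e = n} + card {e \<in> arcs G. head G e = n} \<le> 3"
        using exists_low_degree[OF less.prems(2,1)] by auto
      obtain G' \<gamma>' where r: "reorients G \<gamma> G' \<gamma>'" and into: "\<forall>e \<in> arcs G'. tail G' e = n \<longrightarrow> head G' e = n"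
        using exists_reorientation_into[of G \<gamma> n] by auto
      have G': "verts G' = verts G" "arcs G' = arcs G" using r by (auto simp: reorients_def)
      have fin': "fin_digraph G'" "tight_graph G' \<gamma>'"
        using reorients_fin_digraph[OF r] reorients_tight_graph[OF r] less.prems by auto
      \<comment> \<open>The degree is the number of edges at \<open>n\<close> plus the number of
        loops at \<open>n\<close>, and neither depends on the orientation.\<close>
      have deg: "card {e \<in> arcs G'. tail G' e = n} + card {e \<in> arcs G'. head G' e = n} \<le> 3"
      proof -
        have fin: "finite (arcs G)" using less.prems by (simp add: fin_digraph_iff)
        have ends: "tail G' e = tail G e \<and> head G' e = head G e \<or> tail G' e = head G e \<and> head G' e = tail G e"
          if "e \<in> arcs G" for e using r that unfolding reorients_def by metis
        have eq: "card {e \<in> arcs G. t e = n} + card {e \<in> arcs G. h e = n} =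
          card {e \<in> arcs G. t e = n \<or> h e = n} + card {e \<in> arcs G. t e = n \<and> h e = n}" for t h
        proof -
          have "{e \<in> arcs G. t e = n} \<union> {e \<in> arcs G. h e = n} = {e \<in> arcs G. t e = n \<or> h e = n}"
            "{e \<in> arcs G. t e = n} \<inter> {e \<in> arcs G. h e = n} = {e \<in> arcs G. t e = n \<and> h e = n}" by auto
          then show ?thesis
            using card_Un_Int[of "{e \<in> arcs G. t e = n}" "{e \<in> arcs G. h e = n}"] fin by simp
        qed
        have "{e \<in> arcs G. tail G' e = n \<or> head G' e = n} = {e \<in> arcs G. tail G e = n \<or> head G e = n}"
          "{e \<in> arcs G. tail G' e = n \<and> head G' e = n} = {e \<in> arcs G. tail G e = n \<and> head G e = n}"
          by (rule Collect_cong, use ends in metis)+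
        then show ?thesis using n(2) eq[of "tail G" "head G"] eq[of "tail G'" "head G'"] G' by simp
      qed
      have "\<exists>H \<delta>. fin_digraph H \<and> tight_graph H \<delta> \<and> card (verts H) < card (verts G') \<and>
        (H1c H \<delta> G' \<gamma>' \<or> L \<and> H1c_lollipop H \<delta> G' \<gamma>' \<or> H2c H \<delta> G' \<gamma>')"
        by (rule remove_low_degree_vertex[OF fin' _ _ _ deg no_lollipop]) (use n G' False into in auto)
      then obtain H \<delta> where H: "fin_digraph H" "tight_graph H \<delta>" "card (verts H) < card (verts G)"
        "H1c H \<delta> G' \<gamma>' \<or> L \<and> H1c_lollipop H \<delta> G' \<gamma>' \<or> H2c H \<delta> G' \<gamma>'"
        unfolding G' by blast
      have "constructible B L H \<delta>" using less.hyps[OF H(3,2,1)] .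
      then have "constructible B L G' \<gamma>'" using H(4) by (auto intro: constructible.intros)
      then show ?thesis using reorients_sym[OF r] by (rule constructible.reorients)
    qed
  qed
qed

end


section \<open>Ranks\<close>

text \<open>Collects what is used of a scalar multiplication: the bound \<open>N\<close> makes the
  set under \<open>Max\<close> in \<open>lin_rank\<close> finite, and independence of nonzero
  singletons lets rank 0 detect the trivial subgroup.\<close>

definition rank_bounded :: "('k::comm_ring_1 \<Rightarrow> 'g::ab_group_add \<Rightarrow> 'g) \<Rightarrow> nat \<Rightarrow> bool" where
  "rank_bounded scale N \<longleftrightarrow> Modules.module scale \<and>
     (\<forall>B. finite B \<longrightarrow> \<not> Modules.module.dependent scale B \<longrightarrow> card B \<le> N) \<and>
     (\<forall>x. x \<noteq> 0 \<longrightarrow> \<not> Modules.module.dependent scale {x})"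

lemma lin_rank_properties:
  assumes scale: "rank_bounded scale N" and S: "0 \<in> S"
  shows "lin_rank scale S \<le> N" "lin_rank scale S = 0 \<longleftrightarrow> S = {0}"
proof -
  interpret Modules.module scale using scale by (simp add: rank_bounded_def)
  let ?C = "{card B | B. B \<subseteq> S \<and> finite B \<and> independent B}"
  have C: "?C \<subseteq> {..N}" using scale by (auto simp: rank_bounded_def)
  have fin: "finite ?C" by (rule finite_subset[OF C]) simp
  have "card {} \<in> ?C" by (intro CollectI exI[of _ "{}"]) (simp add: independent_empty)
  then have ne: "?C \<noteq> {}" by blast
  have rank: "lin_rank scale S = Max ?C" by (simp add: lin_rank_def)
  show "lin_rank scale S \<le> N" unfolding rank using Max_in[OF fin ne] C by blast
  show "lin_rank scale S = 0 \<longleftrightarrow> S = {0}"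
  proof
    assume 0: "lin_rank scale S = 0"
    have "x = 0" if "x \<in> S" for x
    proof (rule ccontr)
      assume "x \<noteq> 0"
      then have "independent {x}" using scale by (simp add: rank_bounded_def)
      then have "card {x} \<in> ?C" using that by (intro CollectI exI[of _ "{x}"]) auto
      then have "1 \<le> Max ?C" using Max_ge[OF fin] by fastforce
      then show False using 0 rank by simp
    qed
    then show "S = {0}" using S by blast
  next
    assume S0: "S = {0}"
    have "c = 0" if c: "c \<in> ?C" for c
    proof -
      obtain B where B: "c = card B" "B \<subseteq> {0}" "independent B" using c S0 by blast
      then have "B = {}" using dependent_zero by blast
      then show ?thesis using B by simp
    qed
    then show "lin_rank scale S = 0" unfolding rank using Max_in[OF fin ne] by blast
  qed
qed

text \<open>Treats the integers and the integers modulo p together, as integral domains: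
  commutativity y x - x y = 0 is a linear relation between any two elements.\<close>

lemma rank_bounded_mult: "rank_bounded ((*) :: 'a::idom \<Rightarrow> 'a \<Rightarrow> 'a) 1"
proof -
  interpret Modules.module "(*) :: 'a \<Rightarrow> 'a \<Rightarrow> 'a" by unfold_locales (auto simp: algebra_simps)
  have "card B \<le> 1" if fin: "finite B" and ind: "independent B" for B :: "'a set"
  proof (rule ccontr)
    assume "\<not> card B \<le> 1"
    then obtain x y where xy: "x \<in> B" "y \<in> B" "x \<noteq> y" using card_le_Suc0_iff_eq[OF fin] by auto
    let ?u = "\<lambda>v. if v = x then y else - x"
    have s: "(\<Sum>v\<in>{x, y}. ?u v * v) = 0" using xy(3) by (simp add: mult.commute)
    have "{x, y} \<subseteq> B" using xy by blast
    then have "?u x = 0" "?u y = 0" using independentD[OF ind _ _ s] by blast+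
    then show False using xy(3) by simp
  qed
  moreover have "independent {x}" if "x \<noteq> 0" for x :: 'a
    unfolding independent_explicit_module using that by (auto simp: subset_singleton_iff)
  ultimately show ?thesis unfolding rank_bounded_def using module_axioms by blast
qed

lemma module_int2_scale: "Modules.module int2_scale"
  by unfold_locales (auto simp: int2_scale_def algebra_simps)

text \<open>Any three vectors in the plane satisfy the Cramer relation, whose coefficients are the
  determinants \<open>d\<close>. Independence gives \<open>d x y = 0\<close>; then crossing over the
  first or the second coordinates relates \<open>x\<close> and \<open>y\<close> alone, which forces
  both to be zero.\<close>

lemma rank_bounded_int2: "rank_bounded int2_scale 2"
proof -
  interpret Modules.module int2_scale by (rule module_int2_scale)
  have "card B \<le> 2" if fin: "finite B" and ind: "independent B" for B
  proof (rule ccontr)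
    assume "\<not> card B \<le> 2"
    then obtain T where "T \<subseteq> B" "card T = 3"
      using obtain_subset_with_card_n[of 3 B] by (metis Suc_leI not_le numeral_3_eq_3 numeral_2_eq_2)
    then obtain x y z where xyz: "x \<noteq> y" "x \<noteq> z" "y \<noteq> z" "{x, y, z} \<subseteq> B" by (metis card_3_iff)
    define d where "d a b = fst a * snd b - snd a * fst b" for a b :: "int \<times> int"
    let ?u = "\<lambda>v. if v = x then d y z else if v = y then - d x z else d x y"
    have s: "(\<Sum>v\<in>{x, y, z}. int2_scale (?u v) v) = 0"
    proof -
      have "(\<Sum>v\<in>{x, y, z}. int2_scale (?u v) v) = int2_scale (d y z) x + (int2_scale (- d x z) y + int2_scale (d x y) z)"
        using xyz(1-3) xyz(1-3)[symmetric] by simp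
      also have "\<dots> = 0" by (simp add: int2_scale_def d_def prod_eq_iff algebra_simps)
      finally show ?thesis .
    qed
    have "?u z = 0" using independentD[OF ind _ xyz(4) s, of z] by blast
    then have dxy: "d x y = 0" using xyz by simp
    have xy: "{x, y} \<subseteq> B" using xyz by blast
    let ?v = "\<lambda>v. if v = x then fst y else - fst x" and ?w = "\<lambda>v. if v = x then snd y else - snd x"
    have "(\<Sum>v\<in>{x, y}. int2_scale (?v v) v) = int2_scale (fst y) x + int2_scale (- fst x) y"
      "(\<Sum>v\<in>{x, y}. int2_scale (?w v) v) = int2_scale (snd y) x + int2_scale (- snd x) y"
      using xyz(1) xyz(1)[symmetric] by simp_all
    moreover have "int2_scale (fst y) x + int2_scale (- fst x) y = 0" "int2_scale (snd y) x + int2_scale (- snd x) y = 0"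
      using dxy by (simp_all add: int2_scale_def d_def prod_eq_iff algebra_simps)
    ultimately have s: "(\<Sum>v\<in>{x, y}. int2_scale (?v v) v) = 0" "(\<Sum>v\<in>{x, y}. int2_scale (?w v) v) = 0"
      by simp_all
    have "?v x = 0" "?v y = 0" by (rule independentD[OF ind _ xy s(1)]; simp)+
    moreover have "?w x = 0" "?w y = 0" by (rule independentD[OF ind _ xy s(2)]; simp)+
    ultimately have "fst y = 0" "fst x = 0" "snd y = 0" "snd x = 0" using xyz(1)[symmetric] by simp_all
    then show False using xyz(1) by (simp add: prod_eq_iff)
  qed
  moreover have "independent {x}" if "x \<noteq> 0" for x
  proof -
    have "k = 0" if "int2_scale k x = 0" for k
      using that \<open>x \<noteq> 0\<close> by (auto simp: int2_scale_def prod_eq_iff)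
    then show ?thesis unfolding independent_explicit_module by (auto simp: subset_singleton_iff)
  qed
  ultimately show ?thesis unfolding rank_bounded_def using module_axioms by blast
qed


section \<open>Cycles and potentials\<close>

lemma traversals_simps [simp]:
  "verts (traversals G) = verts G" "arcs (traversals G) = arcs G \<times> UNIV"
  "tail (traversals G) (e, d) = (if d then tail G e else head G e)"
  "head (traversals G) (e, d) = (if d then head G e else tail G e)"
  by (simp_all add: traversals_def)

lemma wf_traversals: "wf_digraph G \<Longrightarrow> wf_digraph (traversals G)"
  by (auto simp: wf_digraph_def)

lemma rho_simps [simp]: "rho \<gamma> [] = 0" "rho \<gamma> ((e, d) # p) = (if d then \<gamma> e else - \<gamma> e) + rho \<gamma> p"
  by (simp_all add: rho_def)

lemma rho_walk:
  assumes "pre_digraph.cas (traversals G) u p v" "set p \<subseteq> F \<times> UNIV"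
    and \<pi>: "\<And>e. e \<in> F \<Longrightarrow> \<gamma> e = \<pi> (head G e) - \<pi> (tail G e)"
  shows "rho \<gamma> p = \<pi> v - \<pi> u"
  using assms(1,2)
proof (induction p arbitrary: u)
  case Nil
  then show ?case by (simp add: pre_digraph.cas.simps)
next
  case (Cons t p)
  obtain e d where t: "t = (e, d)" by force
  have e: "e \<in> F" "set p \<subseteq> F \<times> UNIV" using Cons.prems t by auto
  have "tail (traversals G) t = u" "pre_digraph.cas (traversals G) (head (traversals G) t) p v"
    using Cons.prems(1) by (simp_all add: pre_digraph.cas.simps)
  then show ?case using Cons.IH[OF _ e(2)] \<pi>[OF e(1)] by (auto simp: t)
qed

text \<open>A second use of an edge, in either direction, would return to the tail of its first use,
  which a path never revisits. This makes a path that is closed by one further edge an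
  \<open>undirected_cycle\<close>.\<close>

lemma apath_distinct_edges:
  assumes "wf_digraph G" "pre_digraph.apath (traversals G) u p v"
  shows "distinct (map fst p)"
  using assms(2)
proof (induction p arbitrary: u)
  case Nil
  then show ?case by simp
next
  case (Cons t p)
  interpret T: wf_digraph "traversals G" using wf_traversals assms(1) .
  have t: "T.apath (head (traversals G) t) p v" "tail (traversals G) t \<notin> set (T.awalk_verts (head (traversals G) t) p)"
    using Cons.prems by (auto simp: T.apath_Cons_iff)
  have "fst t \<notin> fst ` set p"
  proof
    assume "fst t \<in> fst ` set p"
    then obtain s where s: "s \<in> set p" "fst s = fst t" by auto
    have "tail (traversals G) s \<in> set (T.awalk_verts (head (traversals G) t) p)"
      "head (traversals G) s \<in> set (T.awalk_verts (head (traversals G) t) p)"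
      using T.awalk_verts_arc1[OF s(1)] T.awalk_verts_arc2[OF T.awalkI_apath[OF t(1)] s(1)] by blast+
    moreover have "tail (traversals G) t = tail (traversals G) s \<or> tail (traversals G) t = head (traversals G) s"
      using s(2) by (cases s; cases t) auto
    ultimately show False using t(2) by metis
  qed
  then show ?case using Cons.IH[OF t(1)] by simp
qed

lemma undirected_cycle_mono:
  assumes "undirected_cycle (G\<lparr>arcs := F\<rparr>) p" "F \<subseteq> F'"
  shows "undirected_cycle (G\<lparr>arcs := F'\<rparr>) p"
proof -
  let ?T = "traversals (G\<lparr>arcs := F\<rparr>)" and ?T' = "traversals (G\<lparr>arcs := F'\<rparr>)"
  have "compatible ?T ?T'" by (auto simp: compatible_def fun_eq_iff)
  note comp = compatible_cas[OF this] compatible_awalk_verts[OF this]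
  obtain u where u: "pre_digraph.awalk ?T u p u" "distinct (tl (pre_digraph.awalk_verts ?T u p))" "p \<noteq> []"
    "distinct (map fst p)"
    using assms(1) unfolding undirected_cycle_def pre_digraph.cycle_def by blast
  have "set p \<subseteq> F' \<times> UNIV" using u(1) assms(2) unfolding pre_digraph.awalk_def by auto
  then have "pre_digraph.awalk ?T' u p u" using u(1) comp unfolding pre_digraph.awalk_def by simp
  then show ?thesis
    unfolding undirected_cycle_def pre_digraph.cycle_def using u comp(2) by (metis (no_types, lifting))
qed

text \<open>Edges are added one at a time. If the ends of \<open>e\<close> are already connected, a
  path between them closes to a cycle, and its zero sum says that \<open>e\<close> fits the old
  potential. Otherwise the potential can be shifted on one side.\<close>

lemma potential_of_cycles:
  fixes \<gamma> :: "'e \<Rightarrow> 'g::ab_group_add"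
  assumes "finite F" "\<And>e. e \<in> F \<Longrightarrow> tail G e \<in> verts G \<and> head G e \<in> verts G"
    and "\<And>p. undirected_cycle (G\<lparr>arcs := F\<rparr>) p \<Longrightarrow> rho \<gamma> p = 0"
  shows "\<exists>\<pi>. \<forall>e \<in> F. \<gamma> e = \<pi> (head G e) - \<pi> (tail G e)"
  using assms
proof (induction F)
  case empty
  then show ?case by simp
next
  case (insert e F)
  let ?G = "G\<lparr>arcs := F\<rparr>" and ?G' = "G\<lparr>arcs := insert e F\<rparr>"
  have "rho \<gamma> p = 0" if "undirected_cycle ?G p" for p
    using insert.prems(2) undirected_cycle_mono[OF that] by blast
  then obtain \<pi> where \<pi>: "\<And>e. e \<in> F \<Longrightarrow> \<gamma> e = \<pi> (head G e) - \<pi> (tail G e)"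
    using insert.IH insert.prems(1) by blast
  have wf: "wf_digraph ?G" "wf_digraph ?G'" using insert.prems(1) by (auto simp: wf_digraph_def)
  interpret T: wf_digraph "traversals ?G" using wf_traversals[OF wf(1)] .
  interpret T': wf_digraph "traversals ?G'" using wf_traversals[OF wf(2)] .
  let ?u = "tail G e" and ?v = "head G e"
  have uv: "?u \<in> verts G" "?v \<in> verts G" using insert.prems(1) by auto
  show ?case
  proof (cases "?v \<rightarrow>\<^sup>*\<^bsub>traversals ?G\<^esub> ?u")
    case True
    then obtain q where q: "T.apath ?v q ?u" using T.reachable_apath by blast
    have "compatible (traversals ?G') (traversals ?G)" by (auto simp: compatible_def fun_eq_iff)
    note cas = compatible_cas[OF this] and vs = compatible_awalk_verts[OF this]
    have qF: "set q \<subseteq> F \<times> UNIV" "T.cas ?v q ?u" using q by (auto simp: T.apath_def T.awalk_def)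
    let ?p = "(e, True) # q"
    have "T'.cycle ?p"
      unfolding T'.cycle_def
    proof (intro exI[of _ ?u] conjI)
      show "T'.awalk ?u ?p ?u" unfolding T'.awalk_def using uv qF cas by auto
      show "distinct (tl (T'.awalk_verts ?u ?p))" using q vs by (simp add: T.apath_def)
    qed simp
    moreover have "distinct (map fst ?p)"
      using apath_distinct_edges[OF wf(1) q] qF(1) insert.hyps(2) by auto
    ultimately have "rho \<gamma> ?p = 0" using insert.prems(2)[of ?p] unfolding undirected_cycle_def by blast
    moreover have "rho \<gamma> q = \<pi> ?u - \<pi> ?v" by (rule rho_walk[OF qF(2,1)]) (simp add: \<pi>)
    ultimately have "\<gamma> e = \<pi> ?v - \<pi> ?u" by (simp add: algebra_simps eq_neg_iff_add_eq_0)
    then show ?thesis using \<pi> by blast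
  next
    case False
    define R where "R = {w. ?v \<rightarrow>\<^sup>*\<^bsub>traversals ?G\<^esub> w}"
    have closed: "tail G f \<in> R \<longleftrightarrow> head G f \<in> R" if f: "f \<in> F" for f
    proof -
      have "tail G f \<rightarrow>\<^bsub>traversals ?G\<^esub> head G f" "head G f \<rightarrow>\<^bsub>traversals ?G\<^esub> tail G f"
        by (rule T.dominatesI[of "(f, True)"], use f in \<open>simp_all add: arc_to_ends_def\<close>)
          (rule T.dominatesI[of "(f, False)"], use f in \<open>simp_all add: arc_to_ends_def\<close>)
      then show ?thesis unfolding R_def using T.reachable_adj_trans by blast
    qed
    have vR: "?v \<in> R" using uv by (simp add: R_def)
    have uR: "?u \<notin> R" using False by (simp add: R_def)
    \<comment> \<open>The constant is chosen to make \<open>e\<close> fit; no edge of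
      \<open>F\<close> leaves \<open>R\<close>, so the others still fit.\<close>
    define \<pi>' where "\<pi>' w = (if w \<in> R then \<pi> w + (\<gamma> e - \<pi> ?v + \<pi> ?u) else \<pi> w)" for w
    have "\<gamma> f = \<pi>' (head G f) - \<pi>' (tail G f)" if "f \<in> insert e F" for f
    proof (cases "f = e")
      case True
      then show ?thesis using vR uR by (simp add: \<pi>'_def)
    next
      case False
      then have f: "f \<in> F" using that by simp
      then show ?thesis using \<pi>[OF f] closed[OF f] by (simp add: \<pi>'_def)
    qed
    then show ?thesis by blast
  qed
qed

section \<open>Rank zero and potentials\<close>

lemma balanced_cedge:
  "balanced (cedge G \<gamma> ` F) \<longleftrightarrow> (\<exists>\<pi>. \<forall>e \<in> F. \<gamma> e = \<pi> (head G e) - \<pi> (tail G e))"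
  by (simp add: balanced_def)

lemma group_closure_trivial: "group_closure S = {0} \<longleftrightarrow> S \<subseteq> {0}"
proof
  assume "group_closure S = {0}"
  then show "S \<subseteq> {0}" using group_closure.base[of _ S] by blast
next
  assume S: "S \<subseteq> {0}"
  have "x = 0" if "x \<in> group_closure S" for x
    using that by (induction rule: group_closure.induct) (use S in auto)
  then show "group_closure S = {0}" by auto
qed

lemma rho_image_trivial:
  assumes "fin_digraph G"
  shows "rho_image G \<gamma> = {0} \<longleftrightarrow> balanced (cedge G \<gamma> ` arcs G)"
proof -
  have wf: "finite (arcs G)" "\<And>e. e \<in> arcs G \<Longrightarrow> tail G e \<in> verts G \<and> head G e \<in> verts G"
    using assms by (auto simp: fin_digraph_iff)
  have "rho_image G \<gamma> = {0} \<longleftrightarrow> (\<forall>p. undirected_cycle G p \<longrightarrow> rho \<gamma> p = 0)"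
    unfolding rho_image_def group_closure_trivial by blast
  also have "\<dots> \<longleftrightarrow> (\<exists>\<pi>. \<forall>e \<in> arcs G. \<gamma> e = \<pi> (head G e) - \<pi> (tail G e))"
  proof
    assume "\<forall>p. undirected_cycle G p \<longrightarrow> rho \<gamma> p = 0"
    then show "\<exists>\<pi>. \<forall>e \<in> arcs G. \<gamma> e = \<pi> (head G e) - \<pi> (tail G e)"
      using potential_of_cycles[of "arcs G" G \<gamma>] wf by simp
  next
    assume "\<exists>\<pi>. \<forall>e \<in> arcs G. \<gamma> e = \<pi> (head G e) - \<pi> (tail G e)"
    then obtain \<pi> where \<pi>: "\<And>e. e \<in> arcs G \<Longrightarrow> \<gamma> e = \<pi> (head G e) - \<pi> (tail G e)" by blast
    show "\<forall>p. undirected_cycle G p \<longrightarrow> rho \<gamma> p = 0"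
    proof (intro allI impI)
      fix p assume "undirected_cycle G p"
      then obtain u where "pre_digraph.awalk (traversals G) u p u"
        unfolding undirected_cycle_def pre_digraph.cycle_def by blast
      then have "pre_digraph.cas (traversals G) u p u" "set p \<subseteq> arcs G \<times> UNIV"
        by (simp_all add: pre_digraph.awalk_def)
      then show "rho \<gamma> p = 0" using rho_walk[of G u p u "arcs G" \<gamma> \<pi>] \<pi> by simp
    qed
  qed
  finally show ?thesis by (simp add: balanced_cedge)
qed

lemma rho_rank_eq_0_iff:
  assumes "fin_digraph G" "rank_bounded scale N"
  shows "rho_rank scale G \<gamma> = 0 \<longleftrightarrow> balanced (cedge G \<gamma> ` arcs G)"
  using rho_image_trivial[OF assms(1)] lin_rank_properties(2)[OF assms(2), of "rho_image G \<gamma>"]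
  by (simp add: rho_rank_def rho_image_def)

lemma rho_rank_le: "rank_bounded scale N \<Longrightarrow> rho_rank scale G \<gamma> \<le> N"
  using lin_rank_properties(1)[of scale N "rho_image G \<gamma>"] by (simp add: rho_rank_def rho_image_def)


section \<open>Connected components\<close>

definition component_verts :: "('v, 'e) pre_digraph \<Rightarrow> 'v set set" where
  "component_verts G = verts G // conn_rel (arcs_ends G)"

text \<open>Brings the components that appear in the bounds under the same relation as
  \<open>crank\<close>, so that both count the same classes.\<close>

lemma reachable_mk_symmetric_iff:
  assumes "wf_digraph G"
  shows "u \<rightarrow>\<^sup>*\<^bsub>with_proj (mk_symmetric G)\<^esub> v \<longleftrightarrow> u \<in> verts G \<and> (u, v) \<in> conn_rel (arcs_ends G)"
proof -
  let ?S = "with_proj (mk_symmetric G)"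
  have "arcs_ends ?S = arcs_ends G \<union> (arcs_ends G)\<inverse>"
    by (auto simp: parcs_mk_symmetric arcs_ends_conv)
  then have eq: "conn_rel (arcs_ends G) = (arcs_ends ?S)\<^sup>*" by (simp add: conn_rel_def)
  interpret S: wf_digraph ?S using assms by (auto simp: wf_digraph_def parcs_mk_symmetric)
  have "u \<rightarrow>\<^sup>*\<^bsub>?S\<^esub> v" if "u \<in> verts G" "(u, v) \<in> (arcs_ends ?S)\<^sup>*"
    using that(2) by (induction rule: rtrancl_induct) (use that(1) S.reachable_adj_trans in auto)
  then show ?thesis unfolding eq using S.reachable_in_verts[of u v] reachable_rtranclI[of ?S u v] by auto
qed

lemma component_verts_partition:
  assumes "fin_digraph G"
  shows "\<Union> (component_verts G) = verts G" "finite (component_verts G)"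
    "\<And>X Y. X \<in> component_verts G \<Longrightarrow> Y \<in> component_verts G \<Longrightarrow> X \<noteq> Y \<Longrightarrow> X \<inter> Y = {}"
    "\<And>X. X \<in> component_verts G \<Longrightarrow> X \<noteq> {}"
    "\<And>X e. X \<in> component_verts G \<Longrightarrow> e \<in> arcs G \<Longrightarrow> tail G e \<in> X \<longleftrightarrow> head G e \<in> X"
proof -
  let ?E = "conn_rel (arcs_ends G)"
  have V: "u \<in> verts G \<longleftrightarrow> v \<in> verts G" if "(u, v) \<in> ?E" for u v
    by (rule conn_rel_closed[OF _ that]) (use assms in \<open>auto simp: fin_digraph_iff arcs_ends_conv\<close>)
  show "\<Union> (component_verts G) = verts G"
    unfolding component_verts_def quotient_def using V by (auto intro: conn_rel_refl)
  show "finite (component_verts G)"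
    using assms by (simp add: component_verts_def quotient_def fin_digraph_iff)
  show "X \<noteq> {}" if "X \<in> component_verts G" for X
    using that by (auto simp: component_verts_def quotient_def intro: conn_rel_refl)
  show "X \<inter> Y = {}" if XY: "X \<in> component_verts G" "Y \<in> component_verts G" "X \<noteq> Y" for X Y
  proof -
    obtain x y where xy: "X = ?E `` {x}" "Y = ?E `` {y}"
      using XY(1,2) unfolding component_verts_def quotient_def by blast
    show ?thesis
    proof (rule ccontr)
      assume "X \<inter> Y \<noteq> {}"
      then obtain z where "(x, z) \<in> ?E" "(y, z) \<in> ?E" using xy by blast
      then have "(x, y) \<in> ?E" using conn_rel_sym conn_rel_trans by metis
      then show False using XY(3) xy conn_rel_class_eq_iff by metis
    qed
  qed
  show "tail G e \<in> X \<longleftrightarrow> head G e \<in> X" if X: "X \<in> component_verts G" and e: "e \<in> arcs G" for X e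
  proof -
    obtain x where x: "X = ?E `` {x}" using X unfolding component_verts_def quotient_def by blast
    have "(tail G e, head G e) \<in> ?E" using e by (intro conn_rel_base) (auto simp: arcs_ends_conv)
    then show ?thesis unfolding x
      using conn_rel_trans[of x "tail G e" "arcs_ends G" "head G e"] conn_rel_sym[of "tail G e" "head G e"]
        conn_rel_trans[of x "head G e" "arcs_ends G" "tail G e"] by auto
  qed
qed

lemma sccs_verts_mk_symmetric:
  assumes "fin_digraph G"
  shows "pre_digraph.sccs_verts (with_proj (mk_symmetric G)) = component_verts G"
proof -
  let ?E = "conn_rel (arcs_ends G)"
  have wf: "wf_digraph G" using assms by (simp add: fin_digraph_def)
  note reach = reachable_mk_symmetric_iff[OF wf]
  have V: "u \<in> verts G \<longleftrightarrow> v \<in> verts G" if "(u, v) \<in> ?E" for u v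
    by (rule conn_rel_closed[OF _ that]) (use assms in \<open>auto simp: fin_digraph_iff arcs_ends_conv\<close>)
  show ?thesis
  proof (rule subset_antisym; rule subsetI)
    fix X assume "X \<in> pre_digraph.sccs_verts (with_proj (mk_symmetric G))"
    then have X: "X \<noteq> {}" "\<And>u v. u \<in> X \<Longrightarrow> v \<in> X \<Longrightarrow> u \<in> verts G \<and> (u, v) \<in> ?E"
      "\<And>u v. u \<in> X \<Longrightarrow> v \<notin> X \<Longrightarrow> \<not> (u \<in> verts G \<and> (u, v) \<in> ?E) \<or> \<not> (v \<in> verts G \<and> (v, u) \<in> ?E)"
      unfolding pre_digraph.sccs_verts_def reach by blast+
    then obtain x where x: "x \<in> X" by auto
    have "X = ?E `` {x}"
    proof (rule subset_antisym; rule subsetI)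
      fix y assume "y \<in> X"
      then show "y \<in> ?E `` {x}" using X(2)[OF x] by simp
    next
      fix y assume "y \<in> ?E `` {x}"
      then have xy: "(x, y) \<in> ?E" by simp
      then have "(y, x) \<in> ?E" by (rule conn_rel_sym)
      then show "y \<in> X" using X(3)[OF x, of y] X(2)[OF x x] xy V[OF xy] by blast
    qed
    then show "X \<in> component_verts G"
      unfolding component_verts_def using X(2)[OF x x] by (auto intro: quotientI)
  next
    fix X assume X: "X \<in> component_verts G"
    then obtain x where x: "x \<in> verts G" "X = ?E `` {x}"
      unfolding component_verts_def quotient_def by blast
    have "X \<noteq> {}" using component_verts_partition(4)[OF assms X] .
    moreover have "u \<in> verts G \<and> (u, v) \<in> ?E" if "u \<in> X" "v \<in> X" for u v
    proof -
      have xuv: "(x, u) \<in> ?E" "(x, v) \<in> ?E" using that x by auto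
      then show ?thesis using V[OF xuv(1)] x(1) conn_rel_trans[OF conn_rel_sym[OF xuv(1)] xuv(2)] by blast
    qed
    moreover have "\<not> (u, v) \<in> ?E" if "u \<in> X" "v \<notin> X" for u v
      using that conn_rel_trans[of x u "arcs_ends G" v] x by auto
    ultimately show "X \<in> pre_digraph.sccs_verts (with_proj (mk_symmetric G))"
      unfolding pre_digraph.sccs_verts_def reach by blast
  qed
qed

lemma connected_iff:
  assumes "fin_digraph G"
  shows "connected G \<longleftrightarrow> verts G \<noteq> {} \<and> (\<forall>u \<in> verts G. \<forall>v \<in> verts G. (u, v) \<in> conn_rel (arcs_ends G))"
proof -
  have "wf_digraph G" using assms by (simp add: fin_digraph_def)
  then show ?thesis unfolding connected_def strongly_connected_def reachable_mk_symmetric_iff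
    by (auto simp: reachable_mk_symmetric_iff)
qed

lemma connected_component_verts:
  assumes "fin_digraph G" "connected G"
  shows "component_verts G = {verts G}"
proof -
  let ?E = "conn_rel (arcs_ends G)"
  have c: "verts G \<noteq> {}" "\<And>u v. u \<in> verts G \<Longrightarrow> v \<in> verts G \<Longrightarrow> (u, v) \<in> ?E"
    using connected_iff[OF assms(1)] assms(2) by auto
  have "v \<in> verts G" if "u \<in> verts G" "(u, v) \<in> ?E" for u v
    using component_verts_partition(1)[OF assms(1)] that unfolding component_verts_def quotient_def by blast
  then have "?E `` {u} = verts G" if "u \<in> verts G" for u using c that by blast
  then show ?thesis unfolding component_verts_def quotient_def using c(1) by auto
qed

text \<open>Testing the tail is enough, because components are closed under arcs.\<close>

definition comp_arcs :: "('v, 'e) pre_digraph \<Rightarrow> 'v set \<Rightarrow> 'e set" where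
  "comp_arcs G X = {e \<in> arcs G. tail G e \<in> X}"

lemma arcs_component:
  assumes "fin_digraph G" "X \<in> component_verts G"
  shows "arcs (G \<restriction> X) = comp_arcs G X"
  using component_verts_partition(5)[OF assms] by (auto simp: comp_arcs_def)

lemma fin_digraph_component: "fin_digraph G \<Longrightarrow> X \<in> component_verts G \<Longrightarrow> fin_digraph (G \<restriction> X)"
  using component_verts_partition(1)[of G] unfolding fin_digraph_iff
  by (auto intro: finite_subset[of X "verts G"])

abbreviation balanced_comps :: "('v, 'e) pre_digraph \<Rightarrow> ('e \<Rightarrow> 'g::ab_group_add) \<Rightarrow> 'v set set" where
  "balanced_comps G \<gamma> \<equiv> {X \<in> component_verts G. balanced (cedge G \<gamma> ` comp_arcs G X)}"

abbreviation unbalanced_comps :: "('v, 'e) pre_digraph \<Rightarrow> ('e \<Rightarrow> 'g::ab_group_add) \<Rightarrow> 'v set set" where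
  "unbalanced_comps G \<gamma> \<equiv> {X \<in> component_verts G. \<not> balanced (cedge G \<gamma> ` comp_arcs G X)}"

text \<open>Ranks are at most 2, so the components of rank 1 or 2 are exactly those without a
  potential. Components are subgraphs in the bounds and vertex sets here; inducing is
  injective.\<close>

lemma num_comps_balanced:
  assumes G: "fin_digraph G" and scale: "rank_bounded scale N" "N \<le> 2"
  shows "num_comps scale 0 G \<gamma> = int (card (balanced_comps G \<gamma>))"
    "num_comps scale 1 G \<gamma> + num_comps scale 2 G \<gamma> = int (card (unbalanced_comps G \<gamma>))"
proof -
  let ?r = "\<lambda>X. rho_rank scale (G \<restriction> X) \<gamma>"
  have num: "num_comps scale i G \<gamma> = int (card {X \<in> component_verts G. ?r X = i})" for i
  proof -
    have "{H \<in> conn_components G. rho_rank scale H \<gamma> = i} = (\<lambda>X. G \<restriction> X) ` {X \<in> component_verts G. ?r X = i}"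
      unfolding conn_components_def sccs_verts_mk_symmetric[OF G] by auto
    moreover have "inj_on (\<lambda>X. G \<restriction> X) {X \<in> component_verts G. ?r X = i}"
      by (rule inj_onI) (metis induce_subgraph_verts)
    ultimately show ?thesis unfolding num_comps_def by (simp add: card_image)
  qed
  have ced: "cedge (G \<restriction> X) \<gamma> = cedge G \<gamma>" for X by (simp add: cedge_def fun_eq_iff)
  have r0: "?r X = 0 \<longleftrightarrow> balanced (cedge G \<gamma> ` comp_arcs G X)" if "X \<in> component_verts G" for X
    using rho_rank_eq_0_iff[OF fin_digraph_component[OF G that] scale(1), of \<gamma>] arcs_component[OF G that]
    unfolding ced by simp
  show "num_comps scale 0 G \<gamma> = int (card (balanced_comps G \<gamma>))"
    unfolding num using r0 by (metis (no_types, lifting) Collect_cong)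
  have "unbalanced_comps G \<gamma> = {X \<in> component_verts G. ?r X = 1} \<union> {X \<in> component_verts G. ?r X = 2}"
  proof -
    have "(?r X = 0) = (\<not> (?r X = 1 \<or> ?r X = 2))" for X
      using rho_rank_le[OF scale(1), of "G \<restriction> X" \<gamma>] scale(2) by auto
    then show ?thesis using r0 by blast
  qed
  moreover have "finite {X \<in> component_verts G. ?r X = i}" for i
    using component_verts_partition(2)[OF G] by simp
  moreover have "{X \<in> component_verts G. ?r X = 1} \<inter> {X \<in> component_verts G. ?r X = 2} = {}" by auto
  ultimately show "num_comps scale 1 G \<gamma> + num_comps scale 2 G \<gamma> = int (card (unbalanced_comps G \<gamma>))"
    unfolding num by (simp add: card_Un_disjoint)
qed

lemma sum_over_components:
  assumes G: "fin_digraph G"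
  shows "card (verts G) = (\<Sum>X\<in>component_verts G. card X)"
    "card (arcs G) = (\<Sum>X\<in>component_verts G. card (comp_arcs G X))"
proof -
  note part = component_verts_partition[OF G]
  have fin: "finite (verts G)" "finite (arcs G)" using G by (auto simp: fin_digraph_iff)
  have "finite X" if "X \<in> component_verts G" for X
    using that part(1) fin(1) by (metis Union_upper finite_subset)
  then show "card (verts G) = (\<Sum>X\<in>component_verts G. card X)"
    using card_Union_disjoint[of "component_verts G"] part(1,3) by (auto simp: pairwise_def disjnt_def)
  have "arcs G = (\<Union>X\<in>component_verts G. comp_arcs G X)"
    using part(1) G by (auto simp: comp_arcs_def fin_digraph_iff)
  moreover have "card (\<Union>X\<in>component_verts G. comp_arcs G X) = (\<Sum>X\<in>component_verts G. card (comp_arcs G X))"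
  proof (rule card_UN_disjoint)
    show "\<forall>X\<in>component_verts G. \<forall>Y\<in>component_verts G. X \<noteq> Y \<longrightarrow> comp_arcs G X \<inter> comp_arcs G Y = {}"
      using part(3) by (fastforce simp: comp_arcs_def)
  qed (use part(2) fin in \<open>auto simp: comp_arcs_def\<close>)
  ultimately show "card (arcs G) = (\<Sum>X\<in>component_verts G. card (comp_arcs G X))" by simp
qed


section \<open>Sparse graphs\<close>

lemma edge_induced_simps [simp]:
  "arcs (edge_induced G F) = F" "cedge (edge_induced G F) \<gamma> = cedge G \<gamma>"
  by (simp_all add: edge_induced_def cedge_def fun_eq_iff)

lemma verts_edge_induced: "verts (edge_induced G F) = touched (cedge G \<gamma> ` F)"
  by (simp add: edge_induced_def touched_cedge)

lemma arcs_ends_edge_induced: "arcs_ends (edge_induced G F) = ends ` cedge G \<gamma> ` F"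
  by (simp add: arcs_ends_conv edge_induced_def image_image ends_def)

lemma fin_digraph_edge_induced: "finite F \<Longrightarrow> fin_digraph (edge_induced G F)"
  by (simp add: fin_digraph_iff edge_induced_def)

lemma card_component_verts_edge_induced:
  assumes "finite F" "F \<noteq> {}"
  shows "1 \<le> card (component_verts (edge_induced G F))"
proof -
  note part = component_verts_partition[OF fin_digraph_edge_induced[OF assms(1), of G]]
  have "component_verts (edge_induced G F) \<noteq> {}" using part(1) assms(2) by (auto simp: edge_induced_def)
  then show ?thesis using part(2) by (simp add: Suc_le_eq card_gt_0_iff)
qed

lemma card_component_verts:
  assumes "fin_digraph G"
  shows "card (component_verts G) = card (balanced_comps G \<gamma>) + card (unbalanced_comps G \<gamma>)"
proof -
  have "component_verts G = balanced_comps G \<gamma> \<union> unbalanced_comps G \<gamma>" by blast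
  moreover have "balanced_comps G \<gamma> \<inter> unbalanced_comps G \<gamma> = {}" by blast
  moreover have "finite (balanced_comps G \<gamma>)" "finite (unbalanced_comps G \<gamma>)"
    using component_verts_partition(2)[OF assms] by simp_all
  ultimately show ?thesis using card_Un_disjoint[of "balanced_comps G \<gamma>" "unbalanced_comps G \<gamma>"] by simp
qed

lemma unbalanced_comps_empty:
  assumes "balanced (cedge G \<gamma> ` arcs G)"
  shows "unbalanced_comps G \<gamma> = {}"
proof -
  have "cedge G \<gamma> ` comp_arcs G X \<subseteq> cedge G \<gamma> ` arcs G" for X by (auto simp: comp_arcs_def)
  then show ?thesis using balanced_subset[OF assms] by blast
qed

lemma connected_unbalanced_comps:
  assumes G: "fin_digraph G" "connected G" "\<not> balanced (cedge G \<gamma> ` arcs G)"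
  shows "balanced_comps G \<gamma> = {}" "unbalanced_comps G \<gamma> = {verts G}"
proof -
  have "comp_arcs G (verts G) = arcs G" using G(1) by (auto simp: comp_arcs_def fin_digraph_iff)
  then show "balanced_comps G \<gamma> = {}" "unbalanced_comps G \<gamma> = {verts G}"
    using connected_component_verts[OF G(1,2)] G(3) by auto
qed

lemma sparse_cedgeI:
  assumes "finite (arcs G)"
    and "\<And>F. F \<subseteq> arcs G \<Longrightarrow> F \<noteq> {} \<Longrightarrow> int (card F) \<le> \<Phi> (ends ` cedge G \<gamma> ` F)"
    and "\<And>F. F \<subseteq> arcs G \<Longrightarrow> F \<noteq> {} \<Longrightarrow> balanced (cedge G \<gamma> ` F)
      \<Longrightarrow> int (card F) \<le> 2 * int (card (touched (cedge G \<gamma> ` F))) - 3"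
  shows "sparse \<Phi> (cedge G \<gamma> ` arcs G)"
  unfolding sparse_def
proof (intro conjI allI impI)
  show "finite (cedge G \<gamma> ` arcs G)" using assms(1) by simp
next
  fix F' assume "F' \<subseteq> cedge G \<gamma> ` arcs G" "F' \<noteq> {}"
  then obtain F where F: "F \<subseteq> arcs G" "F' = cedge G \<gamma> ` F" "F \<noteq> {}" by (metis image_is_empty subset_imageE)
  show "int (card F') \<le> \<Phi> (ends ` F')" using assms(2)[OF F(1,3)] unfolding F(2) by simp
  assume "balanced F'"
  then show "int (card F') \<le> 2 * int (card (touched F')) - 3"
    using assms(3)[OF F(1,3)] unfolding F(2) by simp
qed

section \<open>Connectedness and componentwise counting\<close>

context count
begin

text \<open>Supplies the connectedness and the nonzero rank that belong to the definitions of the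
  three graph classes: a separation costs another \<open>k\<close>, and a balanced graph has at most
  2n - 3 < 2n - k edges.\<close>

lemma tight_graph_connected:
  assumes G: "fin_digraph G" "tight_graph G \<gamma>"
  shows "connected G" "\<not> balanced (cedge G \<gamma> ` arcs G)"
proof -
  have wf: "finite (verts G)" "\<And>e. e \<in> arcs G \<Longrightarrow> tail G e \<in> verts G \<and> head G e \<in> verts G"
    using G(1) by (auto simp: fin_digraph_iff)
  have sG: "sparse \<Phi> (cedge G \<gamma> ` arcs G)" and ne: "arcs G \<noteq> {}"
    and cG: "int (card (arcs G)) = 2 * int (card (verts G)) - k"
    using G(2) by (auto simp: tight_graph_def)
  have tG: "touched (cedge G \<gamma> ` arcs G) \<subseteq> verts G" unfolding touched_cedge using wf(2) by blast
  show "connected G"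
  proof (rule ccontr)
    let ?E = "conn_rel (arcs_ends G)"
    assume "\<not> connected G"
    moreover have "verts G \<noteq> {}" using ne wf(2) by blast
    ultimately obtain u v where uv: "u \<in> verts G" "v \<in> verts G" "(u, v) \<notin> ?E"
      using connected_iff[OF G(1)] by blast
    have "int (card (cedge G \<gamma> ` arcs G)) < 2 * int (card (verts G)) - k"
    proof (rule sparse_connected[OF sG wf(1) tG])
      have "u \<in> ?E `` {u}" by simp
      then show "verts G \<inter> ?E `` {u} \<noteq> {}" using uv(1) by blast
      show "verts G - ?E `` {u} \<noteq> {}" using uv by blast
      have E: "?E `` {u} \<in> component_verts G" unfolding component_verts_def using uv(1) by (rule quotientI)
      show "src e \<in> ?E `` {u} \<longleftrightarrow> dst e \<in> ?E `` {u}" if e: "e \<in> cedge G \<gamma> ` arcs G" for e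
      proof -
        obtain a where a: "a \<in> arcs G" "e = cedge G \<gamma> a" using e by blast
        show ?thesis unfolding a(2) cedge_sel by (rule component_verts_partition(5)[OF G(1) E a(1)])
      qed
    qed
    then show False using cG by simp
  qed
  show "\<not> balanced (cedge G \<gamma> ` arcs G)"
  proof
    assume "balanced (cedge G \<gamma> ` arcs G)"
    then have "int (card (cedge G \<gamma> ` arcs G)) \<le> 2 * int (card (touched (cedge G \<gamma> ` arcs G))) - 3"
      using sparse_balanced_bound[OF sG] ne by blast
    moreover have "card (touched (cedge G \<gamma> ` arcs G)) \<le> card (verts G)" using tG wf(1) by (intro card_mono)
    ultimately show False using cG k unfolding card_cedge by linarith
  qed
qed

text \<open>An edge-induced graph has no isolated vertices, so every component contains an arc and
  both bounds apply to it.\<close>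

lemma sparse_component:
  assumes sG: "sparse \<Phi> (cedge G \<gamma> ` arcs G)" and F: "finite F" "F \<subseteq> arcs G"
    and X: "X \<in> component_verts (edge_induced G F)"
  shows "comp_arcs (edge_induced G F) X \<noteq> {}"
    "touched (cedge G \<gamma> ` comp_arcs (edge_induced G F) X) \<subseteq> X"
    "int (card (comp_arcs (edge_induced G F) X)) \<le>
      2 * int (card X) - (if balanced (cedge G \<gamma> ` comp_arcs (edge_induced G F) X) then 3 else k)"
proof -
  let ?H = "edge_induced G F"
  have H: "fin_digraph ?H" using F(1) by (rule fin_digraph_edge_induced)
  note part = component_verts_partition[OF H]
  let ?C = "comp_arcs ?H X"
  have th: "tail ?H = tail G" "head ?H = head G" by (simp_all add: edge_induced_def)
  have CF: "?C \<subseteq> F" by (auto simp: comp_arcs_def)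
  obtain x where x: "x \<in> X" using part(4)[OF X] by blast
  then have "x \<in> verts ?H" using part(1) X by blast
  then obtain e where "e \<in> F" "x = tail G e \<or> x = head G e" by (auto simp: edge_induced_def)
  then have "e \<in> ?C" using x part(5)[OF X, of e] by (auto simp: comp_arcs_def th)
  then show ne: "?C \<noteq> {}" by blast
  show t: "touched (cedge G \<gamma> ` ?C) \<subseteq> X"
    using part(5)[OF X] unfolding touched_cedge by (auto simp: comp_arcs_def th)
  have finX: "finite X" using part(1) X H by (metis Union_upper fin_digraph_iff finite_subset)
  have sC: "sparse \<Phi> (cedge G \<gamma> ` ?C)" by (rule sparse_subset[OF sG]) (use CF F(2) in blast)
  have "int (card ?C) \<le> 2 * int (card X) - k"
    using sparse_card_le[OF sC t finX] x by auto
  moreover have "int (card ?C) \<le> 2 * int (card X) - 3" if "balanced (cedge G \<gamma> ` ?C)"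
  proof -
    have "int (card ?C) \<le> 2 * int (card (touched (cedge G \<gamma> ` ?C))) - 3"
      using sparse_balanced_bound[OF sC _ that] ne by simp
    moreover have "card (touched (cedge G \<gamma> ` ?C)) \<le> card X" using t finX by (intro card_mono)
    ultimately show ?thesis by linarith
  qed
  ultimately show "int (card ?C) \<le> 2 * int (card X) - (if balanced (cedge G \<gamma> ` ?C) then 3 else k)" by simp
qed

lemma sparse_sum_components:
  assumes sG: "sparse \<Phi> (cedge G \<gamma> ` arcs G)" and F: "finite F" "F \<subseteq> arcs G"
  shows "int (card F) \<le> 2 * num_verts (edge_induced G F) - 3 * int (card (balanced_comps (edge_induced G F) \<gamma>))
    - k * int (card (unbalanced_comps (edge_induced G F) \<gamma>))"
proof -
  let ?H = "edge_induced G F"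
  let ?P = "\<lambda>X. balanced (cedge G \<gamma> ` comp_arcs ?H X)" and ?C = "component_verts ?H"
  have H: "fin_digraph ?H" using F(1) by (rule fin_digraph_edge_induced)
  note part = component_verts_partition[OF H]
  have "int (card F) = (\<Sum>X\<in>?C. int (card (comp_arcs ?H X)))"
    using sum_over_components(2)[OF H] by simp
  also have "\<dots> \<le> (\<Sum>X\<in>?C. 2 * int (card X) - (if ?P X then 3 else k))"
    by (rule sum_mono) (rule sparse_component(3)[OF sG F])
  also have "\<dots> = 2 * (\<Sum>X\<in>?C. int (card X)) - (\<Sum>X\<in>?C. if ?P X then 3 else k)"
    by (simp add: sum_subtractf sum_distrib_left)
  also have "(\<Sum>X\<in>?C. int (card X)) = num_verts ?H"
    using sum_over_components(1)[OF H] by (simp add: num_verts_def)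
  also have "(\<Sum>X\<in>?C. if ?P X then 3 else k) = 3 * int (card {X \<in> ?C. ?P X}) + k * int (card {X \<in> ?C. \<not> ?P X})"
  proof -
    have "?C \<inter> {X. ?P X} = {X \<in> ?C. ?P X}" "?C \<inter> - {X. ?P X} = {X \<in> ?C. \<not> ?P X}" by blast+
    then show ?thesis using sum.If_cases[OF part(2), of ?P "\<lambda>_. 3" "\<lambda>_. k"] by simp
  qed
  finally show ?thesis by simp
qed

end

section \<open>The component bounds expressed by counts\<close>

interpretation ross: count "\<lambda>R. 2 * int (card (Field R)) - 2" 2
  by (rule count_vertices) simp

interpretation cone: count "\<lambda>R. 2 * int (card (Field R)) - 1" 1
  by (rule count_vertices) simp

interpretation cylinder: count "\<lambda>R. 2 * crank R + 1" 1
  by (rule count_crank)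

lemma ross_bound_eq:
  "fin_digraph G \<Longrightarrow> ross_bound G \<gamma> =
    2 * num_verts G - 3 * int (card (balanced_comps G \<gamma>)) - 2 * int (card (unbalanced_comps G \<gamma>))"
  using num_comps_balanced[OF _ rank_bounded_int2, of G \<gamma>] by (simp add: ross_bound_def)

lemma cone_laman_bound_eq:
  "fin_digraph G \<Longrightarrow> cone_laman_bound G \<gamma> =
    2 * num_verts G - 3 * int (card (balanced_comps G \<gamma>)) - int (card (unbalanced_comps G \<gamma>))"
  using num_comps_balanced[OF _ rank_bounded_mult, of G \<gamma>] by (simp add: cone_laman_bound_def)

lemma cylinder_laman_bound_eq:
  "fin_digraph G \<Longrightarrow> cylinder_laman_bound G \<gamma> = 2 * num_verts G + int (rho_rank (*) G \<gamma>)
    - 3 * int (card (balanced_comps G \<gamma>)) - 2 * int (card (unbalanced_comps G \<gamma>))"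
  using num_comps_balanced[OF _ rank_bounded_mult, of G \<gamma>] by (simp add: cylinder_laman_bound_def)

text \<open>A nonempty set has at least one component, and a balanced set has only balanced ones, so
  the component bound subtracts at least \<open>k\<close>, respectively 3. Conversely, the bounds of
  the components are summed.\<close>

lemma sparse_vertices_iff:
  assumes G: "fin_digraph G" and k: "k = 1 \<or> k = 2"
  shows "sparse (\<lambda>R. 2 * int (card (Field R)) - k) (cedge G \<gamma> ` arcs G) \<longleftrightarrow>
    (\<forall>F \<subseteq> arcs G. int (card F) \<le> 2 * num_verts (edge_induced G F)
      - 3 * int (card (balanced_comps (edge_induced G F) \<gamma>)) - k * int (card (unbalanced_comps (edge_induced G F) \<gamma>)))"
    (is "?L \<longleftrightarrow> (\<forall>F \<subseteq> arcs G. ?b F)")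
proof
  have fin: "finite (arcs G)" using G by (simp add: fin_digraph_iff)
  assume sp: "\<forall>F \<subseteq> arcs G. ?b F"
  show ?L
  proof (rule sparse_cedgeI[OF fin])
    fix F assume F: "F \<subseteq> arcs G" "F \<noteq> {}"
    let ?H = "edge_induced G F"
    have finF: "finite F" using finite_subset[OF F(1) fin] .
    have c: "1 \<le> card (balanced_comps ?H \<gamma>) + card (unbalanced_comps ?H \<gamma>)"
      using card_component_verts_edge_induced[OF finF F(2), of G]
      unfolding card_component_verts[OF fin_digraph_edge_induced[OF finF], of G \<gamma>] .
    have b: "int (card F) \<le> 2 * int (card (touched (cedge G \<gamma> ` F))) - 3 * int (card (balanced_comps ?H \<gamma>))
      - k * int (card (unbalanced_comps ?H \<gamma>))"
      using sp[rule_format, OF F(1)] unfolding num_verts_def verts_edge_induced[of G F \<gamma>] .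
    show "int (card F) \<le> 2 * int (card (touched (cedge G \<gamma> ` F))) - k"
    proof (cases "k = 1")
      case True
      then show ?thesis using b c by simp
    next
      case False
      then have "k = 2" using k by simp
      then show ?thesis using b c by simp
    qed
    assume "balanced (cedge G \<gamma> ` F)"
    then have "unbalanced_comps ?H \<gamma> = {}" using unbalanced_comps_empty[of ?H \<gamma>] by simp
    then have u: "card (unbalanced_comps ?H \<gamma>) = 0" by (metis card.empty)
    show "int (card F) \<le> 2 * int (card (touched (cedge G \<gamma> ` F))) - 3"
      using b c unfolding u by simp
  qed
next
  interpret count "\<lambda>R. 2 * int (card (Field R)) - k" k using k by (rule count_vertices)
  assume sp: ?L
  show "\<forall>F \<subseteq> arcs G. ?b F"
  proof (intro allI impI)
    fix F assume F: "F \<subseteq> arcs G"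
    have "finite F" using finite_subset[OF F] G by (simp add: fin_digraph_iff)
    then show "?b F" by (rule sparse_sum_components[OF sp _ F])
  qed
qed

lemma ross_sparse_iff:
  assumes G: "fin_digraph G"
  shows "ross_sparse G \<gamma> \<longleftrightarrow> sparse (\<lambda>R. 2 * int (card (Field R)) - 2) (cedge G \<gamma> ` arcs G)"
proof -
  have "fin_digraph (edge_induced G F)" if "F \<subseteq> arcs G" for F
    by (rule fin_digraph_edge_induced, rule finite_subset[OF that]) (use G in \<open>simp add: fin_digraph_iff\<close>)
  then show ?thesis
    unfolding ross_sparse_def num_edges_def using sparse_vertices_iff[OF G, of 2 \<gamma>] by (simp add: ross_bound_eq)
qed

lemma cone_laman_sparse_iff:
  assumes G: "fin_digraph G"
  shows "cone_laman_sparse G \<gamma> \<longleftrightarrow> sparse (\<lambda>R. 2 * int (card (Field R)) - 1) (cedge G \<gamma> ` arcs G)"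
proof -
  have "fin_digraph (edge_induced G F)" if "F \<subseteq> arcs G" for F
    by (rule fin_digraph_edge_induced, rule finite_subset[OF that]) (use G in \<open>simp add: fin_digraph_iff\<close>)
  then show ?thesis
    unfolding cone_laman_sparse_def num_edges_def using sparse_vertices_iff[OF G, of 1 \<gamma>] by (simp add: cone_laman_bound_eq)
qed

lemma crank_Union_le:
  assumes "finite \<X>" "\<And>X. X \<in> \<X> \<Longrightarrow> finite (f X)"
  shows "crank (\<Union>X\<in>\<X>. f X) \<le> (\<Sum>X\<in>\<X>. crank (f X))"
  using assms
proof (induction \<X>)
  case (insert X \<X>)
  have "finite (\<Union>Y\<in>\<X>. f Y)" using insert by auto
  then have "crank (f X \<union> (\<Union>Y\<in>\<X>. f Y)) + crank (f X \<inter> (\<Union>Y\<in>\<X>. f Y)) \<le> crank (f X) + crank (\<Union>Y\<in>\<X>. f Y)"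
    using insert.prems by (intro crank_submodular) auto
  moreover have "0 \<le> crank (f X \<inter> (\<Union>Y\<in>\<X>. f Y))"
    using crank_mono[of "f X \<inter> (\<Union>Y\<in>\<X>. f Y)" "{}"] insert.prems by simp
  moreover have "crank (\<Union>Y\<in>\<X>. f Y) \<le> (\<Sum>Y\<in>\<X>. crank (f Y))" using insert by simp
  ultimately show ?case using insert.hyps by simp
qed simp

text \<open>As the rank is at most 1 and \<open>crank\<close> is vertices minus components, the
  bound implies the count. Conversely, balanced components are counted one by one, but the
  unbalanced ones all at once, because the summand \<open>rho_rank\<close> is shared by all of
  them.\<close>

lemma cylinder_laman_sparse_iff:
  assumes G: "fin_digraph G"
  shows "cylinder_laman_sparse G \<gamma> \<longleftrightarrow> sparse (\<lambda>R. 2 * crank R + 1) (cedge G \<gamma> ` arcs G)"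
proof
  have fin: "finite (arcs G)" using G by (simp add: fin_digraph_iff)
  assume sp: "cylinder_laman_sparse G \<gamma>"
  show "sparse (\<lambda>R. 2 * crank R + 1) (cedge G \<gamma> ` arcs G)"
  proof (rule sparse_cedgeI[OF fin])
    fix F assume F: "F \<subseteq> arcs G" "F \<noteq> {}"
    let ?H = "edge_induced G F"
    have H: "fin_digraph ?H" using finite_subset[OF F(1) fin] by (rule fin_digraph_edge_induced)
    have "int (card F) \<le> cylinder_laman_bound ?H \<gamma>"
      using sp F(1) unfolding cylinder_laman_sparse_def num_edges_def by simp
    then have b: "int (card F) \<le> 2 * int (card (touched (cedge G \<gamma> ` F))) + int (rho_rank (*) ?H \<gamma>)
      - 3 * int (card (balanced_comps ?H \<gamma>)) - 2 * int (card (unbalanced_comps ?H \<gamma>))"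
      unfolding cylinder_laman_bound_eq[OF H] num_verts_def verts_edge_induced[of G F \<gamma>] by simp
    have "crank (ends ` cedge G \<gamma> ` F) = int (card (touched (cedge G \<gamma> ` F))) - int (card (component_verts ?H))"
      unfolding crank_def component_verts_def arcs_ends_edge_induced[of G F \<gamma>] verts_edge_induced[of G F \<gamma>] by simp
    then show "int (card F) \<le> 2 * crank (ends ` cedge G \<gamma> ` F) + 1"
      using b card_component_verts[OF H, of \<gamma>] rho_rank_le[OF rank_bounded_mult, of ?H \<gamma>] by linarith
    assume bal: "balanced (cedge G \<gamma> ` F)"
    then have "unbalanced_comps ?H \<gamma> = {}" using unbalanced_comps_empty[of ?H \<gamma>] by simp
    then have "card (unbalanced_comps ?H \<gamma>) = 0" by (metis card.empty)
    moreover have "rho_rank (*) ?H \<gamma> = 0" using rho_rank_eq_0_iff[OF H rank_bounded_mult, of \<gamma>] bal by simp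
    ultimately show "int (card F) \<le> 2 * int (card (touched (cedge G \<gamma> ` F))) - 3"
      using b card_component_verts_edge_induced[OF finite_subset[OF F(1) fin] F(2), of G] card_component_verts[OF H, of \<gamma>] by linarith
  qed
next
  assume sp: "sparse (\<lambda>R. 2 * crank R + 1) (cedge G \<gamma> ` arcs G)"
  show "cylinder_laman_sparse G \<gamma>" unfolding cylinder_laman_sparse_def
  proof (intro allI impI)
    fix F assume F: "F \<subseteq> arcs G"
    have fin: "finite F" using F G finite_subset by (metis fin_digraph_iff)
    let ?H = "edge_induced G F"
    have H: "fin_digraph ?H" using fin by (rule fin_digraph_edge_induced)
    note part = component_verts_partition[OF H]
    note comp = cylinder.sparse_component[OF sp fin F]
    let ?B = "balanced_comps ?H \<gamma>" and ?U = "unbalanced_comps ?H \<gamma>"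
    let ?a = "\<lambda>X. comp_arcs ?H X"
    have finBU: "finite ?B" "finite ?U" using part(2) by simp_all
    have BU: "component_verts ?H = ?B \<union> ?U" "?B \<inter> ?U = {}" by blast+
    have a: "?a X \<subseteq> F" for X by (auto simp: comp_arcs_def)
    have split: "(\<Sum>X\<in>component_verts ?H. f X) = (\<Sum>X\<in>?B. f X) + (\<Sum>X\<in>?U. f X)" for f :: "'a set \<Rightarrow> int"
      using BU finBU sum.union_disjoint[of ?B ?U f] by metis
    have F_sum: "int (card F) = (\<Sum>X\<in>?B. int (card (?a X))) + (\<Sum>X\<in>?U. int (card (?a X)))"
      using sum_over_components(2)[OF H] split[of "\<lambda>X. int (card (?a X))"] by simp
    have V_sum: "num_verts ?H = (\<Sum>X\<in>?B. int (card X)) + (\<Sum>X\<in>?U. int (card X))"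
      using sum_over_components(1)[OF H] split[of "\<lambda>X. int (card X)"] by (simp add: num_verts_def)
    have "(\<Sum>X\<in>?B. int (card (?a X))) \<le> (\<Sum>X\<in>?B. 2 * int (card X) - 3)"
      using comp(3) by (intro sum_mono) fastforce
    then have B_le: "(\<Sum>X\<in>?B. int (card (?a X))) \<le> 2 * (\<Sum>X\<in>?B. int (card X)) - 3 * int (card ?B)"
      by (simp add: sum_subtractf sum_distrib_left)
    have U_le: "(\<Sum>X\<in>?U. int (card (?a X))) \<le> 2 * (\<Sum>X\<in>?U. int (card X)) - 2 * int (card ?U) + int (rho_rank (*) ?H \<gamma>)"
    proof (cases "?U = {}")
      case True
      then show ?thesis unfolding True by simp
    next
      case False
      then obtain Y where Y: "Y \<in> ?U" by blast
      have "\<not> balanced (cedge ?H \<gamma> ` arcs ?H)"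
        using Y unbalanced_comps_empty[of ?H \<gamma>] by blast
      then have r: "rho_rank (*) ?H \<gamma> \<noteq> 0" using rho_rank_eq_0_iff[OF H rank_bounded_mult, of \<gamma>] by blast
      \<comment> \<open>Counting the unbalanced components separately would give a surplus of 1 for
        each of them; one application of the count to their union gives a single 1, which the
        nonzero rank pays for.\<close>
      let ?A = "\<Union>X\<in>?U. ?a X"
      have disj: "\<forall>X\<in>?U. \<forall>Y\<in>?U. X \<noteq> Y \<longrightarrow> ?a X \<inter> ?a Y = {}"
        using part(3) by (fastforce simp: comp_arcs_def)
      have "card ?A = (\<Sum>X\<in>?U. card (?a X))"
        by (rule card_UN_disjoint[OF finBU(2) _ disj]) (use a fin finite_subset in blast)
      then have cA: "int (card ?A) = (\<Sum>X\<in>?U. int (card (?a X)))" by simp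
      have AF: "?A \<subseteq> F" using a by blast
      have "?a Y \<noteq> {}" using comp(1) Y by blast
      then have "?A \<noteq> {}" using Y by blast
      have "sparse (\<lambda>R. 2 * crank R + 1) (cedge G \<gamma> ` ?A)"
        by (rule sparse_subset[OF sp]) (use AF F in blast)
      then have "int (card ?A) \<le> 2 * crank (ends ` cedge G \<gamma> ` ?A) + 1"
        using sparse_bound[of _ "cedge G \<gamma> ` ?A"] \<open>?A \<noteq> {}\<close> by (metis (no_types, lifting) card_cedge image_is_empty)
      moreover have "crank (ends ` cedge G \<gamma> ` ?A) \<le> (\<Sum>X\<in>?U. int (card X) - 1)"
      proof -
        have "ends ` cedge G \<gamma> ` ?A = (\<Union>X\<in>?U. ends ` cedge G \<gamma> ` ?a X)" by (simp only: image_UN)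
        also have "crank \<dots> \<le> (\<Sum>X\<in>?U. crank (ends ` cedge G \<gamma> ` ?a X))"
          by (rule crank_Union_le[OF finBU(2)]) (use a fin finite_subset in blast)
        also have "\<dots> \<le> (\<Sum>X\<in>?U. int (card X) - 1)"
        proof (rule sum_mono)
          fix X assume "X \<in> ?U"
          then have X: "X \<in> component_verts ?H" by blast
          have finX: "finite X" using part(1) X H by (metis Union_upper fin_digraph_iff finite_subset)
          have "crank (ends ` cedge G \<gamma> ` ?a X) \<le> int (card (touched (cedge G \<gamma> ` ?a X))) - 1"
            by (rule crank_upper) (use finite_subset[OF a fin] comp(1)[OF X] in auto)
          moreover have "card (touched (cedge G \<gamma> ` ?a X)) \<le> card X" using comp(2)[OF X] finX by (intro card_mono)
          ultimately show "crank (ends ` cedge G \<gamma> ` ?a X) \<le> int (card X) - 1" by linarith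
        qed
        finally show ?thesis .
      qed
      moreover have "(\<Sum>X\<in>?U. int (card X) - 1) = (\<Sum>X\<in>?U. int (card X)) - int (card ?U)"
        by (simp add: sum_subtractf)
      ultimately show ?thesis using r cA by linarith
    qed
    show "num_edges ?H \<le> cylinder_laman_bound ?H \<gamma>"
      unfolding cylinder_laman_bound_eq[OF H] num_edges_def edge_induced_simps(1) using F_sum V_sum B_le U_le by linarith
  qed
qed


section \<open>Tight graphs\<close>

lemma ross_graph_iff:
  assumes G: "fin_digraph G"
  shows "ross_graph G \<gamma> \<longleftrightarrow> ross.tight_graph G \<gamma>"
proof -
  have bound: "ross_bound G \<gamma> = 2 * int (card (verts G)) - 2"
    if "connected G" "\<not> balanced (cedge G \<gamma> ` arcs G)"
    unfolding ross_bound_eq[OF G] num_verts_def connected_unbalanced_comps[OF G that] by simp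
  have "arcs G \<noteq> {}" if "\<not> balanced (cedge G \<gamma> ` arcs G)" using that by (auto simp: balanced_def)
  then show ?thesis
    using bound ross.tight_graph_connected[OF G, of \<gamma>] ross_sparse_iff[OF G, of \<gamma>]
      rho_rank_eq_0_iff[OF G rank_bounded_int2, of \<gamma>]
    unfolding ross_graph_def ross.tight_graph_def num_edges_def by metis
qed

lemma cone_laman_graph_iff:
  assumes G: "fin_digraph G"
  shows "cone_laman_graph G \<gamma> \<longleftrightarrow> cone.tight_graph G \<gamma>"
proof -
  have bound: "cone_laman_bound G \<gamma> = 2 * int (card (verts G)) - 1"
    if "connected G" "\<not> balanced (cedge G \<gamma> ` arcs G)"
    unfolding cone_laman_bound_eq[OF G] num_verts_def connected_unbalanced_comps[OF G that] by simp
  have "arcs G \<noteq> {}" if "\<not> balanced (cedge G \<gamma> ` arcs G)" using that by (auto simp: balanced_def)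
  then show ?thesis
    using bound cone.tight_graph_connected[OF G, of \<gamma>] cone_laman_sparse_iff[OF G, of \<gamma>]
      rho_rank_eq_0_iff[OF G rank_bounded_mult, of \<gamma>]
    unfolding cone_laman_graph_def cone.tight_graph_def num_edges_def by metis
qed

lemma cylinder_laman_graph_iff:
  assumes G: "fin_digraph G"
  shows "cylinder_laman_graph G \<gamma> \<longleftrightarrow> cylinder.tight_graph G \<gamma>"
proof -
  have bound: "cylinder_laman_bound G \<gamma> = 2 * int (card (verts G)) - 1"
    if "connected G" "\<not> balanced (cedge G \<gamma> ` arcs G)"
  proof -
    have "rho_rank (*) G \<gamma> = 1"
      using rho_rank_eq_0_iff[OF G rank_bounded_mult, of \<gamma>] rho_rank_le[OF rank_bounded_mult, of G \<gamma>] that(2) by linarith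
    then show ?thesis
      unfolding cylinder_laman_bound_eq[OF G] num_verts_def connected_unbalanced_comps[OF G that] by simp
  qed
  have "arcs G \<noteq> {}" if "\<not> balanced (cedge G \<gamma> ` arcs G)" using that by (auto simp: balanced_def)
  then show ?thesis
    using bound cylinder.tight_graph_connected[OF G, of \<gamma>] cylinder_laman_sparse_iff[OF G, of \<gamma>]
      rho_rank_eq_0_iff[OF G rank_bounded_mult, of \<gamma>]
    unfolding cylinder_laman_graph_def cylinder.tight_graph_def num_edges_def by metis
qed

section \<open>Base graphs\<close>

lemma ross_base_tight:
  assumes "ross_base G \<gamma>"
  shows "fin_digraph G \<and> ross.tight_graph G \<gamma>"
proof -
  obtain u v e f where *: "u \<noteq> v" "e \<noteq> f" "verts G = {u, v}" "arcs G = {e, f}"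
    "tail G e = u" "head G e = v" "tail G f = u" "head G f = v" "\<gamma> e \<noteq> \<gamma> f"
    using assms unfolding ross_base_def by blast
  \<comment> \<open>The base arises from the empty edge set by adding the vertex \<open>v\<close>
    with its two edges.\<close>
  have "sparse (\<lambda>R. 2 * int (card (Field R)) - 2) ({} \<union> cedge G \<gamma> ` arcs G)"
    by (rule ross.sparse_add_vertex[of _ v]) (use * in \<open>auto simp: cedge_def\<close>)
  then show ?thesis using * by (auto simp: ross.tight_graph_def fin_digraph_iff)
qed

context count
begin

lemma loop_base_tight:
  assumes "loop_base G \<gamma>" "k = 1"
  shows "fin_digraph G \<and> tight_graph G \<gamma>"
proof -
  obtain v l where *: "verts G = {v}" "arcs G = {l}" "tail G l = v" "head G l = v" "\<gamma> l \<noteq> 0"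
    using assms(1) unfolding loop_base_def by blast
  have "\<not> balanced {cedge G \<gamma> l}" using * by (auto simp: balanced_def)
  moreover have "ends (cedge G \<gamma> l) = (v, v)" using * by (simp add: ends_def)
  ultimately have "sparse \<Phi> {cedge G \<gamma> l}"
    unfolding sparse_def using single[of v v] assms(2) by (auto simp: subset_singleton_iff)
  then show ?thesis unfolding tight_graph_def fin_digraph_iff using * assms(2) by simp
qed

lemma tight_loop_base:
  assumes G: "fin_digraph G" "tight_graph G \<gamma>" and small: "int (card (verts G)) \<le> 1" and k1: "k = 1"
  shows "loop_base G \<gamma>"
proof -
  have fin: "finite (verts G)" "finite (arcs G)" using G by (auto simp: fin_digraph_iff)
  have sG: "sparse \<Phi> (cedge G \<gamma> ` arcs G)" and ne: "arcs G \<noteq> {}"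
    and cG: "int (card (arcs G)) = 2 * int (card (verts G)) - 1"
    using G(2) k1 unfolding tight_graph_def by simp_all
  have "card (arcs G) \<ge> 1" using fin ne by (simp add: Suc_le_eq card_gt_0_iff)
  then have "card (verts G) = 1" using small cG by linarith
  then have "card (verts G) = 1" "card (arcs G) = 1" using cG by simp_all
  then obtain v l where vl: "verts G = {v}" "arcs G = {l}" by (metis card_1_singletonE)
  then have e: "tail G l = v" "head G l = v" using G(1) by (auto simp: fin_digraph_iff)
  have "\<gamma> l \<noteq> 0" using no_balanced_loop(1)[OF sG, of "cedge G \<gamma> l"] vl e by simp
  then show ?thesis unfolding loop_base_def using vl e by blast
qed

end

text \<open>From n \<le> 2 and 2n - 2 \<ge> 1 there are two vertices and two edges. Loops are
  impossible for \<open>k\<close> = 2, so after a reorientation both edges run from \<open>u\<close>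
  to \<open>v\<close>, and parallel edges differ in color.\<close>

lemma tight_ross_base:
  assumes G: "fin_digraph G" "ross.tight_graph G \<gamma>" and small: "int (card (verts G)) \<le> 2"
  shows "constructible ross_base False G \<gamma>"
proof -
  have fin: "finite (verts G)" "finite (arcs G)" using G by (auto simp: fin_digraph_iff)
  have sG: "sparse (\<lambda>R. 2 * int (card (Field R)) - 2) (cedge G \<gamma> ` arcs G)" and ne: "arcs G \<noteq> {}"
    and cG: "int (card (arcs G)) = 2 * int (card (verts G)) - 2"
    using G(2) by (auto simp: ross.tight_graph_def)
  have "card (arcs G) \<ge> 1" using fin ne by (simp add: Suc_le_eq card_gt_0_iff)
  then have "card (verts G) = 2" using small cG by linarith
  then have c: "card (verts G) = 2" "card (arcs G) = 2" using cG by simp_all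
  obtain u v where uv: "verts G = {u, v}" "u \<noteq> v" using c(1) by (meson card_2_iff)
  obtain G' \<gamma>' where r: "reorients G \<gamma> G' \<gamma>'" and into: "\<forall>e \<in> arcs G'. tail G' e = v \<longrightarrow> head G' e = v"
    using exists_reorientation_into[of G \<gamma> v] by auto
  have G': "verts G' = verts G" "arcs G' = arcs G" using r by (auto simp: reorients_def)
  have t': "fin_digraph G'" "ross.tight_graph G' \<gamma>'"
    using reorients_fin_digraph[OF r G(1)] ross.reorients_tight_graph[OF r G(2)] by auto
  obtain e f where ef: "arcs G' = {e, f}" "e \<noteq> f" using c(2) G' by (metis card_2_iff)
  have loopless: "tail G' e \<noteq> head G' e" if "e \<in> arcs G'" for e
    using ross.no_balanced_loop(2)[of "cedge G' \<gamma>' ` arcs G'" "cedge G' \<gamma>' e"] t'(2) that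
    by (auto simp: ross.tight_graph_def)
  have ends: "tail G' e = u \<and> head G' e = v" if "e \<in> arcs G'" for e
  proof -
    have "tail G' e \<in> {u, v}" "head G' e \<in> {u, v}" using t'(1) that G'(1) uv(1) by (auto simp: fin_digraph_iff)
    then show ?thesis using loopless[OF that] into that by auto
  qed
  have "\<gamma>' e \<noteq> \<gamma>' f"
    using ross.tight_graph_parallel[OF t'(2), of e f] ends ef uv(2) by simp
  then have "ross_base G' \<gamma>'" unfolding ross_base_def using uv ef ends G' by blast
  then show ?thesis using constructible.base constructible.reorients reorients_sym[OF r] by metis
qed

theorem theorem1:
  fixes G :: "('v, 'e) pre_digraph"
    and \<gamma>\<^sub>1 :: "'e \<Rightarrow> int \<times> int"
    and \<gamma>\<^sub>2 :: "'e \<Rightarrow> 'p::prime_card mod_ring"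
    and \<gamma>\<^sub>3 :: "'e \<Rightarrow> int"
  assumes "fin_digraph G"
  shows "(ross_graph G \<gamma>\<^sub>1 \<longleftrightarrow> ross_constructible G \<gamma>\<^sub>1) \<and>
    (odd CARD('p) \<longrightarrow> (cone_laman_graph G \<gamma>\<^sub>2 \<longleftrightarrow> cone_laman_constructible G \<gamma>\<^sub>2)) \<and>
    (cylinder_laman_graph G \<gamma>\<^sub>3 \<longleftrightarrow> cylinder_laman_constructible G \<gamma>\<^sub>3)"
proof (intro conjI impI)
  show "ross_graph G \<gamma>\<^sub>1 \<longleftrightarrow> ross_constructible G \<gamma>\<^sub>1"
    unfolding ross_graph_iff[OF assms] ross_constructible_iff
    \<comment> \<open>The condition on lollipops speaks of \<open>k\<close> = 1 and holds vacuously
      here.\<close>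
    by (rule ross.tight_graph_iff_constructible[OF assms ross_base_tight tight_ross_base]) auto
  show "cone_laman_graph G \<gamma>\<^sub>2 \<longleftrightarrow> cone_laman_constructible G \<gamma>\<^sub>2"
    unfolding cone_laman_graph_iff[OF assms] cone_laman_constructible_iff
    by (rule cone.tight_graph_iff_constructible[OF assms cone.loop_base_tight
          constructible.base[OF cone.tight_loop_base]]) simp_all
  show "cylinder_laman_graph G \<gamma>\<^sub>3 \<longleftrightarrow> cylinder_laman_constructible G \<gamma>\<^sub>3"
    unfolding cylinder_laman_graph_iff[OF assms] cylinder_laman_constructible_iff
  proof (rule cylinder.tight_graph_iff_constructible[OF assms cylinder.loop_base_tight
        constructible.base[OF cylinder.tight_loop_base]])
    fix R :: "'v rel" and m
    assume R: "finite R" "R \<noteq> {}"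
    \<comment> \<open>A loop at a new vertex adds no graphic rank, which is why the cylinder family
      has no lollipop move.\<close>
    have "crank (insert (m, m) R) = crank R" using crank_insert[OF R(1), of m m] by simp
    then show "2 * crank (insert (m, m) R) + 1 \<le> 2 * int (card (Field R)) - 1" using crank_upper[OF R] by simp
  qed simp_all
qed

end
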